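(* Let $0<\alpha<1$ and $p,q>0$. (1) The following conditions are equivalent: (i) $SG_{\alpha,p}(A,B)\prec_{\log}R_{\alpha,q}(A,B)$ for all $A,B\ge0$ with $s(A)\ge s(B)$; (ii) $SG_{\alpha,p}(A,B)\prec_{\log}R_{\alpha,q}(A,B)$ for all $A,B\in\mathbb{M}_2^{++}$; (iii) $p/q\le\min\{\alpha,1-\alpha\}$. (2) The following conditions are equivalent: (i) $R_{\alpha,q}(A,B)\prec_{\log}SG_{\alpha,p}(A,B)$ for all $A,B\ge0$ with $s(A)\ge s(B)$; (ii) $R_{\alpha,q}(A,B)\prec_{\log}SG_{\alpha,p}(A,B)$ for all $A,B\in\mathbb{M}_2^{++}$; (iii) $p/q\ge\max\{\alpha,1-\alpha\}$.
   Context: Notation: $\mathbb{M}_n$ is the set of $n\times n$ complex matrices, $\mathbb{M}_n^+$ (resp. $\mathbb{M}_n^{++}$) the positive semidefinite (resp. positive definite) ones. $A\ge0$ (resp. $A>0$) means $A\in\mathbb{M}_n^+$ (resp. $A\in\mathbb{M}_n^{++}$) for some $n\in\mathbb{N}$; matrices appearing together have the same size. $s(A)$ is the support projection of $A\ge0$. $A^{-1}$ denotes the generalized inverse (the inverse on the support of $A$, zero on the kernel), and $A^r:=(A^{-1})^{-r}$ for $r<0$. For $A,B\ge0$ with $s(A)\ge s(B)$, $A\#B:=A^{1/2}(A^{-1/2}BA^{-1/2})^{1/2}A^{1/2}$. The quasi $\alpha$-weighted spectral geometric mean is, for $s(A)\ge s(B)$, $SG_{\alpha,p}(A,B):=\bigl((A^{-p}\#B^p)^{\alpha}A^p(A^{-p}\#B^p)^{\alpha}\bigr)^{1/p}$.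 The Rényi mean is $R_{\alpha,p}(A,B):=\bigl(A^{\frac{1-\alpha}{2}p}B^{\alpha p}A^{\frac{1-\alpha}{2}p}\bigr)^{1/p}$. Log-majorization: for $X,Y\in\mathbb{M}_n^+$ with eigenvalues $\lambda_1(\cdot)\ge\dots\ge\lambda_n(\cdot)$ counted with multiplicity, $X\prec_{\log}Y$ means $\prod_{i=1}^k\lambda_i(X)\le\prod_{i=1}^k\lambda_i(Y)$ for $1\le k\le n$, with equality for $k=n$. *)

theory Defs
  imports
    "Jordan_Normal_Form.Schur_Decomposition"
    "Jordan_Normal_Form.Matrix_Kernel"
begin

definition hermitian_mat :: "nat \<Rightarrow> complex mat \<Rightarrow> bool" where
  "hermitian_mat n A \<longleftrightarrow> A \<in> carrier_mat n n \<and> mat_adjoint A = A"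

definition psd :: "nat \<Rightarrow> complex mat \<Rightarrow> bool" where
  "psd n A \<longleftrightarrow> hermitian_mat n A \<and> (\<forall>x \<in> carrier_vec n. Re ((A *\<^sub>v x) \<bullet>c x) \<ge> 0)"

definition pos_def :: "nat \<Rightarrow> complex mat \<Rightarrow> bool" where
  "pos_def n A \<longleftrightarrow> hermitian_mat n A \<and>
     (\<forall>x \<in> carrier_vec n. x \<noteq> 0\<^sub>v n \<longrightarrow> Re ((A *\<^sub>v x) \<bullet>c x) > 0)"

definition loewner_le :: "nat \<Rightarrow> complex mat \<Rightarrow> complex mat \<Rightarrow> bool" where
  "loewner_le n X Y \<longleftrightarrow> hermitian_mat n X \<and> hermitian_mat n Y \<and> psd n (Y - X)"

definition unitary_mat :: "nat \<Rightarrow> complex mat \<Rightarrow> bool" where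
  "unitary_mat n U \<longleftrightarrow> U \<in> carrier_mat n n \<and>
     mat_adjoint U * U = 1\<^sub>m n \<and> U * mat_adjoint U = 1\<^sub>m n"

text \<open>Functional calculus of a Hermitian matrix. The result does not depend on the
  diagonalization used; see \<open>herm_fun_diag\<close> below.\<close>

definition herm_fun :: "(real \<Rightarrow> real) \<Rightarrow> complex mat \<Rightarrow> complex mat" where
  "herm_fun f A = (THE X. \<exists>U d.
     unitary_mat (dim_row A) U \<and>
     A = U * mat_diag (dim_row A) (\<lambda>i. complex_of_real (d i)) * mat_adjoint U \<and>
     X = U * mat_diag (dim_row A) (\<lambda>i. complex_of_real (f (d i))) * mat_adjoint U)"

lemma mat_adjoint_carrier: "U \<in> carrier_mat n m \<Longrightarrow> mat_adjoint U \<in> carrier_mat m n"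
  by (auto simp: mat_adjoint_def mat_of_rows_def)

lemma herm_fun_unique:
  assumes U: "unitary_mat n U" and V: "unitary_mat n V"
    and eq: "U * mat_diag n (\<lambda>i. complex_of_real (d i)) * mat_adjoint U =
             V * mat_diag n (\<lambda>i. complex_of_real (e i)) * mat_adjoint V"
  shows "U * mat_diag n (\<lambda>i. complex_of_real (f (d i))) * mat_adjoint U =
         V * mat_diag n (\<lambda>i. complex_of_real (f (e i))) * mat_adjoint V"
proof -
  define U' V' where "U' = mat_adjoint U" and "V' = mat_adjoint V"
  define D E where "D = mat_diag n (\<lambda>i. complex_of_real (d i))"
    and "E = mat_diag n (\<lambda>i. complex_of_real (e i))"
  define F G where "F = mat_diag n (\<lambda>i. complex_of_real (f (d i)))"
    and "G = mat_diag n (\<lambda>i. complex_of_real (f (e i)))"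
  have c [simp]: "U \<in> carrier_mat n n" "V \<in> carrier_mat n n"
      "U' \<in> carrier_mat n n" "V' \<in> carrier_mat n n"
      "D \<in> carrier_mat n n" "E \<in> carrier_mat n n"
      "F \<in> carrier_mat n n" "G \<in> carrier_mat n n"
    using U V by (auto simp: unitary_mat_def U'_def V'_def D_def E_def F_def G_def
        intro: mat_adjoint_carrier)
  have uv: "U' * U = 1\<^sub>m n" "U * U' = 1\<^sub>m n" "V' * V = 1\<^sub>m n" "V * V' = 1\<^sub>m n"
    using U V by (auto simp: unitary_mat_def U'_def V'_def)
  have eq': "U * D * U' = V * E * V'"
    using eq by (simp add: U'_def V'_def D_def E_def)
  define W where "W = V' * U"
  have W [simp]: "W \<in> carrier_mat n n"
    unfolding W_def by (rule mult_carrier_mat) (rule c)+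
  have m [simp]: "A * B \<in> carrier_mat n n"
    if "A \<in> carrier_mat n n" "B \<in> carrier_mat n n" for A B :: "complex mat"
    using that by (rule mult_carrier_mat)
  note assoc = assoc_mult_mat[where ?n\<^sub>1.0 = n and ?n\<^sub>2.0 = n and ?n\<^sub>3.0 = n and ?n\<^sub>4.0 = n]
  have "W * D = V' * (U * D * U') * U"
    by (simp add: W_def assoc uv right_mult_one_mat[of _ n n] left_mult_one_mat[of _ n n])
  also have "\<dots> = V' * (V * E * V') * U"
    by (simp only: eq')
  also have "\<dots> = (V' * V) * (E * (V' * U))"
    by (simp add: assoc)
  also have "\<dots> = E * W"
    unfolding uv W_def by (simp add: left_mult_one_mat[of _ n n])
  finally have WD: "W * D = E * W" .
  have entry: "W $$ (i, j) * d j = e i * W $$ (i, j)" if "i < n" "j < n" for i j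
  proof -
    have "(W * D) $$ (i, j) = (E * W) $$ (i, j)"
      by (simp add: WD)
    then show ?thesis
      using that by (simp add: D_def E_def mat_diag_mult_left[OF W] mat_diag_mult_right[OF W])
  qed
  have "W $$ (i, j) * f (d j) = f (e i) * W $$ (i, j)" if "i < n" "j < n" for i j
    using entry[OF that] by (cases "W $$ (i, j) = 0") (auto simp: mult.commute)
  then have WF: "W * F = G * W"
    by (auto simp: F_def G_def mat_diag_mult_left[OF W] mat_diag_mult_right[OF W])
  have "U * F * U' = (V * V') * (U * F * U')"
    unfolding uv by (simp add: left_mult_one_mat[of _ n n])
  also have "\<dots> = V * (W * F) * U'"
    by (simp add: W_def assoc)
  also have "\<dots> = V * (G * W) * U'"
    by (simp only: WF)
  also have "\<dots> = V * G * V'"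
    by (simp add: W_def assoc uv right_mult_one_mat[of _ n n] left_mult_one_mat[of _ n n])
  finally show ?thesis
    by (simp add: U'_def V'_def F_def G_def)
qed

lemma herm_fun_diag:
  assumes U: "unitary_mat n U"
    and A: "A = U * mat_diag n (\<lambda>i. complex_of_real (d i)) * mat_adjoint U"
  shows "herm_fun f A = U * mat_diag n (\<lambda>i. complex_of_real (f (d i))) * mat_adjoint U"
proof -
  have n: "dim_row A = n"
    using U by (auto simp: A unitary_mat_def)
  show ?thesis
    unfolding herm_fun_def n
  proof (rule the_equality)
    fix X
    assume "\<exists>V e. unitary_mat n V \<and>
      A = V * mat_diag n (\<lambda>i. complex_of_real (e i)) * mat_adjoint V \<and>
      X = V * mat_diag n (\<lambda>i. complex_of_real (f (e i))) * mat_adjoint V"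
    then obtain V e where V: "unitary_mat n V"
      "A = V * mat_diag n (\<lambda>i. complex_of_real (e i)) * mat_adjoint V"
      "X = V * mat_diag n (\<lambda>i. complex_of_real (f (e i))) * mat_adjoint V"
      by blast
    then show "X = U * mat_diag n (\<lambda>i. complex_of_real (f (d i))) * mat_adjoint U"
      using herm_fun_unique[OF V(1) U] A by simp
  qed (use U A in blast)
qed

text \<open>Since \<open>inverse 0 = 0\<close>, this is the inverse on the support and zero on the kernel.\<close>

definition gen_inverse :: "complex mat \<Rightarrow> complex mat" where
  "gen_inverse A = herm_fun inverse A"

text \<open>Real powers of a positive semidefinite matrix. Since \<open>0 powr 0 = 0\<close>, the zeroth
  power is the support projection.\<close>

definition mat_powr :: "complex mat \<Rightarrow> real \<Rightarrow> complex mat" where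
  "mat_powr A r = (if r < 0 then herm_fun (\<lambda>x. x powr (- r)) (gen_inverse A)
                   else herm_fun (\<lambda>x. x powr r) A)"

text \<open>The support projection: the orthogonal projection with the same kernel as \<open>A\<close>,
  hence with range the orthogonal complement of that kernel.\<close>

definition support_proj :: "complex mat \<Rightarrow> complex mat" where
  "support_proj A = (THE P. hermitian_mat (dim_row A) P \<and> P * P = P \<and>
     mat_kernel P = mat_kernel A)"

definition geom_mean :: "complex mat \<Rightarrow> complex mat \<Rightarrow> complex mat" where
  "geom_mean A B =
     mat_powr A (1/2) *
     mat_powr (mat_powr A (- (1/2)) * B * mat_powr A (- (1/2))) (1/2) *
     mat_powr A (1/2)"

text \<open>The quasi \<open>\<alpha>\<close>-weighted spectral geometric mean, meaningful for \<open>s(A) \<ge> s(B)\<close>.\<close>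

definition SG :: "real \<Rightarrow> real \<Rightarrow> complex mat \<Rightarrow> complex mat \<Rightarrow> complex mat" where
  "SG \<alpha> p A B =
     (let G = mat_powr (geom_mean (mat_powr A (- p)) (mat_powr B p)) \<alpha>
      in mat_powr (G * mat_powr A p * G) (1 / p))"

definition Renyi :: "real \<Rightarrow> real \<Rightarrow> complex mat \<Rightarrow> complex mat \<Rightarrow> complex mat" where
  "Renyi \<alpha> p A B =
     mat_powr (mat_powr A ((1 - \<alpha>) / 2 * p) * mat_powr B (\<alpha> * p) *
               mat_powr A ((1 - \<alpha>) / 2 * p)) (1 / p)"

text \<open>Eigenvalues of a Hermitian matrix in decreasing order, with multiplicity.
  Indexing of the list starts at 0.\<close>

definition eigs_desc :: "complex mat \<Rightarrow> real list" where
  "eigs_desc A = rev (sorted_list_of_multiset (image_mset Re (proots (char_poly A))))"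

definition log_majorized :: "nat \<Rightarrow> complex mat \<Rightarrow> complex mat \<Rightarrow> bool" where
  "log_majorized n X Y \<longleftrightarrow> psd n X \<and> psd n Y \<and>
     (\<forall>k \<in> {1..n}. (\<Prod>i<k. eigs_desc X ! i) \<le> (\<Prod>i<k. eigs_desc Y ! i)) \<and>
     (\<Prod>i<n. eigs_desc X ! i) = (\<Prod>i<n. eigs_desc Y ! i)"

end

theory Submission
  imports Defs "Jordan_Normal_Form.Spectral_Radius" "HOL-Analysis.Convex"
begin

text \<open>Put \<open>a = A\<^sup>p\<close>, \<open>b = B\<^sup>p\<close>, \<open>r = q / p\<close> and let \<open>X\<close> be the geometric mean of \<open>a\<^sup>-\<^sup>1\<close> and \<open>b\<close>, which solves the
  Riccati equation \<open>X a X = b\<close>. Taking \<open>k\<close>-th compound matrices reduces log-majorization to the comparison of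
  largest eigenvalues, that is, of the norms of \<open>X\<^sup>\<alpha> a\<^sup>1\<^sup>/\<^sup>2\<close> and of a product of powers of \<open>b\<close> and \<open>a\<close>. By Cordes'
  inequality the latter may be taken to be \<open>b\<^sup>1\<^sup>/\<^sup>2 a\<^sup>v\<close> with \<open>v = (1 - \<alpha>) / (2 \<alpha>)\<close>, whose norm is that of \<open>a\<^sup>1\<^sup>/\<^sup>2 X a\<^sup>v\<close>.
  For \<open>\<alpha> \<le> 1/2\<close> symmetrising the exponents of \<open>a\<close> gives a lower bound for it, and for \<open>\<alpha> \<ge> 1/2\<close> the factorisation
  \<open>(a\<^sup>1\<^sup>/\<^sup>2 X\<^sup>\<alpha>) (X\<^sup>1\<^sup>-\<^sup>\<alpha> a\<^sup>v)\<close> gives an upper bound; exchanging \<open>a\<close> and \<open>b\<close> covers the remaining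
  ranges of \<open>\<alpha>\<close>. Conversely, letting \<open>X\<close> (or \<open>X\<^sup>-\<^sup>1\<close>) degenerate to a rank one projection in dimension two, the
  inequalities become Jensen's inequality for the power \<open>(1 - \<alpha>) r\<close> (or \<open>\<alpha> r\<close>).\<close>


section \<open>Adjoints and the spectral theorem\<close>

text \<open>Inequalities between norms are stated as transfer of upper bounds: every constant that
  bounds one side (\<open>opbound\<close>, \<open>qbound\<close>) yields one that bounds the other.
  This suits compounds: \<open>qbound\<close> for the k-th compound bounds the product of the k
  largest eigenvalues, and compounds commute with products and all real powers, hence with both
  means. Equality of the full products is a determinant computation.

  Exchanging a and b amounts to replacing X by its inverse Y: from \<open>b = X a X\<close> follow
  \<open>Y b Y = a\<close> and
  \<open>Y^(1-\<alpha>) b Y^(1-\<alpha>) = X^\<alpha> a X^\<alpha>\<close>, so \<alpha> turns into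
  \<open>1 - \<alpha>\<close> while the spectral side stays the same.

  The obstacle is that A and B may be singular. It is met without approximation: as
  \<open>0 powr r = 0\<close> for every real r, exponents of one matrix add whatever their signs,
  with \<open>A^0\<close> a projection in place of the identity, and the support hypothesis enters
  as the equation \<open>B A^0 = B\<close>.

  The thresholds for p/q arise because Cordes' inequality allows only exponents up to 1: the
  exponents \<open>1 / (\<alpha> r)\<close> and \<open>1 / ((1-\<alpha>) r)\<close> occur in one
  direction, their reciprocals in the other.\<close>

lemma dim_mat_adjoint [simp]: "dim_row (mat_adjoint A) = dim_col A" "dim_col (mat_adjoint A) = dim_row A"
  by (auto simp: mat_adjoint_def)

lemma index_mat_adjoint [simp]:
  "i < dim_col A \<Longrightarrow> j < dim_row A \<Longrightarrow> mat_adjoint A $$ (i, j) = cnj (A $$ (j, i))"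
  by (simp add: mat_adjoint_def mat_of_rows_def)

lemma index_mult_mat_sum:
  "A \<in> carrier_mat n m \<Longrightarrow> B \<in> carrier_mat m k \<Longrightarrow> i < n \<Longrightarrow> j < k \<Longrightarrow>
   (A * B) $$ (i, j) = (\<Sum>l<m. A $$ (i, l) * B $$ (l, j))"
  by (simp add: scalar_prod_def atLeast0LessThan)

lemma index_mult_mat_vec_sum:
  "A \<in> carrier_mat n m \<Longrightarrow> x \<in> carrier_vec m \<Longrightarrow> i < n \<Longrightarrow>
   (A *\<^sub>v x) $ i = (\<Sum>l<m. A $$ (i, l) * x $ l)"
  by (simp add: scalar_prod_def atLeast0LessThan)

lemma mat_adjoint_adjoint [simp]: "mat_adjoint (mat_adjoint A) = A" for A :: "complex mat"
  by (rule eq_matI) auto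

lemma mat_adjoint_mult:
  fixes A B :: "complex mat"
  assumes "A \<in> carrier_mat n m" "B \<in> carrier_mat m k"
  shows "mat_adjoint (A * B) = mat_adjoint B * mat_adjoint A"
  using assms by (intro eq_matI) (auto simp: scalar_prod_def mult.commute)

lemma mat_adjoint_mat_diag: "mat_adjoint (mat_diag n (\<lambda>i. complex_of_real (d i))) = mat_diag n (\<lambda>i. complex_of_real (d i))"
  by (intro eq_matI) (auto simp: mat_diag_def)

lemma mat_adjoint_one [simp]: "mat_adjoint (1\<^sub>m n) = (1\<^sub>m n :: complex mat)"
  by (intro eq_matI) auto

lemma index_conj_diag:
  assumes "U \<in> carrier_mat n n" "i < n" "j < n"
  shows "(U * mat_diag n f * mat_adjoint U) $$ (i, j) = (\<Sum>k<n. U $$ (i, k) * f k * cnj (U $$ (j, k)))"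
proof -
  have "(U * mat_diag n f * mat_adjoint U) $$ (i, j) = (\<Sum>k<n. (U * mat_diag n f) $$ (i, k) * mat_adjoint U $$ (k, j))"
    using assms by (intro index_mult_mat_sum) (auto simp: mat_adjoint_carrier)
  also have "\<dots> = (\<Sum>k<n. U $$ (i, k) * f k * cnj (U $$ (j, k)))"
    using assms by (intro sum.cong) (auto simp: mat_diag_mult_right[OF assms(1)])
  finally show ?thesis .
qed

lemma inner_adjoint:
  fixes A :: "complex mat"
  assumes "A \<in> carrier_mat n m" "x \<in> carrier_vec m" "y \<in> carrier_vec n"
  shows "(A *\<^sub>v x) \<bullet>c y = x \<bullet>c (mat_adjoint A *\<^sub>v y)"
proof -
  have "(A *\<^sub>v x) \<bullet>c y = (\<Sum>i<n. (\<Sum>j<m. A $$ (i, j) * x $ j) * cnj (y $ i))"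
    using assms by (auto simp: scalar_prod_def atLeast0LessThan intro!: sum.cong)
  also have "\<dots> = (\<Sum>j<m. \<Sum>i<n. A $$ (i, j) * x $ j * cnj (y $ i))"
    by (simp add: sum_distrib_right) (rule sum.swap)
  also have "\<dots> = (\<Sum>j<m. x $ j * cnj (\<Sum>i<n. cnj (A $$ (i, j)) * y $ i))"
    by (simp add: sum_distrib_left mult_ac)
  also have "\<dots> = x \<bullet>c (mat_adjoint A *\<^sub>v y)"
    using assms by (auto simp: scalar_prod_def atLeast0LessThan intro!: sum.cong)
  finally show ?thesis .
qed

definition vsq :: "complex vec \<Rightarrow> real" where
  "vsq x = Re (x \<bullet>c x)"

lemma vsq_sum: "vsq x = (\<Sum>i<dim_vec x. (cmod (x $ i))\<^sup>2)"
  unfolding vsq_def scalar_prod_def Re_sum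
  by (rule sum.cong) (auto simp: cmod_power2, simp add: power2_eq_square)

lemma vsq_nonneg [simp]: "vsq x \<ge> 0"
  by (simp add: vsq_sum sum_nonneg)

lemma inner_self: "x \<bullet>c x = complex_of_real (vsq x)"
  by (simp add: vsq_sum scalar_prod_def atLeast0LessThan complex_mult_cnj cmod_power2)

lemma vsq_eq_0: "x \<in> carrier_vec n \<Longrightarrow> vsq x = 0 \<longleftrightarrow> x = 0\<^sub>v n"
  by (auto simp: vsq_sum sum_nonneg_eq_0_iff intro!: eq_vecI)

lemma vsq_smult: "vsq (c \<cdot>\<^sub>v x) = (cmod c)\<^sup>2 * vsq x"
  by (simp add: vsq_sum norm_mult power_mult_distrib sum_distrib_left)

section \<open>Unitary diagonalization of Hermitian matrices\<close>

text \<open>The Householder reflection exchanging the first unit vector and w. With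
  \<open>u = w - unit_vec n 0\<close> and real first coordinate r,
  \<open>vsq u = 2 * (1 - r)\<close>, so q is the usual coefficient 2 divided by
  \<open>vsq u\<close>. Realness of r is what makes the reflection send the unit vector exactly to
  w.\<close>

lemma unitary_with_first_col:
  assumes w: "w \<in> carrier_vec n" and n: "0 < n" and w1: "vsq w = 1" and w0: "w $ 0 \<in> \<real>"
  shows "\<exists>H. unitary_mat n H \<and> col H 0 = w"
proof (cases "w = unit_vec n 0")
  case True
  then show ?thesis
    using n by (intro exI[of _ "1\<^sub>m n"]) (auto simp: unitary_mat_def)
next
  case False
  obtain r where r: "w $ 0 = complex_of_real r"
    using w0 by (auto elim: Reals_cases)
  define u where "u = w - unit_vec n 0"
  have u: "u \<in> carrier_vec n" using w by (simp add: u_def)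
  have sumw: "(\<Sum>i\<in>{..<n}-{0}. (cmod (w $ i))\<^sup>2) = 1 - r\<^sup>2"
    using w1 w n by (simp add: vsq_sum sum.remove[of "{..<n}" 0] r)
  have "vsq u = (\<Sum>i<n. (cmod (u $ i))\<^sup>2)"
    using u by (simp add: vsq_sum)
  also have "\<dots> = (cmod (u $ 0))\<^sup>2 + (\<Sum>i\<in>{..<n}-{0}. (cmod (w $ i))\<^sup>2)"
    using n w by (subst sum.remove[of _ 0]) (auto simp: u_def intro!: sum.cong)
  also have "cmod (u $ 0) = \<bar>r - 1\<bar>"
  proof -
    have "u $ 0 = complex_of_real (r - 1)" using n w by (simp add: u_def r)
    then show ?thesis by (simp only: norm_of_real)
  qed
  finally have "vsq u = (r - 1)\<^sup>2 + (1 - r\<^sup>2)" by (simp only: sumw power2_abs)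
  then have vu: "vsq u = 2 * (1 - r)"
    by (simp add: power2_eq_square algebra_simps)
  have "vsq u \<noteq> 0"
    using False w u vsq_eq_0[OF u] by (auto simp: u_def vec_eq_iff)
  then have r1: "r \<noteq> 1" using vu by auto
  define q where "q = 1 / complex_of_real (1 - r)"
  have q: "q * complex_of_real (1 - r) = 1" "cnj q = q" using r1
    by (simp_all add: q_def del: of_real_diff)
  define H where "H = mat n n (\<lambda>(i, j). (if i = j then 1 else 0) - q * u $ i * cnj (u $ j))"
  have H: "H \<in> carrier_mat n n" by (simp add: H_def)
  have adj: "mat_adjoint H = H"
    by (rule eq_matI) (auto simp: H_def q)
  have uu: "(\<Sum>l<n. cnj (u $ l) * u $ l) = 2 * complex_of_real (1 - r)"
    using inner_self[of u] u vu by (simp add: scalar_prod_def atLeast0LessThan mult.commute)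
  have HH: "H * H = 1\<^sub>m n"
  proof (rule eq_matI)
    fix i j assume ij: "i < dim_row (1\<^sub>m n)" "j < dim_col (1\<^sub>m n)"
    then have "(H * H) $$ (i, j) = (\<Sum>l<n. H $$ (i, l) * H $$ (l, j))"
      using H by (intro index_mult_mat_sum) auto
    also have "\<dots> = (\<Sum>l<n. (if i = l then (if l = j then 1 else 0) else 0)
         - (if i = l then q * u $ l * cnj (u $ j) else 0)
         - (if l = j then q * u $ i * cnj (u $ l) else 0)
         + q * u $ i * q * cnj (u $ j) * (cnj (u $ l) * u $ l))"
      using ij by (intro sum.cong) (auto simp: H_def algebra_simps)
    also have "\<dots> = (if i = j then 1 else 0) - 2 * (q * u $ i * cnj (u $ j))
         + q * u $ i * q * cnj (u $ j) * (2 * complex_of_real (1 - r))"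
      using ij by (simp add: sum.distrib sum_subtractf uu flip: sum_distrib_left)
    also have "\<dots> = (if i = j then 1 else 0) - 2 * (q * u $ i * cnj (u $ j))
         + 2 * u $ i * q * cnj (u $ j) * (q * complex_of_real (1 - r))"
      by simp
    also have "\<dots> = (if i = j then 1 else 0)" by (simp only: q) simp
    finally show "(H * H) $$ (i, j) = 1\<^sub>m n $$ (i, j)" using ij by simp
  qed (use H in auto)
  have "col H 0 = w"
  proof (rule eq_vecI)
    fix i assume i: "i < dim_vec w"
    have "cnj (u $ 0) = - complex_of_real (1 - r)"
      using n w by (simp add: u_def r)
    then have "q * u $ i * cnj (u $ 0) = - (u $ i * (q * complex_of_real (1 - r)))" by (simp only: mult_minus_right mult_ac)
    also have "\<dots> = - u $ i" by (simp only: q) simp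
    finally show "col H 0 $ i = w $ i"
      using i n w by (auto simp: H_def u_def)
  qed (use H w in auto)
  then show ?thesis using adj HH H by (auto simp: unitary_mat_def)
qed

text \<open>Multiplying an eigenvector by a phase makes its first coordinate real, as the reflection
  above requires.\<close>

lemma real_first_unit_eigenvector:
  fixes A :: "complex mat"
  assumes A: "A \<in> carrier_mat n n" and n: "0 < n"
  shows "\<exists>w e. w \<in> carrier_vec n \<and> vsq w = 1 \<and> w $ 0 \<in> \<real> \<and> A *\<^sub>v w = e \<cdot>\<^sub>v w"
proof -
  from spectrum_non_empty[OF A] n obtain e v where v: "v \<in> carrier_vec n" "v \<noteq> 0\<^sub>v n" "A *\<^sub>v v = e \<cdot>\<^sub>v v"
    using A by (auto simp: spectrum_def eigenvalue_def eigenvector_def)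
  define c where "c = (if v $ 0 = 0 then 1 else cnj (v $ 0) / cmod (v $ 0)) / complex_of_real (sqrt (vsq v))"
  have v0: "vsq v > 0"
    using v vsq_eq_0[OF v(1)] vsq_nonneg[of v] by linarith
  have "cmod c = 1 / sqrt (vsq v)"
    using v0 by (simp add: c_def norm_divide)
  then have "vsq (c \<cdot>\<^sub>v v) = 1"
    using v0 by (simp add: vsq_smult power_divide)
  moreover have "(c \<cdot>\<^sub>v v) $ 0 \<in> \<real>"
  proof -
    have "(c \<cdot>\<^sub>v v) $ 0 = c * v $ 0" using v n by simp
    also have "\<dots> = of_real (cmod (v $ 0) / sqrt (vsq v))"
      using complex_norm_square[of "v $ 0"]
      by (auto simp: c_def divide_simps mult_ac power2_eq_square)
    finally show ?thesis by simp
  qed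
  moreover have "A *\<^sub>v (c \<cdot>\<^sub>v v) = e \<cdot>\<^sub>v (c \<cdot>\<^sub>v v)"
    using v A by (simp add: mult_mat_vec smult_smult_assoc mult.commute)
  ultimately show ?thesis using v by (intro exI[of _ "c \<cdot>\<^sub>v v"] exI[of _ e]) auto
qed

lemma unitary_mat_mult:
  assumes "unitary_mat n U" "unitary_mat n V"
  shows "unitary_mat n (U * V)"
proof -
  have c: "U \<in> carrier_mat n n" "V \<in> carrier_mat n n" "mat_adjoint U \<in> carrier_mat n n" "mat_adjoint V \<in> carrier_mat n n"
    using assms by (auto simp: unitary_mat_def mat_adjoint_carrier)
  have uv: "mat_adjoint U * U = 1\<^sub>m n" "U * mat_adjoint U = 1\<^sub>m n" "mat_adjoint V * V = 1\<^sub>m n" "V * mat_adjoint V = 1\<^sub>m n"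
    using assms by (auto simp: unitary_mat_def)
  have "mat_adjoint (U * V) * (U * V) = mat_adjoint V * ((mat_adjoint U * U) * V)"
    using c by (simp add: mat_adjoint_mult[OF c(1,2)] assoc_mult_mat[of _ n n _ n _ n] mult_carrier_mat[of _ n n])
  also have "\<dots> = 1\<^sub>m n" using c by (simp only: uv left_mult_one_mat)
  finally have 1: "mat_adjoint (U * V) * (U * V) = 1\<^sub>m n" .
  have "(U * V) * mat_adjoint (U * V) = U * ((V * mat_adjoint V) * mat_adjoint U)"
    using c by (simp add: mat_adjoint_mult[OF c(1,2)] assoc_mult_mat[of _ n n _ n _ n] mult_carrier_mat[of _ n n])
  also have "\<dots> = 1\<^sub>m n" using c by (simp only: uv left_mult_one_mat)
  finally show ?thesis
    using 1 c by (simp only: unitary_mat_def mult_carrier_mat[of _ n n])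
qed

text \<open>Deflation: if the first column of the unitary H is an eigenvector, the first column of
  \<open>H* A H\<close> is a multiple of the first unit vector, and by symmetry so is the first row.
  The remaining block B is Hermitian of size n, and its diagonalizing V is extended by a leading 1
  to W.\<close>

lemma spectral_theorem:
  "hermitian_mat n A \<Longrightarrow> \<exists>U d. unitary_mat n U \<and>
     A = U * mat_diag n (\<lambda>i. complex_of_real (d i)) * mat_adjoint U"
proof (induction n arbitrary: A)
  case 0
  then show ?case
    by (intro exI[of _ "1\<^sub>m 0"]) (auto simp: hermitian_mat_def unitary_mat_def intro!: eq_matI)
next
  case (Suc n)
  let ?N = "Suc n"
  have A: "A \<in> carrier_mat ?N ?N" "mat_adjoint A = A" using Suc.prems by (auto simp: hermitian_mat_def)
  obtain w e where w: "w \<in> carrier_vec ?N" "vsq w = 1" "w $ 0 \<in> \<real>" "A *\<^sub>v w = e \<cdot>\<^sub>v w"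
    using real_first_unit_eigenvector[OF A(1)] by auto
  obtain H where H: "unitary_mat ?N H" "col H 0 = w"
    using unitary_with_first_col[OF w(1) _ w(2,3)] by auto
  define H' where "H' = mat_adjoint H"
  have c [simp]: "H \<in> carrier_mat ?N ?N" "H' \<in> carrier_mat ?N ?N" "A \<in> carrier_mat ?N ?N"
    and HH: "H' * H = 1\<^sub>m ?N" "H * H' = 1\<^sub>m ?N"
    using H A by (auto simp: unitary_mat_def H'_def mat_adjoint_carrier)
  have m [simp]: "X * Y \<in> carrier_mat ?N ?N"
    if "X \<in> carrier_mat ?N ?N" "Y \<in> carrier_mat ?N ?N" for X Y :: "complex mat"
    using that by (rule mult_carrier_mat)
  note assoc = assoc_mult_mat[of _ ?N ?N _ ?N _ ?N]
  define A' where "A' = H' * A * H"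
  have A' [simp]: "A' \<in> carrier_mat ?N ?N" by (simp add: A'_def)
  have adjA': "mat_adjoint A' = A'"
    using A(2) by (simp add: A'_def H'_def mat_adjoint_mult[of _ ?N ?N _ ?N] mat_adjoint_carrier[of _ ?N ?N] assoc)
  have "col A' 0 = (H' * A) *\<^sub>v w"
    using H(2) by (simp add: A'_def col_mult2[of _ ?N ?N _ ?N])
  also have "\<dots> = e \<cdot>\<^sub>v (H' *\<^sub>v w)"
    using w by (simp add: assoc_mult_mat_vec[of _ ?N ?N _ ?N] mult_mat_vec[of _ ?N ?N])
  also have "H' *\<^sub>v w = col (H' * H) 0"
    using H(2) by (simp add: col_mult2[of _ ?N ?N _ ?N])
  also have "\<dots> = unit_vec ?N 0" by (simp add: HH)
  finally have col0: "col A' 0 = e \<cdot>\<^sub>v unit_vec ?N 0" .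
  have A'i0: "A' $$ (i, 0) = (if i = 0 then e else 0)" if "i < ?N" for i
  proof -
    have "A' $$ (i, 0) = col A' 0 $ i" using that carrier_matD[OF A'] by simp
    then show ?thesis using that by (simp add: col0)
  qed
  have sym: "A' $$ (j, i) = cnj (A' $$ (i, j))" if "i < ?N" "j < ?N" for i j
  proof -
    have "mat_adjoint A' $$ (j, i) = cnj (A' $$ (i, j))" using that carrier_matD[OF A'] by simp
    then show ?thesis by (simp add: adjA')
  qed
  have e: "cnj e = e" using sym[of 0 0] A'i0[of 0] by simp
  have A'0i: "A' $$ (0, i) = (if i = 0 then e else 0)" if "i < ?N" for i
    using sym[of i 0] A'i0[of i] that e by auto
  define B where "B = mat n n (\<lambda>(i, j). A' $$ (Suc i, Suc j))"
  have "hermitian_mat n B"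
    unfolding hermitian_mat_def B_def
  proof (intro conjI eq_matI, goal_cases)
    case (2 i j) then show ?case using sym[of "Suc j" "Suc i"] by simp
  qed auto
  from Suc.IH[OF this] obtain V d where V: "unitary_mat n V"
    and Beq: "B = V * mat_diag n (\<lambda>i. complex_of_real (d i)) * mat_adjoint V" by blast
  have Vc: "V \<in> carrier_mat n n" using V by (simp add: unitary_mat_def)
  define W where "W = mat ?N ?N (\<lambda>(i, j). if i = 0 \<or> j = 0 then (if i = j then 1 else 0) else V $$ (i - 1, j - 1))"
  have W [simp]: "W \<in> carrier_mat ?N ?N" "dim_row W = ?N" "dim_col W = ?N" by (simp_all add: W_def)
  have uW: "unitary_mat ?N W"
    unfolding unitary_mat_def
  proof (intro conjI W(1) eq_matI)
    fix i j assume ij: "i < dim_row (1\<^sub>m ?N)" "j < dim_col (1\<^sub>m ?N)"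
    have 1: "(\<Sum>l<n. cnj (V $$ (l, i')) * V $$ (l, j')) = (if i' = j' then 1 else 0)" if "i' < n" "j' < n" for i' j'
    proof -
      have "(mat_adjoint V * V) $$ (i', j') = (\<Sum>l<n. mat_adjoint V $$ (i', l) * V $$ (l, j'))"
        using Vc that by (intro index_mult_mat_sum) (auto simp: mat_adjoint_carrier)
      then show ?thesis using V Vc that by (simp add: unitary_mat_def del: index_mult_mat)
    qed
    have 2: "(\<Sum>l<n. V $$ (i', l) * cnj (V $$ (j', l))) = (if i' = j' then 1 else 0)" if "i' < n" "j' < n" for i' j'
    proof -
      have "(V * mat_adjoint V) $$ (i', j') = (\<Sum>l<n. V $$ (i', l) * mat_adjoint V $$ (l, j'))"
        using Vc that by (intro index_mult_mat_sum) (auto simp: mat_adjoint_carrier)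
      then show ?thesis using V Vc that by (simp add: unitary_mat_def del: index_mult_mat)
    qed
    have "(mat_adjoint W * W) $$ (i, j) = (\<Sum>l<?N. cnj (W $$ (l, i)) * W $$ (l, j))"
      using ij W by (subst index_mult_mat_sum[of _ ?N ?N _ ?N]) (auto simp: mat_adjoint_carrier)
    also have "\<dots> = (if i = j then 1 else 0)"
      using ij 1[of "i - 1" "j - 1"]
      by (cases i; cases j) (auto simp: W_def sum.lessThan_Suc_shift simp del: sum.lessThan_Suc)
    finally show "(mat_adjoint W * W) $$ (i, j) = 1\<^sub>m ?N $$ (i, j)" using ij by simp
    have "(W * mat_adjoint W) $$ (i, j) = (\<Sum>l<?N. W $$ (i, l) * cnj (W $$ (j, l)))"
      using ij W by (subst index_mult_mat_sum[of _ ?N ?N _ ?N]) (auto simp: mat_adjoint_carrier)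
    also have "\<dots> = (if i = j then 1 else 0)"
      using ij 2[of "i - 1" "j - 1"]
      by (cases i; cases j) (auto simp: W_def sum.lessThan_Suc_shift simp del: sum.lessThan_Suc)
    finally show "(W * mat_adjoint W) $$ (i, j) = 1\<^sub>m ?N $$ (i, j)" using ij by simp
  qed (use W in auto)
  define f where "f = (\<lambda>i. case i of 0 \<Rightarrow> Re e | Suc i \<Rightarrow> d i)"
  define D where "D = mat_diag ?N (\<lambda>i. complex_of_real (f i))"
  have D [simp]: "D \<in> carrier_mat ?N ?N" by (simp add: D_def)
  have ee: "complex_of_real (Re e) = e" using e by (simp add: complex_eq_iff)
  have A'eq: "A' = W * D * mat_adjoint W"
  proof (rule eq_matI)
    fix i j assume "i < dim_row (W * D * mat_adjoint W)" "j < dim_col (W * D * mat_adjoint W)"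
    then have ij: "i < ?N" "j < ?N" using W by auto
    have Bij: "A' $$ (Suc i', Suc j') = (\<Sum>k<n. V $$ (i', k) * complex_of_real (d k) * cnj (V $$ (j', k)))"
      if "i' < n" "j' < n" for i' j'
      using index_conj_diag[OF Vc that, of "\<lambda>i. complex_of_real (d i)", folded Beq] that by (simp add: B_def)
    have "(W * D * mat_adjoint W) $$ (i, j) = (\<Sum>k<?N. W $$ (i, k) * complex_of_real (f k) * cnj (W $$ (j, k)))"
      unfolding D_def using ij by (intro index_conj_diag) auto
    also have "\<dots> = A' $$ (i, j)"
      using ij Bij[of "i - 1" "j - 1"] A'i0[of i] A'0i[of j]
      by (cases i; cases j) (auto simp: f_def ee W_def sum.lessThan_Suc_shift simp del: sum.lessThan_Suc)
    finally show "A' $$ (i, j) = (W * D * mat_adjoint W) $$ (i, j)" by simp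
  qed (use carrier_matD[OF A'] carrier_matD[OF W(1)] in auto)
  have W' [simp]: "mat_adjoint W \<in> carrier_mat ?N ?N" by (rule mat_adjoint_carrier) simp
  have "A = (H * H') * A * (H * H')" by (simp add: HH left_mult_one_mat[of _ ?N ?N] right_mult_one_mat[of _ ?N ?N])
  also have "\<dots> = H * A' * H'" by (simp add: A'_def assoc)
  also have "\<dots> = (H * W) * D * (mat_adjoint W * H')" by (simp add: A'eq assoc)
  also have "mat_adjoint W * H' = mat_adjoint (H * W)" by (simp add: H'_def mat_adjoint_mult[of _ ?N ?N _ ?N])
  finally show ?case
    using unitary_mat_mult[OF H(1) uW] unfolding D_def
    by (intro exI[of _ "H * W"] exI[of _ f]) simp
qed


section \<open>Functional calculus\<close>

definition conj_diag :: "nat \<Rightarrow> complex mat \<Rightarrow> (nat \<Rightarrow> real) \<Rightarrow> complex mat" where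
  "conj_diag n U d = U * mat_diag n (\<lambda>i. complex_of_real (d i)) * mat_adjoint U"

lemma conj_diag_cong: "(\<And>i. i < n \<Longrightarrow> d i = e i) \<Longrightarrow> conj_diag n U d = conj_diag n U e"
proof -
  assume "\<And>i. i < n \<Longrightarrow> d i = e i"
  then have "mat_diag n (\<lambda>i. complex_of_real (d i)) = mat_diag n (\<lambda>i. complex_of_real (e i))"
    by (intro eq_matI) (auto simp: mat_diag_def)
  then show ?thesis by (simp add: conj_diag_def)
qed

lemma spectral_theorem_sorted:
  assumes "hermitian_mat n A"
  obtains U d where "unitary_mat n U" "A = conj_diag n U d" "\<And>i j. i \<le> j \<Longrightarrow> j < n \<Longrightarrow> d j \<le> d i"
proof -
  obtain U d where U: "unitary_mat n U" and A: "A = conj_diag n U d"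
    using spectral_theorem[OF assms] unfolding conj_diag_def by blast
  define xs where "xs = rev (sort_key d [0..<n])"
  have xs: "length xs = n" "set xs = {..<n}" "distinct xs" by (auto simp: xs_def)
  define \<pi> where "\<pi> = (!) xs"
  have bij: "bij_betw \<pi> {..<n} {..<n}"
    unfolding \<pi>_def using bij_betw_nth[OF xs(3) refl refl] by (simp only: xs)
  have pin: "\<pi> i < n" if "i < n" for i
    using bij that by (auto simp: bij_betw_def)
  have "sorted (map d (rev xs))" by (simp add: xs_def)
  then have mono: "d (\<pi> j) \<le> d (\<pi> i)" if "i \<le> j" "j < n" for i j
    using sorted_nth_mono[of "map d (rev xs)" "n - 1 - j" "n - 1 - i"] that xs(1)
    by (auto simp: \<pi>_def rev_nth)
  have Uc: "U \<in> carrier_mat n n" using U by (simp add: unitary_mat_def)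
  define V where "V = mat n n (\<lambda>(i, j). U $$ (i, \<pi> j))"
  have Vc: "V \<in> carrier_mat n n" by (simp add: V_def)
  have eq: "V * mat_diag n (\<lambda>i. f (\<pi> i)) * mat_adjoint V = U * mat_diag n f * mat_adjoint U" for f
  proof (rule eq_matI)
    fix i j assume "i < dim_row (U * mat_diag n f * mat_adjoint U)" "j < dim_col (U * mat_diag n f * mat_adjoint U)"
    then have ij: "i < n" "j < n" using Uc by auto
    have "(\<Sum>k<n. V $$ (i, k) * f (\<pi> k) * cnj (V $$ (j, k))) = (\<Sum>k<n. U $$ (i, \<pi> k) * f (\<pi> k) * cnj (U $$ (j, \<pi> k)))"
      using ij by (intro sum.cong) (auto simp: V_def)
    also have "\<dots> = (\<Sum>k<n. U $$ (i, k) * f k * cnj (U $$ (j, k)))"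
      by (rule sum.reindex_bij_betw[OF bij])
    finally show "(V * mat_diag n (\<lambda>i. f (\<pi> i)) * mat_adjoint V) $$ (i, j) = (U * mat_diag n f * mat_adjoint U) $$ (i, j)"
      using ij by (simp only: index_conj_diag[OF Vc ij] index_conj_diag[OF Uc ij])
  qed (use Uc in \<open>auto simp: V_def\<close>)
  have V': "mat_adjoint V \<in> carrier_mat n n" by (rule mat_adjoint_carrier[OF Vc])
  \<comment> \<open>The constant function 1 in \<open>eq\<close> turns the reindexed identity into
    \<open>V V* = U U*\<close>. For square matrices a one-sided inverse is enough.\<close>
  have "V * mat_adjoint V = V * 1\<^sub>m n * mat_adjoint V" using Vc V' by (simp only: right_mult_one_mat)
  also have "\<dots> = U * 1\<^sub>m n * mat_adjoint U" using eq[of "\<lambda>_. 1"] by simp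
  also have "\<dots> = U * mat_adjoint U" using Uc by (simp only: right_mult_one_mat)
  also have "\<dots> = 1\<^sub>m n" using U by (simp add: unitary_mat_def)
  finally have VV: "V * mat_adjoint V = 1\<^sub>m n" .
  then have "mat_adjoint V * V = 1\<^sub>m n"
    by (rule mat_mult_left_right_inverse[OF Vc V'])
  then have "unitary_mat n V" using VV Vc by (simp add: unitary_mat_def)
  moreover have "A = conj_diag n V (\<lambda>i. d (\<pi> i))"
    by (simp only: A conj_diag_def eq[of "\<lambda>i. complex_of_real (d i)"])
  ultimately show thesis using mono by (rule that)
qed

locale fixed_dim =
  fixes n :: nat
begin

lemma mult_closed [simp]: "A \<in> carrier_mat n n \<Longrightarrow> B \<in> carrier_mat n n \<Longrightarrow> A * B \<in> carrier_mat n n"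
  by (rule mult_carrier_mat)

lemma adjoint_closed [simp]: "A \<in> carrier_mat n n \<Longrightarrow> mat_adjoint A \<in> carrier_mat n n"
  by (rule mat_adjoint_carrier)

lemma mult_vec_closed [simp]: "A \<in> carrier_mat n n \<Longrightarrow> x \<in> carrier_vec n \<Longrightarrow> A *\<^sub>v x \<in> carrier_vec n"
  by (rule mult_mat_vec_carrier)

lemmas assoc = assoc_mult_mat[of _ n n _ n _ n]
lemmas assoc_vec = assoc_mult_mat_vec[of _ n n _ n]
lemmas adjoint_mult = mat_adjoint_mult[of _ n n _ n]
lemmas inner_adj = inner_adjoint[of _ n n]
lemmas left_one = left_mult_one_mat[of _ n n]
lemmas right_one = right_mult_one_mat[of _ n n]

lemma unitaryD:
  assumes "unitary_mat n U"
  shows "U \<in> carrier_mat n n" "mat_adjoint U \<in> carrier_mat n n"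
    "mat_adjoint U * U = 1\<^sub>m n" "U * mat_adjoint U = 1\<^sub>m n"
  using assms by (auto simp: unitary_mat_def mat_adjoint_carrier)

lemma conj_diag_closed: "unitary_mat n U \<Longrightarrow> conj_diag n U d \<in> carrier_mat n n"
  by (simp add: conj_diag_def unitaryD)

lemma mult_cancel_left:
  fixes A B C :: "complex mat"
  shows "A \<in> carrier_mat n n \<Longrightarrow> B \<in> carrier_mat n n \<Longrightarrow> C \<in> carrier_mat n n \<Longrightarrow>
    A * B = 1\<^sub>m n \<Longrightarrow> A * (B * C) = C"
  by (subst assoc[symmetric]) (auto simp: left_one)

lemma conj_diag_mult:
  assumes "unitary_mat n U"
  shows "conj_diag n U d * conj_diag n U e = conj_diag n U (\<lambda>i. d i * e i)"
proof -
  note U = unitaryD[OF assms]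
  let ?D = "\<lambda>d. mat_diag n (\<lambda>i. complex_of_real (d i))"
  have "conj_diag n U d * conj_diag n U e = U * (?D d * (mat_adjoint U * (U * (?D e * mat_adjoint U))))"
    using U by (simp add: conj_diag_def assoc)
  also have "\<dots> = U * (?D d * (?D e * mat_adjoint U))"
    using U by (simp add: mult_cancel_left)
  also have "\<dots> = U * ((?D d * ?D e) * mat_adjoint U)"
    using U by (simp add: assoc del: mat_diag_diag)
  also have "\<dots> = conj_diag n U (\<lambda>i. d i * e i)"
    using U by (simp add: conj_diag_def assoc)
  finally show ?thesis .
qed

lemma adjoint_conj_diag:
  assumes "unitary_mat n U"
  shows "mat_adjoint (conj_diag n U d) = conj_diag n U d"
  using unitaryD[OF assms] by (simp add: conj_diag_def adjoint_mult mat_adjoint_mat_diag assoc)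

lemma hermitian_conj_diag: "unitary_mat n U \<Longrightarrow> hermitian_mat n (conj_diag n U d)"
  by (simp add: hermitian_mat_def conj_diag_closed adjoint_conj_diag)

lemma herm_fun_conj_diag: "unitary_mat n U \<Longrightarrow> herm_fun f (conj_diag n U d) = conj_diag n U (\<lambda>i. f (d i))"
  by (simp add: conj_diag_def herm_fun_diag[OF _ refl])

lemma vsq_unitary:
  assumes "unitary_mat n U" "x \<in> carrier_vec n"
  shows "vsq (U *\<^sub>v x) = vsq x"
proof -
  note U = unitaryD[OF assms(1)]
  have "(U *\<^sub>v x) \<bullet>c (U *\<^sub>v x) = x \<bullet>c (mat_adjoint U *\<^sub>v (U *\<^sub>v x))"
    using U assms(2) by (simp add: inner_adj)
  also have "mat_adjoint U *\<^sub>v (U *\<^sub>v x) = x"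
    using U assms(2) by (simp flip: assoc_vec)
  finally show ?thesis by (simp add: vsq_def)
qed

lemma unitary_adjoint: "unitary_mat n U \<Longrightarrow> unitary_mat n (mat_adjoint U)"
  by (auto simp: unitary_mat_def)

lemma quadratic_form_conj_diag:
  assumes U: "unitary_mat n U" and x: "x \<in> carrier_vec n"
  shows "(conj_diag n U d *\<^sub>v x) \<bullet>c x = of_real (\<Sum>k<n. d k * (cmod ((mat_adjoint U *\<^sub>v x) $ k))\<^sup>2)"
proof -
  let ?y = "mat_adjoint U *\<^sub>v x" and ?D = "mat_diag n (\<lambda>i. complex_of_real (d i))"
  have y: "?y \<in> carrier_vec n" using U x by (simp add: unitaryD)
  have "(conj_diag n U d *\<^sub>v x) \<bullet>c x = (U *\<^sub>v (?D *\<^sub>v ?y)) \<bullet>c x"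
    using U x by (simp add: conj_diag_def unitaryD assoc_vec)
  also have "\<dots> = (?D *\<^sub>v ?y) \<bullet>c ?y"
    using U x y by (simp add: inner_adj unitaryD)
  also have "\<dots> = (\<Sum>k<n. of_real (d k) * ?y $ k * cnj (?y $ k))"
  proof -
    have "(?D *\<^sub>v ?y) $ k = of_real (d k) * ?y $ k" if "k < n" for k
    proof -
      have "(?D *\<^sub>v ?y) $ k = (\<Sum>l<n. ?D $$ (k, l) * ?y $ l)"
        using that y by (intro index_mult_mat_vec_sum) auto
      also have "\<dots> = (\<Sum>l<n. if k = l then of_real (d k) * ?y $ k else 0)"
        using that by (intro sum.cong) (auto simp: mat_diag_def)
      finally show ?thesis using that by simp
    qed
    then show ?thesis
      using y carrier_matD[OF unitaryD(1)[OF U]]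
      by (simp add: scalar_prod_def atLeast0LessThan del: index_mult_mat_vec)
  qed
  also have "\<dots> = of_real (\<Sum>k<n. d k * (cmod (?y $ k))\<^sup>2)"
    by (simp add: mult.assoc complex_mult_cnj cmod_power2)
  finally show ?thesis .
qed

lemma conj_diag_eigenvector:
  assumes U: "unitary_mat n U" and i: "i < n"
  shows "conj_diag n U d *\<^sub>v col U i = complex_of_real (d i) \<cdot>\<^sub>v col U i"
    and "col U i \<in> carrier_vec n" and "vsq (col U i) = 1"
proof -
  note Uc = unitaryD[OF U]
  let ?D = "mat_diag n (\<lambda>i. complex_of_real (d i))"
  have cU: "col U i = U *\<^sub>v unit_vec n i"
    using col_mult2[of U n n "1\<^sub>m n" n i] Uc i by simp
  then show "col U i \<in> carrier_vec n" using Uc by simp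
  have "vsq (unit_vec n i) = 1"
    using i by (simp add: vsq_def)
  then show "vsq (col U i) = 1" using vsq_unitary[OF U, of "unit_vec n i"] by (simp add: cU)
  have "conj_diag n U d *\<^sub>v col U i = U *\<^sub>v (?D *\<^sub>v (mat_adjoint U *\<^sub>v (U *\<^sub>v unit_vec n i)))"
    using Uc by (simp add: conj_diag_def cU assoc_vec)
  also have "mat_adjoint U *\<^sub>v (U *\<^sub>v unit_vec n i) = unit_vec n i"
    using Uc by (simp flip: assoc_vec)
  also have "?D *\<^sub>v unit_vec n i = complex_of_real (d i) \<cdot>\<^sub>v unit_vec n i"
    using i by (intro eq_vecI) (auto simp: mat_diag_def)
  also have "U *\<^sub>v \<dots> = complex_of_real (d i) \<cdot>\<^sub>v col U i"
    using Uc by (simp add: cU mult_mat_vec[of _ n n])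
  finally show "conj_diag n U d *\<^sub>v col U i = complex_of_real (d i) \<cdot>\<^sub>v col U i" .
qed

section \<open>Positive semidefinite matrices and their real powers\<close>

lemma psd_conj_diag:
  assumes "unitary_mat n U" "\<And>i. i < n \<Longrightarrow> d i \<ge> 0"
  shows "psd n (conj_diag n U d)"
  using assms by (auto simp: psd_def hermitian_conj_diag quadratic_form_conj_diag intro!: sum_nonneg)

lemma psd_sorted:
  assumes "psd n A"
  obtains U d where "unitary_mat n U" "A = conj_diag n U d" "\<And>i. i < n \<Longrightarrow> d i \<ge> 0"
    "\<And>i j. i \<le> j \<Longrightarrow> j < n \<Longrightarrow> d j \<le> d i"
proof -
  have "hermitian_mat n A" using assms by (simp add: psd_def)
  then obtain U d where U: "unitary_mat n U" and A: "A = conj_diag n U d"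
    and mono: "\<And>i j. i \<le> j \<Longrightarrow> j < n \<Longrightarrow> d j \<le> d i" using spectral_theorem_sorted by metis
  have "d i \<ge> 0" if "i < n" for i
  proof -
    note ev = conj_diag_eigenvector(1)[OF U that, of d] conj_diag_eigenvector(2,3)[OF U that]
    have "0 \<le> Re ((A *\<^sub>v col U i) \<bullet>c col U i)" using assms ev by (auto simp: psd_def)
    also have "(A *\<^sub>v col U i) \<bullet>c col U i = of_real (d i)"
      using ev by (simp add: A inner_self)
    finally show ?thesis by simp
  qed
  with U A mono show thesis by (intro that)
qed

lemma psd_closed [simp]: "psd n A \<Longrightarrow> A \<in> carrier_mat n n"
  by (simp add: psd_def hermitian_mat_def)

lemma psd_adjoint [simp]: "psd n A \<Longrightarrow> mat_adjoint A = A"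
  by (simp add: psd_def hermitian_mat_def)

text \<open>Negative exponents go through the generalized inverse, but at a zero eigenvalue both
  \<open>inverse 0 powr - r\<close> and \<open>0 powr r\<close> are 0, so one formula serves all
  real exponents. This is the source of the exponent arithmetic for singular matrices below.\<close>

lemma mat_powr_conj_diag:
  assumes U: "unitary_mat n U" and d: "\<And>i. i < n \<Longrightarrow> d i \<ge> 0"
  shows "mat_powr (conj_diag n U d) r = conj_diag n U (\<lambda>i. d i powr r)"
proof (cases "r < 0")
  case True
  have "inverse x powr - r = x powr r" if "x \<ge> 0" for x :: real
    using that by (cases "x = 0") (simp_all add: powr_minus powr_def ln_inverse)
  with True d U show ?thesis
    by (auto simp: mat_powr_def gen_inverse_def herm_fun_conj_diag intro!: conj_diag_cong)
next
  case False
  with U show ?thesis by (simp add: mat_powr_def herm_fun_conj_diag)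
qed

lemma psd_mat_powr [simp]: "psd n A \<Longrightarrow> psd n (mat_powr A r)"
  by (elim psd_sorted) (simp add: mat_powr_conj_diag psd_conj_diag)

lemma mat_powr_closed [simp]: "psd n A \<Longrightarrow> mat_powr A r \<in> carrier_mat n n"
  by (simp del: psd_closed add: psd_closed[OF psd_mat_powr])

lemma mat_powr_mult: "psd n A \<Longrightarrow> mat_powr A r * mat_powr A s = mat_powr A (r + s)"
  by (elim psd_sorted) (simp add: mat_powr_conj_diag conj_diag_mult powr_add)

lemma mat_powr_mult': "psd n A \<Longrightarrow> X \<in> carrier_mat n n \<Longrightarrow> mat_powr A r * (mat_powr A s * X) = mat_powr A (r + s) * X"
  by (simp add: mat_powr_mult flip: assoc)

lemma mat_powr_powr: "psd n A \<Longrightarrow> mat_powr (mat_powr A r) s = mat_powr A (r * s)"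
  by (elim psd_sorted) (simp add: mat_powr_conj_diag powr_powr)

lemma mat_powr_one [simp]: "psd n A \<Longrightarrow> mat_powr A 1 = A"
  by (elim psd_sorted) (auto simp: mat_powr_conj_diag intro!: conj_diag_cong)

lemma mat_powr_sqrt_unique:
  assumes "psd n Y"
  shows "mat_powr (Y * Y) (1/2) = Y"
proof -
  have "Y * Y = mat_powr Y 1 * mat_powr Y 1" using assms by simp
  also have "\<dots> = mat_powr Y 2" by (simp only: mat_powr_mult[OF assms]) simp
  finally show ?thesis using assms by (simp add: mat_powr_powr)
qed

lemma psd_congruence:
  assumes "psd n A" "T \<in> carrier_mat n n"
  shows "psd n (mat_adjoint T * A * T)"
  unfolding psd_def hermitian_mat_def
proof (intro conjI ballI)
  show "mat_adjoint T * A * T \<in> carrier_mat n n" using assms by simp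
  show "mat_adjoint (mat_adjoint T * A * T) = mat_adjoint T * A * T"
    using assms by (simp add: adjoint_mult assoc)
  fix x :: "complex vec" assume x: "x \<in> carrier_vec n"
  have "((mat_adjoint T * A * T) *\<^sub>v x) \<bullet>c x = (A *\<^sub>v (T *\<^sub>v x)) \<bullet>c (T *\<^sub>v x)"
    using assms x by (simp add: assoc_vec inner_adj)
  then show "0 \<le> Re (((mat_adjoint T * A * T) *\<^sub>v x) \<bullet>c x)"
    using assms x by (simp add: psd_def)
qed

lemma psd_sandwich:
  assumes "psd n A" "psd n T"
  shows "psd n (T * A * T)"
  using psd_congruence[OF assms(1), of T] assms(2) by simp

end


section \<open>Cordes' inequality\<close>

text \<open>The constant bounds the square of the operator norm.\<close>

definition opbound :: "nat \<Rightarrow> real \<Rightarrow> complex mat \<Rightarrow> bool" where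
  "opbound n c M \<longleftrightarrow> (\<forall>x \<in> carrier_vec n. vsq (M *\<^sub>v x) \<le> c * vsq x)"

text \<open>For Hermitian \<open>H\<close> this bounds the largest eigenvalue only, on the same
  scale as \<open>H\<close>, whereas \<open>opbound\<close> lives on the squared scale. The two meet
  in \<open>opbound_qbound\<close> through the Gram matrix.\<close>

definition qbound :: "nat \<Rightarrow> real \<Rightarrow> complex mat \<Rightarrow> bool" where
  "qbound n c H \<longleftrightarrow> (\<forall>x \<in> carrier_vec n. Re ((H *\<^sub>v x) \<bullet>c x) \<le> c * vsq x)"

context fixed_dim
begin

lemma mult_zero_vec: "A \<in> carrier_mat n n \<Longrightarrow> A *\<^sub>v 0\<^sub>v n = (0\<^sub>v n :: complex vec)"
  by (intro eq_vecI) (auto intro!: scalar_prod_right_zero)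

lemma zero_mat_mult_vec: "x \<in> carrier_vec n \<Longrightarrow> 0\<^sub>m n n *\<^sub>v x = (0\<^sub>v n :: complex vec)"
  by (intro eq_vecI) auto

lemma qbound_conj_diag:
  assumes U: "unitary_mat n U"
  shows "qbound n c (conj_diag n U d) \<longleftrightarrow> (\<forall>i<n. d i \<le> c)"
proof
  assume q: "qbound n c (conj_diag n U d)"
  show "\<forall>i<n. d i \<le> c"
  proof (intro allI impI)
    fix i assume i: "i < n"
    note ev = conj_diag_eigenvector(1)[OF U i, of d] conj_diag_eigenvector(2,3)[OF U i]
    have "Re ((conj_diag n U d *\<^sub>v col U i) \<bullet>c col U i) \<le> c"
      using q ev(2,3) by (auto simp: qbound_def)
    then show "d i \<le> c" using ev by (simp add: inner_self)
  qed
next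
  assume d: "\<forall>i<n. d i \<le> c"
  show "qbound n c (conj_diag n U d)"
    unfolding qbound_def
  proof
    fix x :: "complex vec" assume x: "x \<in> carrier_vec n"
    let ?y = "mat_adjoint U *\<^sub>v x"
    have y: "?y \<in> carrier_vec n" using U x by (simp add: unitaryD)
    have "Re ((conj_diag n U d *\<^sub>v x) \<bullet>c x) = (\<Sum>k<n. d k * (cmod (?y $ k))\<^sup>2)"
      by (simp only: quadratic_form_conj_diag[OF U x] Re_complex_of_real)
    also have "\<dots> \<le> (\<Sum>k<n. c * (cmod (?y $ k))\<^sup>2)"
      using d by (intro sum_mono mult_right_mono) auto
    also have "\<dots> = c * vsq ?y"
      using carrier_vecD[OF y] by (simp only: vsq_sum sum_distrib_left)
    also have "\<dots> = c * vsq x"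
      using vsq_unitary[OF unitary_adjoint[OF U] x] by simp
    finally show "Re ((conj_diag n U d *\<^sub>v x) \<bullet>c x) \<le> c * vsq x" .
  qed
qed

lemma opbound_qbound:
  assumes "T \<in> carrier_mat n n"
  shows "opbound n c T \<longleftrightarrow> qbound n c (mat_adjoint T * T)"
proof -
  have "((mat_adjoint T * T) *\<^sub>v x) \<bullet>c x = complex_of_real (vsq (T *\<^sub>v x))" if "x \<in> carrier_vec n" for x
    using that assms by (simp add: assoc_vec inner_adj flip: inner_self)
  then show ?thesis by (simp add: opbound_def qbound_def)
qed

lemma opbound_mult:
  assumes "A \<in> carrier_mat n n" "B \<in> carrier_mat n n" "0 \<le> c" "opbound n c A" "opbound n d B"
  shows "opbound n (c * d) (A * B)"
  unfolding opbound_def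
proof
  fix x :: "complex vec" assume x: "x \<in> carrier_vec n"
  have "vsq ((A * B) *\<^sub>v x) \<le> c * vsq (B *\<^sub>v x)"
    using assms x by (simp add: assoc_vec opbound_def)
  also have "\<dots> \<le> c * (d * vsq x)"
    using assms x by (intro mult_left_mono) (auto simp: opbound_def)
  finally show "vsq ((A * B) *\<^sub>v x) \<le> c * d * vsq x" by simp
qed

lemma opbound_mono: "opbound n c A \<Longrightarrow> c \<le> d \<Longrightarrow> opbound n d A"
  unfolding opbound_def by (meson mult_right_mono order_trans vsq_nonneg)

lemma psd_gram:
  assumes T: "T \<in> carrier_mat n n"
  shows "psd n (mat_adjoint T * T)"
proof -
  have "psd n (1\<^sub>m n)"
    by (auto simp: psd_def hermitian_mat_def simp flip: vsq_def)
  from psd_congruence[OF this T] show ?thesis using T by (simp add: right_one)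
qed

text \<open>For a unit eigenvector u of \<open>T T*\<close> with eigenvalue d, the vector
  \<open>t = T* u\<close> satisfies \<open>vsq t = d\<close> and \<open>vsq (T t) = d^2\<close>. The
  bound for T applied to t gives \<open>d^2 \<le> c d\<close>.\<close>

lemma opbound_adjoint:
  assumes T: "T \<in> carrier_mat n n" and c: "0 \<le> c" and b: "opbound n c T"
  shows "opbound n c (mat_adjoint T)"
proof -
  have "psd n (T * mat_adjoint T)"
    using psd_gram[of "mat_adjoint T"] T by simp
  then obtain U d where U: "unitary_mat n U" and eq: "T * mat_adjoint T = conj_diag n U d"
    using psd_sorted by metis
  have "d i \<le> c" if i: "i < n" for i
  proof -
    let ?u = "col U i" and ?t = "mat_adjoint T *\<^sub>v col U i"
    note ev = conj_diag_eigenvector(1)[OF U i, of d] conj_diag_eigenvector(2,3)[OF U i]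
    have Tt: "T *\<^sub>v ?t = of_real (d i) \<cdot>\<^sub>v ?u"
      using ev T eq by (simp flip: assoc_vec)
    have "complex_of_real (vsq ?t) = (T *\<^sub>v ?t) \<bullet>c ?u"
      using ev(2) T by (simp add: inner_adj inner_self)
    also have "\<dots> = of_real (d i)"
      using ev by (simp add: Tt inner_self)
    finally have t: "vsq ?t = d i" by simp
    have "(d i)\<^sup>2 = vsq (T *\<^sub>v ?t)"
      by (simp add: Tt vsq_smult ev)
    also have "\<dots> \<le> c * vsq ?t"
      using b T ev(2) by (simp add: opbound_def)
    finally have "d i * d i \<le> c * d i" by (simp add: t power2_eq_square)
    then show ?thesis using c by (cases "d i > 0") auto
  qed
  then show ?thesis
    using T by (subst opbound_qbound) (auto simp: eq qbound_conj_diag[OF U])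
qed

lemma opbound_psd_square:
  assumes H: "psd n H" and c: "0 \<le> c"
  shows "opbound n (c\<^sup>2) H \<longleftrightarrow> qbound n c H"
proof -
  obtain U d where U: "unitary_mat n U" and eq: "H = conj_diag n U d" and d: "\<And>i. i < n \<Longrightarrow> d i \<ge> 0"
    using psd_sorted[OF H] by metis
  have "opbound n (c\<^sup>2) H \<longleftrightarrow> (\<forall>i<n. d i * d i \<le> c\<^sup>2)"
    using H U by (simp add: opbound_qbound eq conj_diag_mult qbound_conj_diag adjoint_conj_diag conj_diag_closed)
  also have "\<dots> \<longleftrightarrow> (\<forall>i<n. d i \<le> c)"
    using d c by (auto simp: power2_eq_square[symmetric] power2_le_iff_abs_le)
  finally show ?thesis by (simp add: eq qbound_conj_diag[OF U])
qed

lemma qbound_powr: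
  assumes H: "psd n H" and c: "0 \<le> c" and t: "0 < t"
  shows "qbound n (c powr t) (mat_powr H t) \<longleftrightarrow> qbound n c H"
proof -
  obtain U d where U: "unitary_mat n U" and eq: "H = conj_diag n U d" and d: "\<And>i. i < n \<Longrightarrow> d i \<ge> 0"
    using psd_sorted[OF H] by metis
  have "x powr t \<le> c powr t \<longleftrightarrow> x \<le> c" if "x \<ge> 0" for x
    using powr_mono2[of t x c] powr_less_mono2[of t c x] that c t by (metis leD leI less_imp_le)
  then show ?thesis
    using d U by (auto simp: eq mat_powr_conj_diag qbound_conj_diag)
qed

text \<open>The symmetrised product is similar to the original one, up to a kernel, so its norm is an eigenvalue
  of \<open>B\<^sup>u X B\<^sup>v\<close>.\<close>

lemma opbound_symmetrize:
  assumes B: "psd n B" and X: "psd n X" and w: "u + v = 2 * w" and c: "0 \<le> c"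
    and b: "opbound n c (mat_powr B u * X * mat_powr B v)"
  shows "opbound n c (mat_powr B w * X * mat_powr B w)"
proof -
  let ?H = "mat_powr B w * X * mat_powr B w" and ?K = "mat_powr B u * X * mat_powr B v"
  have H: "psd n ?H" using B X by (simp add: psd_sandwich)
  obtain U d where U: "unitary_mat n U" and eq: "?H = conj_diag n U d"
    using psd_sorted[OF H] by metis
  have "d i * d i \<le> c" if i: "i < n" for i
  proof -
    let ?v = "col U i"
    note ev = conj_diag_eigenvector(1)[OF U i, of d] conj_diag_eigenvector(2,3)[OF U i]
    define \<delta> where "\<delta> = w - v"
    have uv: "u = \<delta> + w" "w = v + \<delta>" using w by (auto simp: \<delta>_def)
    \<comment> \<open>Since \<open>u = \<delta> + w\<close> and \<open>w = v + \<delta>\<close>,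
      \<open>B^\<delta>\<close> intertwines the two products:
      \<open>(B^u X B^v) B^\<delta> = B^\<delta> (B^w X B^w)\<close>. Hence y is an eigenvector of
      \<open>?K\<close> for \<open>d i\<close>, unless it vanishes, and in that case
      \<open>d i = 0\<close>.\<close>
    define y where "y = mat_powr B \<delta> *\<^sub>v ?v"
    have y: "y \<in> carrier_vec n" using B ev by (simp add: y_def)
    have Bw: "mat_powr B w *\<^sub>v ?v = mat_powr B v *\<^sub>v y"
      using B ev(2) uv by (simp add: y_def mat_powr_mult flip: assoc_vec)
    have Hv: "?H *\<^sub>v ?v = of_real (d i) \<cdot>\<^sub>v ?v" using ev by (simp add: eq)
    have Hv2: "?H *\<^sub>v ?v = (mat_powr B w * X) *\<^sub>v (mat_powr B v *\<^sub>v y)"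
      using B X ev(2) by (subst assoc_vec) (auto simp: Bw)
    have Bu: "mat_powr B u * X = mat_powr B \<delta> * (mat_powr B w * X)"
      using B X by (simp add: mat_powr_mult' uv(1))
    have "?K *\<^sub>v y = (mat_powr B u * X) *\<^sub>v (mat_powr B v *\<^sub>v y)"
      using B X y by (subst assoc_vec) auto
    also have "\<dots> = (mat_powr B \<delta> * (mat_powr B w * X)) *\<^sub>v (mat_powr B v *\<^sub>v y)"
      by (simp only: Bu)
    also have "(mat_powr B \<delta> * (mat_powr B w * X)) *\<^sub>v (mat_powr B v *\<^sub>v y) = mat_powr B \<delta> *\<^sub>v (?H *\<^sub>v ?v)"
      using B X y by (subst assoc_vec) (auto simp: Hv2)
    also have "\<dots> = of_real (d i) \<cdot>\<^sub>v y"
      using B ev(2) by (simp add: Hv y_def mult_mat_vec[of _ n n])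
    finally have Ky: "?K *\<^sub>v y = of_real (d i) \<cdot>\<^sub>v y" .
    show ?thesis
    proof (cases "y = 0\<^sub>v n")
      case True
      have "?H *\<^sub>v ?v = 0\<^sub>v n"
        unfolding Hv2 True using B X by (simp add: mult_zero_vec)
      then have "vsq (of_real (d i) \<cdot>\<^sub>v ?v) = 0" using Hv by (simp add: vsq_def)
      then show ?thesis using ev c by (simp add: vsq_smult)
    next
      case False
      then have "vsq y > 0" using vsq_eq_0[OF y] vsq_nonneg[of y] by linarith
      moreover have "(d i)\<^sup>2 * vsq y \<le> c * vsq y"
        using b y unfolding opbound_def by (metis Ky vsq_smult norm_of_real power2_abs)
      ultimately show ?thesis by (simp add: power2_eq_square)
    qed
  qed
  then show ?thesis
    using H U by (simp add: opbound_qbound eq conj_diag_mult qbound_conj_diag adjoint_conj_diag conj_diag_closed)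
qed

text \<open>Supplies a crude constant, uniform in the exponent, from which the bootstrapping towards
  Cordes' inequality starts.\<close>

lemma mat_powr_uniform_bound:
  assumes A: "psd n A"
  shows "\<exists>L\<ge>1. \<forall>s\<in>{0..1}. opbound n L (mat_powr A s)"
proof -
  obtain U d where U: "unitary_mat n U" and eq: "A = conj_diag n U d" and d: "\<And>i. i < n \<Longrightarrow> d i \<ge> 0"
    using psd_sorted[OF A] by metis
  define L where "L = 1 + sum d {..<n}"
  have L: "L \<ge> 1" using d by (auto simp: L_def intro!: sum_nonneg)
  have "opbound n (L\<^sup>2) (mat_powr A s)" if s: "s \<in> {0..1}" for s
  proof -
    have "d i powr s \<le> L" if i: "i < n" for i
    proof -
      have "d i \<le> L" using member_le_sum[of i "{..<n}" d] d i by (auto simp: L_def)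
      then have "d i powr s \<le> L powr s" using d i s by (intro powr_mono2) auto
      also have "\<dots> \<le> L powr 1" using s L by (intro powr_mono) auto
      finally show ?thesis using L by simp
    qed
    then have "qbound n L (mat_powr A s)"
      using U d by (simp add: eq mat_powr_conj_diag qbound_conj_diag)
    then show ?thesis using A L by (subst opbound_psd_square) auto
  qed
  moreover have "L\<^sup>2 \<ge> 1" using L by simp
  ultimately show ?thesis by blast
qed

text \<open>One bootstrapping step: symmetrising \<open>B\<^sup>u A\<^sup>2\<^sup>s B\<^sup>v\<close> with \<open>u + v = 2s\<close> and one of \<open>u, v\<close> an end point
  of \<open>[0, 1]\<close> replaces the constant by its square root.\<close>

lemma cordes_step:
  assumes A: "psd n A" and B: "psd n B" and c: "0 < c" and b: "opbound n c (A * B)" and M: "0 \<le> M"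
    and hyp: "\<And>s. s \<in> {0..1} \<Longrightarrow> opbound n (M * c powr s) (mat_powr A s * mat_powr B s)"
    and s: "s \<in> {0..1}"
  shows "opbound n (sqrt M * c powr s) (mat_powr A s * mat_powr B s)"
proof -
  let ?A = "mat_powr A" and ?B = "mat_powr B" and ?k = "sqrt M * c powr s"
  have k: "?k \<ge> 0" "?k\<^sup>2 = M * c powr (2 * s)"
  proof -
    have "(c powr s)\<^sup>2 = c powr (2 * s)" by (simp add: power2_eq_square flip: powr_add)
    then show "?k \<ge> 0" "?k\<^sup>2 = M * c powr (2 * s)" using M by (simp_all add: power_mult_distrib)
  qed
  have hyp': "opbound n (M * c powr s) (?B s * ?A s)" if "s \<in> {0..1}" for s
    using opbound_adjoint[OF _ _ hyp[OF that]] A B M by (simp add: adjoint_mult)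
  have H: "opbound n (?k\<^sup>2) (?B s * ?A (2 * s) * ?B s)"
  proof (cases "2 * s \<le> 1")
    case True
    \<comment> \<open>For singular \<open>B\<close> the power 0 is a projection, not the identity,
      so the factor with exponent \<open>v = 0\<close> has to be bounded by 1.\<close>
    have "qbound n 1 (?B 0)"
    proof -
      obtain U d where U: "unitary_mat n U" and eq: "B = conj_diag n U d" and d: "\<And>i. i < n \<Longrightarrow> d i \<ge> 0"
        using psd_sorted[OF B] by metis
      then show ?thesis by (auto simp: mat_powr_conj_diag qbound_conj_diag)
    qed
    then have "opbound n 1 (?B 0)" using B opbound_psd_square[of "?B 0" 1] by simp
    then have "opbound n (M * c powr (2 * s) * 1) ((?B (2 * s) * ?A (2 * s)) * ?B 0)"
      using s True A B M by (intro opbound_mult[OF _ _ _ hyp'[of "2 * s"]]) auto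
    then show ?thesis
      unfolding k(2) using A B M by (intro opbound_symmetrize[of _ _ "2 * s" 0]) auto
  next
    case False
    \<comment> \<open>Here \<open>v = 1\<close>: splitting \<open>A^(2s)\<close> as
      \<open>A^(2s-1) A\<close> leaves one factor to which the hypothesis applies at
      \<open>2s - 1\<close> and the factor \<open>A * B\<close>, bounded by assumption.\<close>
    have "opbound n (M * c powr (2 * s - 1) * c) ((?B (2 * s - 1) * ?A (2 * s - 1)) * (A * B))"
      using s False A B M b by (intro opbound_mult[OF _ _ _ hyp'[of "2 * s - 1"]]) auto
    also have "(?B (2 * s - 1) * ?A (2 * s - 1)) * (A * B) = ?B (2 * s - 1) * ((?A (2 * s - 1) * ?A 1) * ?B 1)"
      using A B by (simp add: assoc del: mat_powr_mult)
    also have "\<dots> = ?B (2 * s - 1) * ?A (2 * s) * ?B 1"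
      using A B by (simp add: mat_powr_mult assoc del: mat_powr_one)
    also have "M * c powr (2 * s - 1) * c = ?k\<^sup>2"
      using c by (simp add: k(2) powr_diff)
    finally show ?thesis
      using A B M by (intro opbound_symmetrize[of _ _ "2 * s - 1" 1]) auto
  qed
  have "?B s * ?A (2 * s) * ?B s = ?B s * (?A s * ?A s) * ?B s"
    using A by (simp add: mat_powr_mult)
  also have "\<dots> = mat_adjoint (?A s * ?B s) * (?A s * ?B s)"
    using A B by (simp add: adjoint_mult assoc)
  finally have eq: "?B s * ?A (2 * s) * ?B s = mat_adjoint (?A s * ?B s) * (?A s * ?B s)" .
  have "psd n (?B s * ?A (2 * s) * ?B s)" using A B by (simp add: psd_sandwich)
  then have "qbound n ?k (?B s * ?A (2 * s) * ?B s)" by (rule iffD1[OF opbound_psd_square[OF _ k(1)] H])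
  then show ?thesis using A B by (subst opbound_qbound) (auto simp: eq)
qed

text \<open>Iterating the step replaces a crude constant M by its roots of order \<open>2^k\<close>,
  which tend to 1. The starting constant involves division by c, so \<open>c = 0\<close>, that is
  \<open>A * B = 0\<close>, is treated separately.\<close>

theorem cordes_inequality:
  assumes A: "psd n A" and B: "psd n B" and c: "0 \<le> c" and b: "opbound n c (A * B)" and s: "0 < s" "s \<le> 1"
  shows "opbound n (c powr s) (mat_powr A s * mat_powr B s)"
proof (cases "c = 0")
  case True
  have "A * B = 0\<^sub>m n n"
  proof (rule eq_matI)
    fix i j assume ij: "i < dim_row (0\<^sub>m n n)" "j < dim_col (0\<^sub>m n n)"
    have "vsq ((A * B) *\<^sub>v unit_vec n j) \<le> 0"
      using b by (simp add: opbound_def True)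
    then have "vsq ((A * B) *\<^sub>v unit_vec n j) = 0" using vsq_nonneg by (metis order_antisym)
    then have "(A * B) *\<^sub>v unit_vec n j = 0\<^sub>v n" using A B by (subst (asm) vsq_eq_0[of _ n]) auto
    moreover have "(A * B) *\<^sub>v unit_vec n j = col (A * B) j"
      using A B ij col_mult2[of "A * B" n n "1\<^sub>m n" n j] by (simp add: right_one)
    ultimately have "col (A * B) j $ i = 0" using ij by simp
    then show "(A * B) $$ (i, j) = 0\<^sub>m n n $$ (i, j)"
      using ij carrier_matD[OF mult_closed[of A B]] A B by simp
  qed (use carrier_matD[OF mult_closed[of A B]] A B in simp_all)
  \<comment> \<open>The exponent \<open>s - 1\<close> is not positive, so these are powers of
    generalized inverses; they reduce the exponent 1 to s on either side of the zero
    product.\<close>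
  then have "mat_powr A (s - 1) * (mat_powr A 1 * mat_powr B 1) * mat_powr B (s - 1) = 0\<^sub>m n n"
    using A B by (simp add: left_mult_zero_mat[of _ n n] right_mult_zero_mat[of _ n n])
  also have "mat_powr A (s - 1) * (mat_powr A 1 * mat_powr B 1) * mat_powr B (s - 1) = mat_powr A s * mat_powr B s"
    using A B by (simp add: assoc mat_powr_mult mat_powr_mult' del: mat_powr_one)
  finally show ?thesis by (simp add: opbound_def True zero_mat_mult_vec) (simp add: vsq_def)
next
  case False
  with c have c: "0 < c" by simp
  obtain L where L: "L \<ge> 1" "\<And>s. s \<in> {0..1} \<Longrightarrow> opbound n L (mat_powr A s)" using mat_powr_uniform_bound[OF A] by blast
  obtain L' where L': "L' \<ge> 1" "\<And>s. s \<in> {0..1} \<Longrightarrow> opbound n L' (mat_powr B s)" using mat_powr_uniform_bound[OF B] by blast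
  \<comment> \<open>On [0, 1] the function \<open>c powr s\<close> is at least
    \<open>min 1 c\<close>, so with this M the bound \<open>L * L'\<close> is below
    \<open>M * c powr s\<close> for all s at once.\<close>
  define M where "M = L * L' / min 1 c"
  have M: "M > 0" using L L' c by (simp add: M_def)
  have "opbound n (M powr ((1/2) ^ k) * c powr s) (mat_powr A s * mat_powr B s)" if "s \<in> {0..1}" for s k
    using that
  proof (induction k arbitrary: s)
    case 0
    have "min 1 c \<le> c powr s"
    proof (cases "c \<le> 1")
      case True
      then show ?thesis using powr_mono'[of s 1 c] c 0 by auto
    next
      case False
      then show ?thesis using ge_one_powr_ge_zero[of c s] c 0 by auto
    qed
    then have "L * L' * 1 \<le> L * L' * (c powr s / min 1 c)"
      using L L' c by (intro mult_left_mono) auto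
    then have "L * L' \<le> M * c powr s" by (simp add: M_def)
    moreover have "opbound n (L * L') (mat_powr A s * mat_powr B s)"
      using L L' 0 A B by (intro opbound_mult) auto
    ultimately show ?case using M by (auto intro: opbound_mono)
  next
    case (Suc k)
    have "sqrt (M powr ((1/2) ^ k)) = M powr ((1/2) ^ Suc k)"
      using M by (simp add: powr_half_sqrt[symmetric] powr_powr mult.commute)
    then show ?case
      using cordes_step[OF A B c b _ Suc.IH Suc.prems] M by simp
  qed
  then have bk: "opbound n (M powr ((1/2) ^ k) * c powr s) (mat_powr A s * mat_powr B s)" for k
    using s by simp
  show ?thesis
    unfolding opbound_def
  proof
    fix x :: "complex vec" assume x: "x \<in> carrier_vec n"
    have "(\<lambda>k. (1/2) ^ k :: real) \<longlonglongrightarrow> 0" by (rule LIMSEQ_power_zero) simp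
    then have "(\<lambda>k. M powr ((1/2) ^ k) * c powr s * vsq x) \<longlonglongrightarrow> M powr 0 * c powr s * vsq x"
      using M by (intro tendsto_intros) auto
    then show "vsq (mat_powr A s * mat_powr B s *\<^sub>v x) \<le> c powr s * vsq x"
      using bk x M by (intro LIMSEQ_le_const) (auto simp: opbound_def)
  qed
qed

end


section \<open>Norm bounds for the two means\<close>

context fixed_dim
begin

lemma cordes_powr:
  assumes "psd n A" "psd n B" "0 \<le> c" "opbound n c (mat_powr A u * mat_powr B v)" "0 < s" "s \<le> 1"
  shows "opbound n (c powr s) (mat_powr A (u * s) * mat_powr B (v * s))"
  using cordes_inequality[of "mat_powr A u" "mat_powr B v" c s] assms by (simp add: mat_powr_powr)

lemma opbound_adjoint_iff:
  "T \<in> carrier_mat n n \<Longrightarrow> 0 \<le> c \<Longrightarrow> opbound n c (mat_adjoint T) \<longleftrightarrow> opbound n c T"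
  using opbound_adjoint[of T c] opbound_adjoint[of "mat_adjoint T" c] by auto

lemma opbound_swap:
  assumes "psd n A" "psd n B" "0 \<le> c"
  shows "opbound n c (mat_powr A u * mat_powr B v) \<longleftrightarrow> opbound n c (mat_powr B v * mat_powr A u)"
  using opbound_adjoint_iff[of "mat_powr A u * mat_powr B v" c] assms by (simp add: adjoint_mult)

lemma opbound_half_powr:
  assumes H: "psd n H" and T: "psd n T"
  shows "opbound n c (mat_powr H (1/2) * T) \<longleftrightarrow> qbound n c (T * H * T)"
proof -
  have "mat_adjoint (mat_powr H (1/2) * T) * (mat_powr H (1/2) * T) = T * (mat_powr H (1/2) * (mat_powr H (1/2) * T))"
    using H T by (simp add: adjoint_mult assoc)
  also have "\<dots> = T * H * T" using H T by (simp add: mat_powr_mult' assoc)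
  finally show ?thesis using H T by (simp add: opbound_qbound)
qed

lemma opbound_half_powr_adjoint:
  assumes H: "psd n H" and T: "psd n T" and c: "0 \<le> c"
  shows "opbound n c (T * mat_powr H (1/2)) \<longleftrightarrow> qbound n c (T * H * T)"
  using opbound_half_powr[OF H T, of c] opbound_adjoint_iff[of "T * mat_powr H (1/2)" c] H T c
  by (simp add: adjoint_mult)

text \<open>Both products have the Gram matrix \<open>a^v (X a X) a^v\<close>. This is how the
  square root of \<open>b = X a X\<close> disappears from the estimates.\<close>

lemma opbound_sandwich_sqrt:
  assumes a: "psd n a" and X: "psd n X"
  shows "opbound n c (mat_powr (X * a * X) (1/2) * mat_powr a v) \<longleftrightarrow>
         opbound n c (mat_powr a (1/2) * X * mat_powr a v)"
proof -
  have "mat_adjoint (mat_powr a (1/2) * X * mat_powr a v) * (mat_powr a (1/2) * X * mat_powr a v)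
      = mat_powr a v * (X * (mat_powr a (1/2) * (mat_powr a (1/2) * (X * mat_powr a v))))"
    using a X by (simp add: adjoint_mult assoc)
  also have "\<dots> = mat_powr a v * (X * a * X) * mat_powr a v"
    using a X by (simp add: mat_powr_mult' assoc)
  finally show ?thesis
    using a X opbound_half_powr[of "X * a * X" "mat_powr a v" c] opbound_qbound[of "mat_powr a (1/2) * X * mat_powr a v" c]
    by (simp add: psd_sandwich)
qed

text \<open>In \<open>a^(1/2) X a^v\<close> the exponents of a sum to
  \<open>1 / (2\<alpha>)\<close>, twice \<open>?w\<close>. After symmetrization the bound concerns
  \<open>X^(1/2) a^?w\<close>, and Cordes' inequality with exponent \<open>2\<alpha>\<close>,
  admissible for \<open>\<alpha> \<le> 1/2\<close>, gives \<open>X^\<alpha> a^(1/2)\<close>.\<close>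

lemma sandwich_bound_small_exponent:
  assumes a: "psd n a" and X: "psd n X" and \<alpha>: "0 < \<alpha>" "\<alpha> \<le> 1/2" and c: "0 \<le> c"
    and b: "opbound n c (mat_powr (X * a * X) (1/2) * mat_powr a ((1 - \<alpha>) / (2 * \<alpha>)))"
  shows "opbound n (c powr \<alpha>) (mat_powr X \<alpha> * mat_powr a (1/2))"
proof -
  let ?w = "1 / (4 * \<alpha>)"
  have H: "psd n (mat_powr a ?w * X * mat_powr a ?w)" using a X by (simp add: psd_sandwich)
  have "opbound n c (mat_powr a (1/2) * X * mat_powr a ((1 - \<alpha>) / (2 * \<alpha>)))"
    using b a X by (simp add: opbound_sandwich_sqrt)
  then have "opbound n c (mat_powr a ?w * X * mat_powr a ?w)"
    using \<alpha> a X c by (intro opbound_symmetrize[of _ _ "1/2" "(1 - \<alpha>) / (2 * \<alpha>)"]) (auto simp: field_simps)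
  then have "qbound n (sqrt c) (mat_powr a ?w * X * mat_powr a ?w)"
    using opbound_psd_square[OF H, of "sqrt c"] c by simp
  then have "opbound n (sqrt c) (mat_powr X (1/2) * mat_powr a ?w)"
    using a X by (simp add: opbound_half_powr)
  from cordes_powr[OF X a _ this, of "2 * \<alpha>"] \<alpha> c show ?thesis
    by (simp add: powr_half_sqrt[symmetric] powr_powr)
qed

text \<open>Cordes' inequality with exponent \<open>?s\<close>, at most 1 exactly when
  \<open>\<alpha> \<ge> 1/2\<close>, turns \<open>X^\<alpha> a^(1/2)\<close> into
  \<open>X^(1-\<alpha>) a^v\<close>. Multiplied by the adjoint of the original product this is
  \<open>a^(1/2) X a^v\<close>, with constant \<open>c * c^?s = c^(1/\<alpha>)\<close>.\<close>

lemma sandwich_bound_large_exponent: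
  assumes a: "psd n a" and X: "psd n X" and \<alpha>: "1/2 \<le> \<alpha>" "\<alpha> < 1" and c: "0 \<le> c"
    and b: "opbound n c (mat_powr X \<alpha> * mat_powr a (1/2))"
  shows "opbound n (c powr (1 / \<alpha>)) (mat_powr (X * a * X) (1/2) * mat_powr a ((1 - \<alpha>) / (2 * \<alpha>)))"
proof -
  let ?s = "(1 - \<alpha>) / \<alpha>"
  have 1: "opbound n c (mat_powr a (1/2) * mat_powr X \<alpha>)"
    using b a X c by (simp add: opbound_swap)
  have "opbound n (c powr ?s) (mat_powr X (\<alpha> * ?s) * mat_powr a (1/2 * ?s))"
    using cordes_powr[OF X a c b, of ?s] \<alpha> by (simp add: field_simps)
  then have "opbound n (c * c powr ?s) ((mat_powr a (1/2) * mat_powr X \<alpha>) * (mat_powr X (\<alpha> * ?s) * mat_powr a (1/2 * ?s)))"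
    using a X c 1 by (intro opbound_mult) auto
  also have "(mat_powr a (1/2) * mat_powr X \<alpha>) * (mat_powr X (\<alpha> * ?s) * mat_powr a (1/2 * ?s)) =
      mat_powr a (1/2) * X * mat_powr a ((1 - \<alpha>) / (2 * \<alpha>))"
    using a X \<alpha> by (simp add: assoc mat_powr_mult')
  also have "c * c powr ?s = c powr (1 / \<alpha>)"
  proof (cases "c = 0")
    case False
    then have "c * c powr ?s = c powr (1 + ?s)" using c by (simp add: powr_add)
    also have "1 + ?s = 1 / \<alpha>" using \<alpha> by (simp add: field_simps)
    finally show ?thesis .
  qed simp
  finally show ?thesis using a X by (simp add: opbound_sandwich_sqrt)
qed

text \<open>The two bounds above are also used with \<open>a\<close>, \<open>X\<close>, \<open>\<alpha>\<close> replaced by \<open>X a X\<close>, \<open>X\<^sup>-\<^sup>1\<close>, \<open>1 - \<alpha>\<close>,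
  where \<open>X\<^sup>-\<^sup>1 (X a X) X\<^sup>-\<^sup>1\<close> is the compression of \<open>a\<close> to the range of \<open>X\<close>.\<close>

lemma opbound_compression:
  assumes a: "psd n a" and X: "psd n X"
  defines "b \<equiv> X * a * X" and "Y \<equiv> mat_powr X (- 1)"
  shows "opbound n c (mat_powr (Y * b * Y) (1/2) * mat_powr b t) \<longleftrightarrow>
         opbound n c (mat_powr a (1/2) * mat_powr b t)"
proof -
  let ?P = "mat_powr X 0"
  have b: "psd n b" and Y: "psd n Y" using a X by (simp_all add: b_def Y_def psd_sandwich)
  have XY: "X * (mat_powr X r * T) = mat_powr X (1 + r) * T" "mat_powr X r * (X * T) = mat_powr X (r + 1) * T"
    if "T \<in> carrier_mat n n" for r T
    using mat_powr_mult'[OF X that, of 1 r] mat_powr_mult'[OF X that, of r 1] X by simp_all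
  have YbY: "Y * b * Y = ?P * a * ?P"
    using a X mat_powr_mult[of X 1 "- 1"] by (simp add: b_def Y_def assoc XY)
  have "b = ?P * b" using a X mat_powr_mult'[of X _ 0 1] by (simp add: b_def assoc)
  \<comment> \<open>Writing \<open>b^t\<close> as \<open>b b^(t-1)\<close> extends the absorption of
    the projection \<open>?P\<close> from b to its powers, whatever the sign of t.\<close>
  then have "b * mat_powr b (t - 1) = ?P * (b * mat_powr b (t - 1))"
    using b X by (metis assoc mat_powr_closed psd_closed)
  then have Pb: "?P * mat_powr b t = mat_powr b t"
    using b mat_powr_mult[OF b, of 1 "t - 1"] by simp
  have bP: "mat_powr b t * ?P = mat_powr b t"
    using arg_cong[OF Pb, of mat_adjoint] b X by (simp add: adjoint_mult)
  have "mat_powr b t * (Y * b * Y) * mat_powr b t = (mat_powr b t * ?P) * a * (?P * mat_powr b t)"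
    unfolding YbY using a X b by (simp add: assoc)
  then have "mat_powr b t * (Y * b * Y) * mat_powr b t = mat_powr b t * a * mat_powr b t"
    by (simp only: Pb bP)
  then show ?thesis
    using a X b Y by (simp add: opbound_half_powr psd_sandwich)
qed

text \<open>The spectral side is invariant under the exchange:
  \<open>Y^(1-\<alpha>) = X^(\<alpha>-1)\<close>, and sandwiching \<open>X a X\<close> between two
  such factors leaves \<open>X^\<alpha> a X^\<alpha>\<close>.\<close>

lemma opbound_dual:
  assumes a: "psd n a" and X: "psd n X" and c: "0 \<le> c"
  shows "opbound n c (mat_powr (mat_powr X (- 1)) (1 - \<alpha>) * mat_powr (X * a * X) (1/2)) \<longleftrightarrow>
         qbound n c (mat_powr X \<alpha> * a * mat_powr X \<alpha>)"
proof -
  have XY: "mat_powr X r * (X * T) = mat_powr X (r + 1) * T"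
    if "T \<in> carrier_mat n n" for r T
    using mat_powr_mult'[OF X that, of r 1] X by simp_all
  have "mat_powr X (\<alpha> - 1) * (X * a * X) * mat_powr X (\<alpha> - 1) = mat_powr X \<alpha> * a * mat_powr X \<alpha>"
    using a X mat_powr_mult[OF X, of 1 "\<alpha> - 1"] by (simp add: assoc XY)
  then show ?thesis
    using opbound_half_powr_adjoint[of "X * a * X" "mat_powr X (\<alpha> - 1)" c] a X c
    by (simp add: mat_powr_powr psd_sandwich)
qed

text \<open>Cordes' inequality first normalizes one exponent of the Renyi product to 1/2: that of
  \<open>X a X\<close> by \<open>1 / (\<alpha> r)\<close> when \<open>\<alpha> \<le> 1/2\<close>,
  that of a by \<open>1 / ((1-\<alpha>) r)\<close> otherwise. In each case this is the more
  restrictive of the two conditions on r; then the small-exponent bound applies, directly or after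
  the exchange.\<close>

lemma spectral_le_renyi_bound:
  assumes a: "psd n a" and X: "psd n X" and \<alpha>: "0 < \<alpha>" "\<alpha> < 1" and r: "1 \<le> \<alpha> * r" "1 \<le> (1 - \<alpha>) * r" and c: "0 \<le> c"
    and bd: "opbound n c (mat_powr (X * a * X) (\<alpha> * r / 2) * mat_powr a ((1 - \<alpha>) * r / 2))"
  shows "qbound n (c powr (1 / r)) (mat_powr X \<alpha> * a * mat_powr X \<alpha>)"
proof -
  have r0: "r > 0" using \<alpha> r by (metis less_numeral_extra(1) less_le_trans zero_less_mult_pos)
  have b: "psd n (X * a * X)" using a X by (simp add: psd_sandwich)
  show ?thesis
  proof (cases "\<alpha> \<le> 1/2")
    case True
    have "opbound n (c powr (1 / (\<alpha> * r))) (mat_powr (X * a * X) (1/2) * mat_powr a ((1 - \<alpha>) / (2 * \<alpha>)))"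
      using cordes_powr[OF b a c bd, of "1 / (\<alpha> * r)"] \<alpha> r r0 by (simp add: mult.commute)
    from sandwich_bound_small_exponent[OF a X _ True _ this] \<alpha> c
    have "opbound n (c powr (1 / r)) (mat_powr X \<alpha> * mat_powr a (1/2))" by (simp add: powr_powr)
    then show ?thesis using a X c by (simp add: opbound_half_powr_adjoint)
  next
    case False
    let ?\<beta> = "1 - \<alpha>" and ?b = "X * a * X" and ?Y = "mat_powr X (- 1)"
    have Y: "psd n ?Y" using X by simp
    have "opbound n (c powr (1 / (?\<beta> * r))) (mat_powr ?b (\<alpha> / (2 * ?\<beta>)) * mat_powr a (1/2))"
      using cordes_powr[OF b a c bd, of "1 / (?\<beta> * r)"] \<alpha> r r0 by (simp add: mult.commute)
    then have "opbound n (c powr (1 / (?\<beta> * r))) (mat_powr a (1/2) * mat_powr ?b (\<alpha> / (2 * ?\<beta>)))"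
      using a b c by (simp add: opbound_swap)
    then have "opbound n (c powr (1 / (?\<beta> * r))) (mat_powr (?Y * ?b * ?Y) (1/2) * mat_powr ?b ((1 - ?\<beta>) / (2 * ?\<beta>)))"
      using opbound_compression[OF a X] by simp
    from sandwich_bound_small_exponent[OF b Y _ _ _ this] False \<alpha> c
    have "opbound n (c powr (1 / r)) (mat_powr ?Y ?\<beta> * mat_powr ?b (1/2))" by (simp add: powr_powr)
    then show ?thesis using a X c by (simp add: opbound_dual)
  qed
qed

text \<open>The steps of the opposite bound in reverse order: the large-exponent bound reaches the
  normalized product, and Cordes' inequality comes last, with exponent \<open>\<alpha> r\<close> or
  \<open>(1-\<alpha>) r\<close>.\<close>

lemma renyi_le_spectral_bound:
  assumes a: "psd n a" and X: "psd n X" and \<alpha>: "0 < \<alpha>" "\<alpha> < 1" and r: "0 < r" "\<alpha> * r \<le> 1" "(1 - \<alpha>) * r \<le> 1" and c: "0 \<le> c"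
    and bd: "qbound n c (mat_powr X \<alpha> * a * mat_powr X \<alpha>)"
  shows "opbound n (c powr r) (mat_powr (X * a * X) (\<alpha> * r / 2) * mat_powr a ((1 - \<alpha>) * r / 2))"
proof -
  have b: "psd n (X * a * X)" using a X by (simp add: psd_sandwich)
  show ?thesis
  proof (cases "1/2 \<le> \<alpha>")
    case True
    have "opbound n c (mat_powr X \<alpha> * mat_powr a (1/2))"
      using bd a X c by (simp add: opbound_half_powr_adjoint)
    from sandwich_bound_large_exponent[OF a X True _ _ this] \<alpha> c
    have "opbound n (c powr (1 / \<alpha>)) (mat_powr (X * a * X) (1/2) * mat_powr a ((1 - \<alpha>) / (2 * \<alpha>)))" by simp
    from cordes_powr[OF b a _ this, of "\<alpha> * r"] \<alpha> r c show ?thesis by (simp add: powr_powr)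
  next
    case False
    let ?\<beta> = "1 - \<alpha>" and ?b = "X * a * X" and ?Y = "mat_powr X (- 1)"
    have Y: "psd n ?Y" using X by simp
    have "opbound n c (mat_powr ?Y ?\<beta> * mat_powr ?b (1/2))"
      using bd a X c by (simp add: opbound_dual)
    from sandwich_bound_large_exponent[OF b Y _ _ _ this] False \<alpha> c
    have "opbound n (c powr (1 / ?\<beta>)) (mat_powr (?Y * ?b * ?Y) (1/2) * mat_powr ?b (\<alpha> / (2 * ?\<beta>)))" by simp
    then have "opbound n (c powr (1 / ?\<beta>)) (mat_powr a (1/2) * mat_powr ?b (\<alpha> / (2 * ?\<beta>)))"
      using opbound_compression[OF a X] by simp
    moreover have "\<alpha> / (2 * ?\<beta>) * (?\<beta> * r) = \<alpha> * r / 2" "1 / ?\<beta> * (?\<beta> * r) = r" using \<alpha> by (simp_all add: field_split_simps)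
    ultimately have "opbound n (c powr r) (mat_powr a (?\<beta> * r / 2) * mat_powr ?b (\<alpha> * r / 2))"
      using cordes_powr[OF a b, of "c powr (1 / ?\<beta>)" "1/2" "\<alpha> / (2 * ?\<beta>)" "?\<beta> * r"] \<alpha> r c by (simp only: powr_powr) simp
    then show ?thesis using a b c by (simp add: opbound_swap)
  qed
qed

section \<open>Passing from \<open>SG\<close> and \<open>Renyi\<close> to the matrices a, b and
  X\<close>

lemma psd_geom_mean [simp]: "psd n A \<Longrightarrow> psd n B \<Longrightarrow> psd n (geom_mean A B)"
  by (simp add: geom_mean_def psd_sandwich)

lemma psd_SG: "psd n A \<Longrightarrow> psd n B \<Longrightarrow> psd n (SG \<alpha> p A B)"
  by (simp add: SG_def Let_def psd_sandwich)

lemma psd_Renyi: "psd n A \<Longrightarrow> psd n B \<Longrightarrow> psd n (Renyi \<alpha> p A B)"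
  by (simp add: Renyi_def psd_sandwich)

text \<open>With \<open>X = a^(-1/2) N a^(-1/2)\<close> and \<open>N^2 = a^(1/2) b a^(1/2)\<close>,
  the product \<open>X a X\<close> collapses to \<open>A^0 b A^0\<close>. The support condition
  removes the two projections.\<close>

lemma geom_mean_riccati:
  fixes p :: real
  assumes A: "psd n A" and B: "psd n B" and supp: "B * mat_powr A 0 = B"
  defines "X \<equiv> geom_mean (mat_powr A (- p)) (mat_powr B p)"
  shows "X * mat_powr A p * X = mat_powr B p"
proof -
  let ?A = "mat_powr A"
  let ?N2 = "?A (p/2) * mat_powr B p * ?A (p/2)"
  let ?N = "mat_powr ?N2 (1/2)"
  have N2: "psd n ?N2" using A B by (simp add: psd_sandwich)
  have N: "psd n ?N" using N2 by (rule psd_mat_powr)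
  have X: "X = ?A (- (p/2)) * ?N * ?A (- (p/2))"
    using A by (simp add: X_def geom_mean_def mat_powr_powr)
  have "?A 0 * ?N2 = ?N2" using A B by (simp add: assoc mat_powr_mult')
  \<comment> \<open>\<open>?N\<close> is \<open>?N2\<close> times \<open>?N2^(-1/2)\<close>, so the
    projection absorbed by \<open>?N2\<close> on the left is absorbed by its square root as
    well.\<close>
  then have "?A 0 * (mat_powr ?N2 1 * mat_powr ?N2 (- (1/2))) = mat_powr ?N2 1 * mat_powr ?N2 (- (1/2))"
    using A N2 by (simp flip: assoc)
  then have AN: "?A 0 * ?N = ?N" using mat_powr_mult[OF N2, of 1 "- (1/2)"] by simp
  have NN: "?N * ?N = ?N2" using mat_powr_mult[OF N2, of "1/2" "1/2"] N2 by simp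
  have BA: "mat_powr B p * ?A 0 = mat_powr B p"
  proof -
    have "mat_powr B (p - 1) * mat_powr B 1 * ?A 0 = mat_powr B (p - 1) * mat_powr B 1"
      using A B supp by (simp add: assoc)
    then show ?thesis using mat_powr_mult[OF B, of "p - 1" 1] by simp
  qed
  have AB: "?A 0 * mat_powr B p = mat_powr B p"
    using arg_cong[OF BA, of mat_adjoint] A B by (simp add: adjoint_mult)
  have "X * ?A p * X = ?A (- (p/2)) * (?N * ((?A (- (p/2)) * (?A p * ?A (- (p/2)))) * ?N)) * ?A (- (p/2))"
    using A N by (simp add: X assoc)
  also have "?A (- (p/2)) * (?A p * ?A (- (p/2))) = ?A 0"
    by (simp add: mat_powr_mult[OF A])
  also have "?A (- (p/2)) * (?N * (?A 0 * ?N)) * ?A (- (p/2)) =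
      (?A (- (p/2)) * ?A (p/2)) * mat_powr B p * (?A (p/2) * ?A (- (p/2)))"
    using A B unfolding AN NN by (simp add: assoc)
  also have "\<dots> = mat_powr B p" using A B by (simp add: mat_powr_mult AB BA)
  finally show ?thesis .
qed

lemma qbound_SG:
  fixes p \<alpha> c :: real
  assumes "psd n A" "psd n B" "0 < p" "0 \<le> c"
  defines "X \<equiv> geom_mean (mat_powr A (- p)) (mat_powr B p)"
  shows "qbound n c (SG \<alpha> p A B) \<longleftrightarrow> qbound n (c powr p) (mat_powr X \<alpha> * mat_powr A p * mat_powr X \<alpha>)"
proof -
  have W: "psd n (mat_powr X \<alpha> * mat_powr A p * mat_powr X \<alpha>)"
    using assms(1,2) by (simp add: X_def psd_sandwich)
  have "SG \<alpha> p A B = mat_powr (mat_powr X \<alpha> * mat_powr A p * mat_powr X \<alpha>) (1 / p)"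
    by (simp add: SG_def X_def Let_def)
  then show ?thesis
    using qbound_powr[OF W, of "c powr p" "1 / p"] assms(3,4) by (simp add: powr_powr)
qed

lemma qbound_Renyi:
  assumes A: "psd n A" and B: "psd n B" and pq: "0 < p" "0 < q" and c: "0 \<le> c"
  shows "qbound n c (Renyi \<alpha> q A B) \<longleftrightarrow>
    opbound n (c powr q) (mat_powr (mat_powr B p) (\<alpha> * (q / p) / 2) * mat_powr (mat_powr A p) ((1 - \<alpha>) * (q / p) / 2))"
proof -
  let ?W = "mat_powr A ((1 - \<alpha>) / 2 * q) * mat_powr B (\<alpha> * q) * mat_powr A ((1 - \<alpha>) / 2 * q)"
  have W: "psd n ?W" using A B by (simp add: psd_sandwich)
  have "qbound n c (Renyi \<alpha> q A B) \<longleftrightarrow> qbound n (c powr q) ?W"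
    using qbound_powr[OF W, of "c powr q" "1 / q"] pq c by (simp add: Renyi_def powr_powr)
  also have "\<dots> \<longleftrightarrow> opbound n (c powr q) (mat_powr B (\<alpha> * q / 2) * mat_powr A ((1 - \<alpha>) / 2 * q))"
    using opbound_half_powr[of "mat_powr B (\<alpha> * q)" "mat_powr A ((1 - \<alpha>) / 2 * q)"] A B
    by (simp add: mat_powr_powr)
  finally show ?thesis using A B pq by (simp add: mat_powr_powr)
qed

lemma qbound_SG_of_Renyi:
  assumes A: "psd n A" and B: "psd n B" and supp: "B * mat_powr A 0 = B"
    and \<alpha>: "0 < \<alpha>" "\<alpha> < 1" and pq: "0 < p" "0 < q" "p \<le> \<alpha> * q" "p \<le> (1 - \<alpha>) * q" and c: "0 \<le> c"
    and bd: "qbound n c (Renyi \<alpha> q A B)"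
  shows "qbound n c (SG \<alpha> p A B)"
proof -
  define X where "X = geom_mean (mat_powr A (- p)) (mat_powr B p)"
  have X: "psd n X" using A B by (simp add: X_def)
  have R: "X * mat_powr A p * X = mat_powr B p" using geom_mean_riccati[OF A B supp] by (simp add: X_def)
  have "qbound n ((c powr q) powr (1 / (q / p))) (mat_powr X \<alpha> * mat_powr A p * mat_powr X \<alpha>)"
  proof (rule spectral_le_renyi_bound)
    show "opbound n (c powr q) (mat_powr (X * mat_powr A p * X) (\<alpha> * (q / p) / 2) * mat_powr (mat_powr A p) ((1 - \<alpha>) * (q / p) / 2))"
      using bd qbound_Renyi[OF A B pq(1,2) c] by (simp only: R)
    show "1 \<le> \<alpha> * (q / p)" "1 \<le> (1 - \<alpha>) * (q / p)" using pq by (simp_all add: pos_le_divide_eq)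
  qed (use X A \<alpha> c in simp_all)
  then show ?thesis using A B pq c by (simp add: qbound_SG powr_powr X_def)
qed

lemma qbound_Renyi_of_SG:
  assumes A: "psd n A" and B: "psd n B" and supp: "B * mat_powr A 0 = B"
    and \<alpha>: "0 < \<alpha>" "\<alpha> < 1" and pq: "0 < p" "0 < q" "\<alpha> * q \<le> p" "(1 - \<alpha>) * q \<le> p" and c: "0 \<le> c"
    and bd: "qbound n c (SG \<alpha> p A B)"
  shows "qbound n c (Renyi \<alpha> q A B)"
proof -
  define X where "X = geom_mean (mat_powr A (- p)) (mat_powr B p)"
  have X: "psd n X" using A B by (simp add: X_def)
  have R: "X * mat_powr A p * X = mat_powr B p" using geom_mean_riccati[OF A B supp] by (simp add: X_def)
  have "opbound n ((c powr p) powr (q / p)) (mat_powr (X * mat_powr A p * X) (\<alpha> * (q / p) / 2) * mat_powr (mat_powr A p) ((1 - \<alpha>) * (q / p) / 2))"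
  proof (rule renyi_le_spectral_bound)
    show "qbound n (c powr p) (mat_powr X \<alpha> * mat_powr A p * mat_powr X \<alpha>)"
      using bd qbound_SG[OF A B pq(1) c] by (simp only: X_def)
    show "0 < q / p" "\<alpha> * (q / p) \<le> 1" "(1 - \<alpha>) * (q / p) \<le> 1" using pq by (simp_all add: pos_divide_le_eq)
  qed (use X A \<alpha> c in simp_all)
  then show ?thesis using A B pq c by (simp add: qbound_Renyi powr_powr R)
qed

end


section \<open>Compound matrices\<close>

text \<open>Strictly increasing lists stand for the \<open>k\<close>-element subsets that index the compound matrix.\<close>

definition combs :: "nat \<Rightarrow> nat \<Rightarrow> nat list list" where
  "combs n k = filter (sorted_wrt (<)) (List.n_lists k [0..<n])"

lemma set_combs: "s \<in> set (combs n k) \<longleftrightarrow> length s = k \<and> set s \<subseteq> {..<n} \<and> sorted_wrt (<) s"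
  by (auto simp: combs_def set_n_lists)

lemma distinct_combs: "distinct (combs n k)"
  by (simp add: combs_def distinct_n_lists)

lemma combs_nth_less: "s \<in> set (combs n k) \<Longrightarrow> a < k \<Longrightarrow> s ! a < n"
  by (auto simp: set_combs dest!: nth_mem)

lemma distinct_comb: "s \<in> set (combs n k) \<Longrightarrow> distinct s"
  by (simp add: set_combs strict_sorted_iff)

lemma combs_eq_iff: "s \<in> set (combs n k) \<Longrightarrow> t \<in> set (combs n k) \<Longrightarrow> s = t \<longleftrightarrow> set s = set t"
  by (auto simp: set_combs intro: strict_sorted_equal)

lemma sum_nth_combs: "(\<Sum>l<length (combs n k). f (combs n k ! l)) = (\<Sum>u\<in>set (combs n k). f u)"
  by (rule sum.reindex_bij_betw) (simp add: bij_betw_nth distinct_combs)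

definition minor :: "'a :: comm_ring_1 mat \<Rightarrow> nat list \<Rightarrow> nat list \<Rightarrow> 'a" where
  "minor A s t = det (mat (length s) (length s) (\<lambda>(a, b). A $$ (s ! a, t ! b)))"

text \<open>An injective choice of k indices is the increasing enumeration of its image preceded by
  a unique permutation. This regroups the sum in the Cauchy-Binet formula.\<close>

lemma injective_selection_bij:
  "bij_betw (\<lambda>(u, \<pi>). restrict (\<lambda>a. u ! \<pi> a) {0..<k}) (set (combs n k) \<times> {\<pi>. \<pi> permutes {0..<k}})
     {g \<in> {0..<k} \<rightarrow>\<^sub>E {0..<n}. inj_on g {0..<k}}"
  (is "bij_betw ?F ?S ?T")
  unfolding bij_betw_def
proof
  have im: "restrict (\<lambda>a. u ! \<pi> a) {0..<k} ` {0..<k} = set u"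
    if "u \<in> set (combs n k)" "\<pi> permutes {0..<k}" for u \<pi>
  proof -
    have "restrict (\<lambda>a. u ! \<pi> a) {0..<k} ` {0..<k} = (!) u ` (\<pi> ` {0..<k})" by (auto simp: image_image)
    also have "\<dots> = (!) u ` {0..<k}" by (simp only: permutes_image[OF that(2)])
    also have "\<dots> = set u"
    proof -
      have "length u = k" using that(1) by (simp add: set_combs)
      then show ?thesis by (auto simp: in_set_conv_nth)
    qed
    finally show ?thesis .
  qed
  show "inj_on ?F ?S"
  proof (rule inj_onI, clarify)
    fix u \<pi> u' \<pi>'
    assume u: "u \<in> set (combs n k)" "u' \<in> set (combs n k)" and p: "\<pi> permutes {0..<k}" "\<pi>' permutes {0..<k}"
      and eq: "restrict (\<lambda>a. u ! \<pi> a) {0..<k} = restrict (\<lambda>a. u' ! \<pi>' a) {0..<k}"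
    have uu: "u = u'"
      using im[OF u(1) p(1)] im[OF u(2) p(2)] eq combs_eq_iff[OF u] by simp
    moreover have "\<pi> a = \<pi>' a" for a
    proof (cases "a < k")
      case True
      have "u ! \<pi> a = u ! \<pi>' a" using fun_cong[OF eq, of a] True uu by simp
      moreover have "\<pi> a < k" "\<pi>' a < k" using p True permutes_in_image by (metis atLeastLessThan_iff zero_le)+
      moreover have "distinct u" "length u = k" using u(1) by (auto simp: distinct_comb set_combs)
      ultimately show ?thesis by (simp add: nth_eq_iff_index_eq)
    next
      case False
      then show ?thesis using p by (simp add: permutes_def)
    qed
    ultimately show "u = u' \<and> \<pi> = \<pi>'" by auto
  qed
  show "?F ` ?S = ?T"
  proof (intro equalityI subsetI)
    fix g assume "g \<in> ?F ` ?S"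
    then obtain u \<pi> where u: "u \<in> set (combs n k)" and p: "\<pi> permutes {0..<k}"
      and g: "g = restrict (\<lambda>a. u ! \<pi> a) {0..<k}" by auto
    have pk: "\<pi> a < k" if "a < k" for a using permutes_in_image[OF p, of a] that by simp
    have "inj_on g {0..<k}"
    proof (rule inj_onI)
      fix a b assume ab: "a \<in> {0..<k}" "b \<in> {0..<k}" "g a = g b"
      then have "u ! \<pi> a = u ! \<pi> b" by (simp add: g)
      then have "\<pi> a = \<pi> b" using ab pk u distinct_comb[OF u] by (simp add: nth_eq_iff_index_eq set_combs)
      then show "a = b" using permutes_inj[OF p] by (auto dest: injD)
    qed
    moreover have "g \<in> {0..<k} \<rightarrow>\<^sub>E {0..<n}"
      using pk combs_nth_less[OF u] by (auto simp: g)
    ultimately show "g \<in> ?T" by simp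
  next
    fix g assume "g \<in> ?T"
    then have g: "g \<in> {0..<k} \<rightarrow>\<^sub>E {0..<n}" "inj_on g {0..<k}" by auto
    define u where "u = sorted_list_of_set (g ` {0..<k})"
    have su: "set u = g ` {0..<k}" "length u = k" "sorted_wrt (<) u" "distinct u"
      using g(2) by (auto simp: u_def card_image)
    have u: "u \<in> set (combs n k)" using su g(1) by (auto simp: set_combs)
    have "bij_betw ((!) u) {0..<k} (set u)"
      using su by (intro bij_betw_nth) auto
    then have inv: "bij_betw (inv_into {0..<k} ((!) u)) (g ` {0..<k}) {0..<k}"
      by (simp add: bij_betw_inv_into su)
    have gb: "bij_betw g {0..<k} (g ` {0..<k})" using g(2) by (simp add: bij_betw_def)
    define \<pi> where "\<pi> a = (if a \<in> {0..<k} then inv_into {0..<k} ((!) u) (g a) else a)" for a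
    have "bij_betw \<pi> {0..<k} {0..<k} \<longleftrightarrow> bij_betw (inv_into {0..<k} ((!) u) \<circ> g) {0..<k} {0..<k}"
      by (rule bij_betw_cong) (simp add: \<pi>_def)
    then have "bij_betw \<pi> {0..<k} {0..<k}"
      using bij_betw_trans[OF gb inv] by simp
    then have p: "\<pi> permutes {0..<k}"
      by (rule bij_imp_permutes) (auto simp: \<pi>_def)
    have "u ! \<pi> a = g a" if "a < k" for a
    proof -
      have "g a \<in> (!) u ` {0..<k}"
        using that su \<open>bij_betw ((!) u) {0..<k} (set u)\<close> by (simp add: bij_betw_def)
      then show ?thesis using that by (simp add: \<pi>_def f_inv_into_f)
    qed
    moreover have "g a = undefined" if "\<not> a < k" for a using PiE_arb[OF g(1), of a] that by simp
    ultimately have "g = ?F (u, \<pi>)" by (intro ext) simp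
    then show "g \<in> ?F ` ?S" using u p by blast
  qed
qed

text \<open>Expanding every entry of \<open>A * B\<close> gives a sum over all maps g that pick an
  inner index for each row. The coefficient \<open>D g\<close> is the determinant formed from the
  rows of B chosen by g: it vanishes for a repeated row, and otherwise is a signed minor of B, whose
  signs assemble the minors of A.\<close>

theorem cauchy_binet:
  fixes A B :: "'a :: comm_ring_1 mat"
  assumes A: "A \<in> carrier_mat m n" and B: "B \<in> carrier_mat n l"
    and s: "length s = k" "set s \<subseteq> {..<m}" and t: "length t = k" "set t \<subseteq> {..<l}"
  shows "minor (A * B) s t = (\<Sum>u\<in>set (combs n k). minor A s u * minor B u t)"
proof -
  let ?K = "{0..<k}" and ?N = "{0..<n}"
  let ?P = "{\<pi>. \<pi> permutes ?K}"
  let ?a = "\<lambda>g. \<Prod>a\<in>?K. A $$ (s ! a, g a)"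
  define D where "D g = det (mat k k (\<lambda>(a, b). B $$ (g a, t ! b)))" for g
  have st: "s ! a < m" "t ! a < l" if "a < k" for a
    using s t that by (metis lessThan_iff nth_mem subsetD)+
  have D: "D g = (\<Sum>\<pi>\<in>?P. signof \<pi> * (\<Prod>a\<in>?K. B $$ (g a, t ! \<pi> a)))" for g
  proof -
    have "D g = (\<Sum>\<pi>\<in>?P. signof \<pi> * (\<Prod>a\<in>?K. mat k k (\<lambda>(a, b). B $$ (g a, t ! b)) $$ (a, \<pi> a)))"
      unfolding D_def by (rule det_def') simp
    also have "\<dots> = (\<Sum>\<pi>\<in>?P. signof \<pi> * (\<Prod>a\<in>?K. B $$ (g a, t ! \<pi> a)))"
      using permutes_in_image by (fastforce intro!: sum.cong prod.cong arg_cong2[where f = "(*)"])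
    finally show ?thesis .
  qed
  have D_noninj: "D g = 0" if "\<not> inj_on g ?K" for g
  proof -
    from that obtain a b where "a < k" "b < k" "a \<noteq> b" "g a = g b" by (auto simp: inj_on_def)
    then show ?thesis unfolding D_def by (intro det_identical_rows[of _ k a b]) (auto intro!: eq_vecI)
  qed
  have D_perm: "D (restrict (\<lambda>a. u ! \<pi> a) ?K) = signof \<pi> * minor B u t"
    if "\<pi> permutes ?K" "u \<in> set (combs n k)" for \<pi> u
  proof -
    let ?M = "mat k k (\<lambda>(a, b). B $$ (u ! a, t ! b))"
    have lt: "\<pi> a < k" if "a < k" for a using permutes_in_image[OF \<open>\<pi> permutes ?K\<close>, of a] that by simp
    have "mat k k (\<lambda>(a, b). B $$ (restrict (\<lambda>a. u ! \<pi> a) ?K a, t ! b)) = mat k k (\<lambda>(i, j). ?M $$ (\<pi> i, j))"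
      by (intro eq_matI) (auto simp: lt)
    then have "D (restrict (\<lambda>a. u ! \<pi> a) ?K) = det (mat k k (\<lambda>(i, j). ?M $$ (\<pi> i, j)))"
      by (simp add: D_def)
    also have "\<dots> = signof \<pi> * det ?M" using that by (intro det_permute_rows) auto
    also have "det ?M = minor B u t" using that by (simp add: minor_def set_combs)
    finally show ?thesis .
  qed
  have minA: "minor A s u = (\<Sum>\<pi>\<in>?P. signof \<pi> * (\<Prod>a\<in>?K. A $$ (s ! a, u ! \<pi> a)))" for u
  proof -
    have "minor A s u = (\<Sum>\<pi>\<in>?P. signof \<pi> * (\<Prod>a\<in>?K. mat k k (\<lambda>(a, b). A $$ (s ! a, u ! b)) $$ (a, \<pi> a)))"
      unfolding minor_def s(1) by (rule det_def') simp
    also have "\<dots> = (\<Sum>\<pi>\<in>?P. signof \<pi> * (\<Prod>a\<in>?K. A $$ (s ! a, u ! \<pi> a)))"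
      using permutes_in_image by (fastforce intro!: sum.cong prod.cong arg_cong2[where f = "(*)"])
    finally show ?thesis .
  qed
  have "minor (A * B) s t = (\<Sum>\<pi>\<in>?P. signof \<pi> * (\<Prod>a\<in>?K. mat k k (\<lambda>(a, b). (A * B) $$ (s ! a, t ! b)) $$ (a, \<pi> a)))"
    unfolding minor_def s(1) by (rule det_def') simp
  also have "\<dots> = (\<Sum>\<pi>\<in>?P. signof \<pi> * (\<Prod>a\<in>?K. \<Sum>j\<in>?N. A $$ (s ! a, j) * B $$ (j, t ! \<pi> a)))"
  proof (intro sum.cong refl arg_cong2[where f = "(*)"] prod.cong)
    fix \<pi> a assume "\<pi> \<in> ?P" "a \<in> ?K"
    then have ab: "a < k" "\<pi> a < k" using permutes_in_image[of \<pi> ?K a] by auto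
    then show "mat k k (\<lambda>(a, b). (A * B) $$ (s ! a, t ! b)) $$ (a, \<pi> a) = (\<Sum>j\<in>?N. A $$ (s ! a, j) * B $$ (j, t ! \<pi> a))"
      using A B st(1)[OF ab(1)] st(2)[OF ab(2)] by (simp add: scalar_prod_def)
  qed
  also have "\<dots> = (\<Sum>\<pi>\<in>?P. signof \<pi> * (\<Sum>g\<in>?K \<rightarrow>\<^sub>E ?N. \<Prod>a\<in>?K. A $$ (s ! a, g a) * B $$ (g a, t ! \<pi> a)))"
    by (simp add: prod_sum_PiE)
  also have "\<dots> = (\<Sum>\<pi>\<in>?P. \<Sum>g\<in>?K \<rightarrow>\<^sub>E ?N. ?a g * (signof \<pi> * (\<Prod>a\<in>?K. B $$ (g a, t ! \<pi> a))))"
    by (simp add: sum_distrib_left prod.distrib mult_ac)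
  also have "\<dots> = (\<Sum>g\<in>?K \<rightarrow>\<^sub>E ?N. ?a g * D g)"
    by (subst sum.swap) (simp add: D sum_distrib_left)
  also have "\<dots> = (\<Sum>g\<in>{g \<in> ?K \<rightarrow>\<^sub>E ?N. inj_on g ?K}. ?a g * D g)"
    by (rule sum.mono_neutral_right) (auto simp: finite_PiE D_noninj)
  also have "\<dots> = (\<Sum>(u, \<pi>)\<in>set (combs n k) \<times> ?P. ?a (restrict (\<lambda>a. u ! \<pi> a) ?K) * D (restrict (\<lambda>a. u ! \<pi> a) ?K))"
    by (subst sum.reindex_bij_betw[OF injective_selection_bij, symmetric]) (simp add: case_prod_unfold)
  also have "\<dots> = (\<Sum>u\<in>set (combs n k). \<Sum>\<pi>\<in>?P. (signof \<pi> * (\<Prod>a\<in>?K. A $$ (s ! a, u ! \<pi> a))) * minor B u t)"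
    by (subst sum.cartesian_product[symmetric]) (auto simp: D_perm mult_ac intro!: sum.cong)
  also have "\<dots> = (\<Sum>u\<in>set (combs n k). minor A s u * minor B u t)"
    by (simp add: minA sum_distrib_right)
  finally show ?thesis .
qed

section \<open>Multiplicativity and spectrum of compounds\<close>

definition compound :: "nat \<Rightarrow> nat \<Rightarrow> complex mat \<Rightarrow> complex mat" where
  "compound n k A = mat (length (combs n k)) (length (combs n k)) (\<lambda>(i, j). minor A (combs n k ! i) (combs n k ! j))"

lemma compound_closed [simp]: "compound n k A \<in> carrier_mat (length (combs n k)) (length (combs n k))"
  by (simp add: compound_def)

lemma compound_mult:
  assumes "A \<in> carrier_mat n n" "B \<in> carrier_mat n n"
  shows "compound n k (A * B) = compound n k A * compound n k B"
proof (rule eq_matI)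
  let ?N = "length (combs n k)"
  fix i j assume "i < dim_row (compound n k A * compound n k B)" "j < dim_col (compound n k A * compound n k B)"
  then have ij: "i < ?N" "j < ?N" by (simp_all add: compound_def)
  have c: "combs n k ! i \<in> set (combs n k)" "combs n k ! j \<in> set (combs n k)" using ij by simp_all
  have "(compound n k A * compound n k B) $$ (i, j) =
      (\<Sum>l<?N. compound n k A $$ (i, l) * compound n k B $$ (l, j))"
    using ij by (intro index_mult_mat_sum) simp_all
  also have "\<dots> = (\<Sum>l<?N. minor A (combs n k ! i) (combs n k ! l) * minor B (combs n k ! l) (combs n k ! j))"
    using ij by (intro sum.cong) (simp_all add: compound_def)
  also have "\<dots> = minor (A * B) (combs n k ! i) (combs n k ! j)"
    using c unfolding sum_nth_combs[where f = "\<lambda>u. minor A (combs n k ! i) u * minor B u (combs n k ! j)"]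
    by (intro cauchy_binet[OF assms, symmetric]) (auto simp: set_combs)
  finally show "compound n k (A * B) $$ (i, j) = (compound n k A * compound n k B) $$ (i, j)"
    using ij by (simp add: compound_def)
qed (simp_all add: compound_def)

lemma compound_adjoint:
  assumes A: "A \<in> carrier_mat n n"
  shows "compound n k (mat_adjoint A) = mat_adjoint (compound n k A)"
proof (rule eq_matI)
  let ?N = "length (combs n k)"
  fix i j assume "i < dim_row (mat_adjoint (compound n k A))" "j < dim_col (mat_adjoint (compound n k A))"
  then have ij: "i < ?N" "j < ?N" by (simp_all add: compound_def)
  define s t where "s = combs n k ! i" and "t = combs n k ! j"
  have st: "s \<in> set (combs n k)" "t \<in> set (combs n k)" using ij by (simp_all add: s_def t_def)
  then have len: "length s = k" "length t = k" by (simp_all add: set_combs)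
  let ?M = "mat k k (\<lambda>(a, b). A $$ (t ! a, s ! b))"
  have "minor (mat_adjoint A) s t = det (mat k k (\<lambda>(a, b). cnj (?M $$ (b, a))))"
    unfolding minor_def len using A combs_nth_less[OF st(1)] combs_nth_less[OF st(2)]
    by (intro arg_cong[of _ _ det] eq_matI) auto
  also have "\<dots> = det (map_mat cnj (?M\<^sup>T))"
    by (intro arg_cong[of _ _ det] eq_matI) auto
  also have "\<dots> = cnj (det (?M\<^sup>T))"
  proof -
    have "cnj (signof p) = signof p" for p :: "nat \<Rightarrow> nat" by (simp add: sign_def)
    then show ?thesis
      unfolding det_def by (auto intro!: sum.cong prod.cong simp: permutes_in_image)
  qed
  also have "det (?M\<^sup>T) = det ?M" by (rule det_transpose[of _ k]) simp
  also have "det ?M = minor A t s" by (simp add: minor_def len)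
  finally show "compound n k (mat_adjoint A) $$ (i, j) = mat_adjoint (compound n k A) $$ (i, j)"
    using ij by (simp add: compound_def s_def t_def)
qed (simp_all add: compound_def)

text \<open>Two different index sets of the same size leave some \<open>s ! a\<close> outside t,
  which makes row a of the submatrix zero; on the diagonal the submatrix is itself diagonal.\<close>

lemma compound_mat_diag:
  "compound n k (mat_diag n d) = mat_diag (length (combs n k)) (\<lambda>i. \<Prod>a<k. d (combs n k ! i ! a))"
proof (rule eq_matI)
  let ?N = "length (combs n k)"
  fix i j assume "i < dim_row (mat_diag ?N (\<lambda>i. \<Prod>a<k. d (combs n k ! i ! a)))"
    "j < dim_col (mat_diag ?N (\<lambda>i. \<Prod>a<k. d (combs n k ! i ! a)))"
  then have ij: "i < ?N" "j < ?N" by (simp_all add: mat_diag_def)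
  define s t where "s = combs n k ! i" and "t = combs n k ! j"
  have st: "s \<in> set (combs n k)" "t \<in> set (combs n k)" using ij by (simp_all add: s_def t_def)
  then have len: "length s = k" "length t = k" by (simp_all add: set_combs)
  let ?M = "mat k k (\<lambda>(a, b). mat_diag n d $$ (s ! a, t ! b))"
  have "det ?M = (if i = j then \<Prod>a<k. d (s ! a) else 0)"
  proof (cases "i = j")
    case True
    then have "s = t" by (simp add: s_def t_def)
    have M: "?M = mat_diag k (\<lambda>a. d (s ! a))"
      using combs_nth_less[OF st(1)] distinct_comb[OF st(1)] len
      by (intro eq_matI) (auto simp: mat_diag_def \<open>s = t\<close> nth_eq_iff_index_eq)
    have "det (mat_diag k (\<lambda>a. d (s ! a))) = prod_list (diag_mat (mat_diag k (\<lambda>a. d (s ! a))))"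
      by (rule det_upper_triangular[of _ k]) (auto simp: mat_diag_def)
    also have "\<dots> = (\<Prod>a<k. d (s ! a))"
      by (simp add: prod_list_diag_prod atLeast0LessThan mat_diag_def)
    finally show ?thesis using True by (simp only: M refl if_True)
  next
    case False
    then have "s \<noteq> t" using ij distinct_combs[of n k] by (simp add: s_def t_def nth_eq_iff_index_eq)
    then have "set s \<noteq> set t" using combs_eq_iff[OF st] by simp
    moreover have "card (set s) = card (set t)"
      using distinct_comb[OF st(1)] distinct_comb[OF st(2)] len by (simp add: distinct_card)
    ultimately have "\<not> set s \<subseteq> set t" using card_subset_eq[of "set t" "set s"] by auto
    then obtain a where a: "a < k" "s ! a \<notin> set t" using len by (auto simp: in_set_conv_nth subset_iff)
    have zero: "?M $$ (a, b) = 0" if "b < k" for b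
    proof -
      have "t ! b \<noteq> s ! a" using a(2) that len by (metis nth_mem)
      then show ?thesis
        using a that combs_nth_less[OF st(1)] combs_nth_less[OF st(2)] by (simp add: mat_diag_def)
    qed
    have "(\<Prod>x\<in>{0..<k}. ?M $$ (x, p x)) = 0" if "p permutes {0..<k}" for p
    proof (rule prod_zero)
      show "\<exists>x\<in>{0..<k}. ?M $$ (x, p x) = 0"
        using a zero[of "p a"] permutes_in_image[OF that, of a] by (intro bexI[of _ a]) auto
    qed simp
    then have "det ?M = 0" by (subst det_def'[of _ k]) (auto intro!: sum.neutral)
    then show ?thesis using False by simp
  qed
  moreover have "compound n k (mat_diag n d) $$ (i, j) = det ?M"
    using ij by (simp add: compound_def minor_def len flip: s_def t_def)
  moreover have "mat_diag ?N (\<lambda>i. \<Prod>a<k. d (combs n k ! i ! a)) $$ (i, j) = (if i = j then \<Prod>a<k. d (s ! a) else 0)"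
    using ij by (simp add: mat_diag_def s_def)
  ultimately show "compound n k (mat_diag n d) $$ (i, j) = mat_diag ?N (\<lambda>i. \<Prod>a<k. d (combs n k ! i ! a)) $$ (i, j)"
    by simp
qed (simp_all add: compound_def mat_diag_def)

lemma compound_one: "compound n k (1\<^sub>m n) = 1\<^sub>m (length (combs n k))"
  using compound_mat_diag[of n k "\<lambda>_. 1"] by simp

lemma unitary_compound:
  assumes "unitary_mat n U"
  shows "unitary_mat (length (combs n k)) (compound n k U)"
proof -
  have U: "U \<in> carrier_mat n n" "mat_adjoint U \<in> carrier_mat n n"
    "mat_adjoint U * U = 1\<^sub>m n" "U * mat_adjoint U = 1\<^sub>m n"
    using assms by (simp_all add: unitary_mat_def mat_adjoint_carrier)
  then show ?thesis
    unfolding unitary_mat_def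
    by (simp only: compound_closed compound_adjoint[OF U(1), symmetric] compound_mult[OF U(1,2), symmetric]
        compound_mult[OF U(2,1), symmetric] compound_one)
qed

lemma compound_conj_diag:
  assumes "unitary_mat n U"
  shows "compound n k (conj_diag n U d) =
    conj_diag (length (combs n k)) (compound n k U) (\<lambda>i. \<Prod>a<k. d (combs n k ! i ! a))"
proof -
  have U: "U \<in> carrier_mat n n" "mat_adjoint U \<in> carrier_mat n n"
    using assms by (simp_all add: unitary_mat_def mat_adjoint_carrier)
  show ?thesis
    unfolding conj_diag_def using U
    by (simp add: compound_mult mult_carrier_mat[of _ n n] compound_adjoint compound_mat_diag)
qed

lemma psd_compound:
  assumes "psd n A"
  shows "psd (length (combs n k)) (compound n k A)"
proof -
  obtain U d where U: "unitary_mat n U" and A: "A = conj_diag n U d" and d: "\<And>i. i < n \<Longrightarrow> d i \<ge> 0"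
    using fixed_dim.psd_sorted[OF assms] by metis
  show ?thesis
    unfolding A compound_conj_diag[OF U]
    by (rule fixed_dim.psd_conj_diag[OF unitary_compound[OF U]])
      (auto intro!: prod_nonneg d combs_nth_less)
qed

text \<open>The eigenvalues of the compound are k-fold products, and \<open>powr\<close> is
  multiplicative, at 0 as well. Negative powers, hence generalized inverses, are therefore
  included.\<close>

lemma compound_mat_powr:
  assumes "psd n A"
  shows "compound n k (mat_powr A r) = mat_powr (compound n k A) r"
proof -
  obtain U d where U: "unitary_mat n U" and A: "A = conj_diag n U d" and d: "\<And>i. i < n \<Longrightarrow> d i \<ge> 0"
    using fixed_dim.psd_sorted[OF assms] by metis
  have nn: "0 \<le> d (combs n k ! i ! a)" if "i < length (combs n k)" "a < k" for i a
    using that by (intro d combs_nth_less[of _ n k]) auto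
  have "compound n k (mat_powr A r) = conj_diag (length (combs n k)) (compound n k U) (\<lambda>i. \<Prod>a<k. d (combs n k ! i ! a) powr r)"
    using d by (simp add: A fixed_dim.mat_powr_conj_diag[OF U] compound_conj_diag[OF U])
  also have "\<dots> = conj_diag (length (combs n k)) (compound n k U) (\<lambda>i. (\<Prod>a<k. d (combs n k ! i ! a)) powr r)"
    by (intro conj_diag_cong prod_powr_distrib[symmetric])
  also have "\<dots> = mat_powr (compound n k A) r"
    unfolding A compound_conj_diag[OF U]
    by (rule fixed_dim.mat_powr_conj_diag[OF unitary_compound[OF U], symmetric]) (auto intro!: prod_nonneg nn)
  finally show ?thesis .
qed


section \<open>Log-majorization\<close>

context fixed_dim
begin

lemma eigs_desc_conj_diag:
  assumes U: "unitary_mat n U" and mono: "\<And>i j. i \<le> j \<Longrightarrow> j < n \<Longrightarrow> d j \<le> d i"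
  shows "eigs_desc (conj_diag n U d) = map d [0..<n]"
proof -
  let ?f = "\<lambda>i. complex_of_real (d i)"
  let ?D = "mat_diag n ?f"
  note Uc = unitaryD[OF U]
  have "similar_mat_wit (conj_diag n U d) ?D U (mat_adjoint U)"
    using Uc by (intro similar_mat_witI[of _ _ n]) (auto simp: conj_diag_def)
  then have "char_poly (conj_diag n U d) = char_poly ?D"
    by (intro char_poly_similar) (auto simp: similar_mat_def)
  also have "\<dots> = (\<Prod>a\<leftarrow>diag_mat ?D. [:- a, 1:])"
    by (rule char_poly_upper_triangular[of _ n]) (auto simp: mat_diag_def)
  also have "diag_mat ?D = map ?f [0..<n]"
    by (auto simp: diag_mat_def mat_diag_def)
  finally have "char_poly (conj_diag n U d) = (\<Prod>a\<leftarrow>map ?f [0..<n]. [:- a, 1:])" .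
  moreover have "proots (\<Prod>a\<leftarrow>xs. [:- a, 1:]) = mset xs" for xs :: "complex list"
  proof (induction xs)
    case (Cons a xs)
    have "(\<Prod>a\<leftarrow>xs. [:- a, 1:]) \<noteq> 0" by (auto simp: prod_list_zero_iff)
    then show ?case using Cons.IH by (simp add: proots_mult del: mult_pCons_left)
  qed simp
  ultimately have "image_mset Re (proots (char_poly (conj_diag n U d))) = image_mset Re (mset (map ?f [0..<n]))"
    by (simp only:)
  also have "\<dots> = mset (map d [0..<n])"
    by (simp add: image_mset.compositionality comp_def)
  finally have "image_mset Re (proots (char_poly (conj_diag n U d))) = mset (map d [0..<n])" .
  then have "eigs_desc (conj_diag n U d) = rev (sort (map d [0..<n]))"
    by (simp only: eigs_desc_def sorted_list_of_multiset_mset)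
  also have "sort (map d [0..<n]) = rev (map d [0..<n])"
    by (rule properties_for_sort) (auto simp: sorted_rev_iff_nth_mono mono)
  finally show ?thesis by simp
qed

lemma qbound_iff_largest_eigenvalue:
  assumes A: "psd n A" and n: "0 < n"
  shows "qbound n c A \<longleftrightarrow> eigs_desc A ! 0 \<le> c"
proof -
  obtain U d where U: "unitary_mat n U" and eq: "A = conj_diag n U d"
    and mono: "\<And>i j. i \<le> j \<Longrightarrow> j < n \<Longrightarrow> d j \<le> d i"
    using psd_sorted[OF A] by metis
  have "(\<forall>i<n. d i \<le> c) \<longleftrightarrow> d 0 \<le> c"
    using mono[of 0] n by (meson le_trans order_trans zero_le)
  then show ?thesis
    using n by (simp add: eq qbound_conj_diag[OF U] eigs_desc_conj_diag[OF U mono])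
qed

lemma eigs_desc_nonneg:
  assumes A: "psd n A" and i: "i < n"
  shows "eigs_desc A ! i \<ge> 0"
proof -
  obtain U d where U: "unitary_mat n U" and eq: "A = conj_diag n U d"
    and "\<And>i. i < n \<Longrightarrow> d i \<ge> 0"
    and mono: "\<And>i j. i \<le> j \<Longrightarrow> j < n \<Longrightarrow> d j \<le> d i"
    using psd_sorted[OF A] by metis
  then show ?thesis using i by (simp add: eigs_desc_conj_diag[OF U mono])
qed

text \<open>The entry at position a of a strictly increasing list is at least a, so for decreasing
  nonnegative d no k-fold product exceeds that of the first k values, which is attained at
  \<open>[0..<k]\<close>.\<close>

lemma qbound_compound:
  assumes A: "psd n A" and k: "k \<le> n"
  shows "qbound (length (combs n k)) c (compound n k A) \<longleftrightarrow> (\<Prod>i<k. eigs_desc A ! i) \<le> c"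
proof -
  obtain U d where U: "unitary_mat n U" and eq: "A = conj_diag n U d"
    and d: "\<And>i. i < n \<Longrightarrow> d i \<ge> 0"
    and mono: "\<And>i j. i \<le> j \<Longrightarrow> j < n \<Longrightarrow> d j \<le> d i"
    using psd_sorted[OF A] by metis
  let ?N = "length (combs n k)"
  have top: "[0..<k] \<in> set (combs n k)" using k by (auto simp: set_combs sorted_wrt_upt)
  have ge: "a \<le> s ! a" if "s \<in> set (combs n k)" "a < k" for s a
    using that(2)
  proof (induction a)
    case (Suc a)
    have "s ! a < s ! Suc a" using that(1) Suc.prems by (auto simp: set_combs sorted_wrt_nth_less)
    then show ?case using Suc by simp
  qed simp
  have le: "(\<Prod>a<k. d (s ! a)) \<le> (\<Prod>a<k. d a)" if s: "s \<in> set (combs n k)" for s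
    using combs_nth_less[OF s] ge[OF s] by (intro prod_mono conjI d mono) auto
  have eig: "(\<Prod>i<k. eigs_desc A ! i) = (\<Prod>a<k. d a)"
    using k by (intro prod.cong) (auto simp: eq eigs_desc_conj_diag[OF U mono])
  have "qbound ?N c (compound n k A) \<longleftrightarrow> (\<forall>i<?N. (\<Prod>a<k. d (combs n k ! i ! a)) \<le> c)"
    by (simp add: eq compound_conj_diag[OF U] fixed_dim.qbound_conj_diag[OF unitary_compound[OF U]])
  also have "\<dots> \<longleftrightarrow> (\<forall>s\<in>set (combs n k). (\<Prod>a<k. d (s ! a)) \<le> c)"
    by (metis in_set_conv_nth)
  also have "\<dots> \<longleftrightarrow> (\<Prod>a<k. d a) \<le> c"
  proof
    assume "\<forall>s\<in>set (combs n k). (\<Prod>a<k. d (s ! a)) \<le> c"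
    from bspec[OF this top] show "(\<Prod>a<k. d a) \<le> c" by simp
  qed (use le in \<open>meson order_trans\<close>)
  finally show ?thesis by (simp only: eig)
qed

lemma det_conj_diag:
  assumes U: "unitary_mat n U"
  shows "det (conj_diag n U d) = of_real (\<Prod>i<n. d i)"
proof -
  let ?D = "mat_diag n (\<lambda>i. complex_of_real (d i))"
  note Uc = unitaryD[OF U]
  have "det (conj_diag n U d) = det U * det ?D * det (mat_adjoint U)"
    using Uc by (simp add: conj_diag_def det_mult[of _ n])
  also have "\<dots> = det (mat_adjoint U * U) * det ?D"
    using Uc(1,2) by (simp add: det_mult[of _ n])
  also have "\<dots> = det ?D" using Uc by simp
  also have "\<dots> = prod_list (diag_mat ?D)"
    by (rule det_upper_triangular[of _ n]) (auto simp: mat_diag_def)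
  also have "\<dots> = of_real (\<Prod>i<n. d i)"
    by (simp add: prod_list_diag_prod atLeast0LessThan mat_diag_def)
  finally show ?thesis .
qed

lemma det_psd:
  assumes "psd n A"
  shows "det A = of_real (\<Prod>i<n. eigs_desc A ! i)" "Re (det A) \<ge> 0"
proof -
  obtain U d where U: "unitary_mat n U" and eq: "A = conj_diag n U d"
    and d: "\<And>i. i < n \<Longrightarrow> d i \<ge> 0"
    and mono: "\<And>i j. i \<le> j \<Longrightarrow> j < n \<Longrightarrow> d j \<le> d i"
    using psd_sorted[OF assms] by metis
  show "det A = of_real (\<Prod>i<n. eigs_desc A ! i)"
    by (simp add: eq det_conj_diag[OF U] eigs_desc_conj_diag[OF U mono])
  show "Re (det A) \<ge> 0"
    by (simp only: eq det_conj_diag[OF U] Re_complex_of_real) (auto intro!: prod_nonneg d)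
qed

lemma det_mat_powr:
  assumes "psd n A"
  shows "Re (det (mat_powr A r)) = Re (det A) powr r"
proof -
  obtain U d where U: "unitary_mat n U" and eq: "A = conj_diag n U d"
    and d: "\<And>i. i < n \<Longrightarrow> d i \<ge> 0"
    using psd_sorted[OF assms] by metis
  have "mat_powr A r = conj_diag n U (\<lambda>i. d i powr r)" by (simp add: eq mat_powr_conj_diag[OF U] d)
  then have "Re (det (mat_powr A r)) = (\<Prod>i<n. d i powr r)"
    by (simp only: det_conj_diag[OF U] Re_complex_of_real)
  also have "\<dots> = Re (det A) powr r"
    by (simp only: eq det_conj_diag[OF U] Re_complex_of_real prod_powr_distrib)
  finally show ?thesis .
qed

lemma det_sandwich:
  assumes "psd n A" "psd n T"
  shows "Re (det (T * A * T)) = (Re (det T))\<^sup>2 * Re (det A)"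
proof -
  have "det (T * A * T) = of_real (Re (det T)) * of_real (Re (det A)) * of_real (Re (det T))"
    using assms det_psd(1)[of A] det_psd(1)[of T] by (simp add: det_mult[of _ n])
  then show ?thesis by (simp add: power2_eq_square)
qed

text \<open>Both determinants are \<open>det A powr (1 - \<alpha>) * det B powr \<alpha>\<close>,
  independently of p and q. The convention \<open>0 powr r = 0\<close> keeps the computation valid
  for zero determinants.\<close>

lemma det_SG_Renyi:
  assumes A: "psd n A" and B: "psd n B" and pq: "p \<noteq> 0" "q \<noteq> 0"
  shows "Re (det (SG \<alpha> p A B)) = Re (det (Renyi \<alpha> q A B))"
proof -
  have sq: "(x powr r)\<^sup>2 = x powr (2 * r)" for x r :: real
    by (simp add: power2_eq_square flip: powr_add)
  define x y where "x = Re (det A)" and "y = Re (det B)"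
  have xy: "x \<ge> 0" "y \<ge> 0" using det_psd(2)[OF A] det_psd(2)[OF B] by (simp_all add: x_def y_def)
  have "Re (det (Renyi \<alpha> q A B)) = x powr (1 - \<alpha>) * y powr \<alpha>"
    using A B pq by (simp add: Renyi_def det_mat_powr det_sandwich psd_sandwich x_def y_def powr_mult powr_powr sq)
  note Renyi = this
  define G where "G = geom_mean (mat_powr A (- p)) (mat_powr B p)"
  have G: "psd n G" using A B by (simp add: G_def)
  have "Re (det G) = x powr (- p) * (x powr p * y powr p) powr (1 / 2)"
    using A B by (simp add: G_def geom_mean_def det_mat_powr det_sandwich psd_sandwich powr_powr sq flip: x_def y_def)
  also have "\<dots> = x powr (- p) * x powr (p / 2) * y powr (p / 2)"
    by (simp add: powr_mult powr_powr)
  also have "\<dots> = x powr (- (p / 2)) * y powr (p / 2)"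
    by (simp add: powr_add[symmetric])
  finally have dG: "Re (det G) = x powr (- (p / 2)) * y powr (p / 2)" .
  have "SG \<alpha> p A B = mat_powr (mat_powr G \<alpha> * mat_powr A p * mat_powr G \<alpha>) (1 / p)"
    by (simp add: SG_def Let_def G_def)
  then have "Re (det (SG \<alpha> p A B)) = ((x powr (- (p / 2)) * y powr (p / 2)) powr (2 * \<alpha>) * x powr p) powr (1 / p)"
    using A G by (simp add: det_mat_powr det_sandwich psd_sandwich dG sq flip: x_def)
  also have "\<dots> = (x powr (p * (1 - \<alpha>)) * y powr (p * \<alpha>)) powr (1 / p)"
    by (simp add: powr_mult powr_powr powr_add[symmetric] mult_ac right_diff_distrib)
  also have "\<dots> = x powr (1 - \<alpha>) * y powr \<alpha>"
    using pq by (simp add: powr_mult powr_powr)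
  finally show ?thesis by (simp only: Renyi)
qed

lemma log_majorizedI:
  assumes X: "psd n X" and Y: "psd n Y" and det: "Re (det X) = Re (det Y)"
    and bound: "\<And>k c. k \<le> n \<Longrightarrow> 0 \<le> c \<Longrightarrow> qbound (length (combs n k)) c (compound n k Y) \<Longrightarrow>
      qbound (length (combs n k)) c (compound n k X)"
  shows "log_majorized n X Y"
  unfolding log_majorized_def
proof (intro conjI ballI X Y)
  fix k assume k: "k \<in> {1..n}"
  let ?c = "\<Prod>i<k. eigs_desc Y ! i"
  have "?c \<ge> 0" using k eigs_desc_nonneg[OF Y] by (auto intro!: prod_nonneg)
  moreover have "qbound (length (combs n k)) ?c (compound n k Y)"
    using k by (simp add: qbound_compound[OF Y])
  ultimately show "(\<Prod>i<k. eigs_desc X ! i) \<le> ?c"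
    using bound[of k ?c] k by (simp add: qbound_compound[OF X])
next
  show "(\<Prod>i<n. eigs_desc X ! i) = (\<Prod>i<n. eigs_desc Y ! i)"
    using det by (simp only: det_psd(1)[OF X] det_psd(1)[OF Y] Re_complex_of_real)
qed

lemma compound_Renyi:
  assumes "psd n A" "psd n B"
  shows "compound n k (Renyi \<alpha> q A B) = Renyi \<alpha> q (compound n k A) (compound n k B)"
  using assms by (simp add: Renyi_def compound_mat_powr psd_sandwich compound_mult)

lemma compound_geom_mean:
  assumes "psd n A" "psd n B"
  shows "compound n k (geom_mean A B) = geom_mean (compound n k A) (compound n k B)"
  using assms by (simp add: geom_mean_def compound_mat_powr psd_sandwich compound_mult)

lemma compound_SG:
  assumes "psd n A" "psd n B"
  shows "compound n k (SG \<alpha> p A B) = SG \<alpha> p (compound n k A) (compound n k B)"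
  using assms by (simp add: SG_def Let_def compound_mat_powr psd_sandwich compound_mult compound_geom_mean)

text \<open>As an equation between products the support condition passes to compounds by
  multiplicativity; this is the reason for carrying it in this form.\<close>

lemma compound_support:
  assumes A: "psd n A" and B: "psd n B" and "B * mat_powr A 0 = B"
  shows "compound n k B * mat_powr (compound n k A) 0 = compound n k B"
  using arg_cong[OF assms(3), of "compound n k"] A B by (simp add: compound_mult compound_mat_powr)

theorem SG_log_majorized_Renyi:
  assumes A: "psd n A" and B: "psd n B" and supp: "B * mat_powr A 0 = B"
    and \<alpha>: "0 < \<alpha>" "\<alpha> < 1" and pq: "0 < p" "0 < q" "p \<le> \<alpha> * q" "p \<le> (1 - \<alpha>) * q"
  shows "log_majorized n (SG \<alpha> p A B) (Renyi \<alpha> q A B)"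
proof (rule log_majorizedI)
  show "psd n (SG \<alpha> p A B)" "psd n (Renyi \<alpha> q A B)" using A B by (simp_all add: psd_SG psd_Renyi)
  show "Re (det (SG \<alpha> p A B)) = Re (det (Renyi \<alpha> q A B))" using A B pq by (intro det_SG_Renyi) auto
  fix k and c :: real assume "0 \<le> c" "qbound (length (combs n k)) c (compound n k (Renyi \<alpha> q A B))"
  then show "qbound (length (combs n k)) c (compound n k (SG \<alpha> p A B))"
    using fixed_dim.qbound_SG_of_Renyi[OF psd_compound[OF A] psd_compound[OF B] compound_support[OF A B supp] \<alpha> pq]
    by (simp add: compound_SG[OF A B] compound_Renyi[OF A B])
qed

theorem Renyi_log_majorized_SG:
  assumes A: "psd n A" and B: "psd n B" and supp: "B * mat_powr A 0 = B"
    and \<alpha>: "0 < \<alpha>" "\<alpha> < 1" and pq: "0 < p" "0 < q" "\<alpha> * q \<le> p" "(1 - \<alpha>) * q \<le> p"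
  shows "log_majorized n (Renyi \<alpha> q A B) (SG \<alpha> p A B)"
proof (rule log_majorizedI)
  show "psd n (SG \<alpha> p A B)" "psd n (Renyi \<alpha> q A B)" using A B by (simp_all add: psd_SG psd_Renyi)
  show "Re (det (Renyi \<alpha> q A B)) = Re (det (SG \<alpha> p A B))" using A B pq by (intro det_SG_Renyi[symmetric]) auto
  fix k and c :: real assume "0 \<le> c" "qbound (length (combs n k)) c (compound n k (SG \<alpha> p A B))"
  then show "qbound (length (combs n k)) c (compound n k (Renyi \<alpha> q A B))"
    using fixed_dim.qbound_Renyi_of_SG[OF psd_compound[OF A] psd_compound[OF B] compound_support[OF A B supp] \<alpha> pq]
    by (simp add: compound_SG[OF A B] compound_Renyi[OF A B])
qed

section \<open>Support projections and positive definite matrices\<close>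

lemma mat_eq_of_mult_vec:
  fixes A B :: "complex mat"
  assumes A: "A \<in> carrier_mat n n" and B: "B \<in> carrier_mat n n"
    and eq: "\<And>x. x \<in> carrier_vec n \<Longrightarrow> A *\<^sub>v x = B *\<^sub>v x"
  shows "A = B"
proof (rule eq_matI)
  have col: "C *\<^sub>v unit_vec n j = col C j" if "C \<in> carrier_mat n n" "j < n" for C :: "complex mat" and j
    using col_mult2[OF that(1) one_carrier_mat that(2)] that by (simp add: right_one)
  fix i j assume ij: "i < dim_row B" "j < dim_col B"
  then have "col A j = col B j" using A B eq[of "unit_vec n j"] col by simp
  then have "col A j $ i = col B j $ i" by simp
  then show "A $$ (i, j) = B $$ (i, j)" using A B ij by (simp add: index_col)
qed (use A B in auto)

lemma mat_kernel_iff: "A \<in> carrier_mat n n \<Longrightarrow> x \<in> mat_kernel A \<longleftrightarrow> x \<in> carrier_vec n \<and> A *\<^sub>v x = 0\<^sub>v n"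
  using mat_kernel[of A n n] by auto

text \<open>For every x the vector \<open>x - Q x\<close> lies in the kernel of Q, hence in that of
  P.\<close>

lemma projection_eq_of_kernel_subset:
  fixes P Q :: "complex mat"
  assumes P: "P \<in> carrier_mat n n" and Q: "Q \<in> carrier_mat n n" "Q * Q = Q" and ker: "mat_kernel Q \<subseteq> mat_kernel P"
  shows "P * Q = P"
proof (rule mat_eq_of_mult_vec)
  fix x :: "complex vec" assume x: "x \<in> carrier_vec n"
  have "Q *\<^sub>v (x - Q *\<^sub>v x) = Q *\<^sub>v x - (Q * Q) *\<^sub>v x"
    using Q(1) x by (simp add: mult_minus_distrib_mat_vec[of _ n n] assoc_vec)
  also have "\<dots> = 0\<^sub>v n" using Q x by (simp add: minus_cancel_vec[of _ n])
  finally have "x - Q *\<^sub>v x \<in> mat_kernel P" using ker Q(1) x by (auto simp: mat_kernel_iff)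
  then have "P *\<^sub>v x - P *\<^sub>v (Q *\<^sub>v x) = 0\<^sub>v n"
    using P Q(1) x by (simp add: mat_kernel_iff mult_minus_distrib_mat_vec[of _ n n])
  then have "P *\<^sub>v x = P *\<^sub>v (Q *\<^sub>v x)" using P Q(1) x
    by (auto simp: vec_eq_iff)
  then show "(P * Q) *\<^sub>v x = P *\<^sub>v x" using P Q(1) x by (simp add: assoc_vec)
qed (use P Q in auto)

text \<open>For uniqueness, equal kernels give \<open>Q P = Q\<close> and \<open>P Q = P\<close>,
  and the adjoint of the first equation is \<open>P Q = Q\<close>.\<close>

lemma support_proj_eq:
  assumes A: "psd n A"
  shows "support_proj A = mat_powr A 0"
  unfolding support_proj_def
proof (rule the_equality)
  let ?P = "mat_powr A 0"
  have P: "hermitian_mat n ?P" "?P * ?P = ?P" using psd_mat_powr[OF A, of 0] by (simp_all add: psd_def mat_powr_mult[OF A])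
  have dim: "dim_row A = n" using psd_closed[OF A] by simp
  have "A * ?P = A" "mat_powr A (- 1) * A = ?P"
    using mat_powr_mult[OF A, of 1 0] mat_powr_mult[OF A, of "- 1" 1] A by simp_all
  then have ker: "mat_kernel ?P = mat_kernel A"
    using A by (auto simp: mat_kernel_iff) (metis assoc_vec mult_zero_vec mat_powr_closed psd_closed)+
  with P show "hermitian_mat (dim_row A) ?P \<and> ?P * ?P = ?P \<and> mat_kernel ?P = mat_kernel A"
    by (simp add: dim)
  fix Q assume "hermitian_mat (dim_row A) Q \<and> Q * Q = Q \<and> mat_kernel Q = mat_kernel A"
  then have Q: "Q \<in> carrier_mat n n" "mat_adjoint Q = Q" "Q * Q = Q" "mat_kernel Q = mat_kernel A"
    by (auto simp: dim hermitian_mat_def)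
  have QP: "Q * ?P = Q" and PQ: "?P * Q = ?P"
    using Q P A ker projection_eq_of_kernel_subset[of Q ?P] projection_eq_of_kernel_subset[of ?P Q] by auto
  have "?P * Q = Q" using arg_cong[OF QP, of mat_adjoint] Q A by (simp add: adjoint_mult)
  with PQ show "Q = ?P" by simp
qed

text \<open>If x is in the kernel of the larger projection, the form of the difference at x is
  \<open>- vsq (?Q x)\<close>. It is nonnegative by assumption, so \<open>?Q x = 0\<close>;
  inclusion of the kernels then gives \<open>?Q ?P = ?Q\<close>, and B absorbs
  \<open>?Q\<close>.\<close>

lemma support_condition:
  assumes A: "psd n A" and B: "psd n B" and le: "loewner_le n (support_proj B) (support_proj A)"
  shows "B * mat_powr A 0 = B"
proof -
  let ?P = "mat_powr A 0" and ?Q = "mat_powr B 0"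
  have P: "?P * ?P = ?P" and Q: "?Q * ?Q = ?Q" by (simp_all add: mat_powr_mult A B)
  have "psd n (?P - ?Q)" using le by (simp add: loewner_le_def support_proj_eq A B)
  then have ge: "0 \<le> Re (((?P - ?Q) *\<^sub>v x) \<bullet>c x)" if "x \<in> carrier_vec n" for x
    using that by (simp add: psd_def)
  have "mat_kernel ?P \<subseteq> mat_kernel ?Q"
  proof
    fix x assume "x \<in> mat_kernel ?P"
    then have x: "x \<in> carrier_vec n" "?P *\<^sub>v x = 0\<^sub>v n" using A by (simp_all add: mat_kernel_iff)
    have "(?P - ?Q) *\<^sub>v x = ?P *\<^sub>v x - ?Q *\<^sub>v x"
      using A B x by (simp add: minus_mult_distrib_mat_vec[of _ n n])
    moreover have "(?P *\<^sub>v x - ?Q *\<^sub>v x) \<bullet>c x = (?P *\<^sub>v x) \<bullet>c x - (?Q *\<^sub>v x) \<bullet>c x"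
      using A B x(1) by (intro minus_scalar_prod_distrib[of _ n]) auto
    ultimately have "((?P - ?Q) *\<^sub>v x) \<bullet>c x = - ((?Q *\<^sub>v x) \<bullet>c x)"
      using x by simp
    also have "(?Q *\<^sub>v x) \<bullet>c x = (?Q *\<^sub>v (?Q *\<^sub>v x)) \<bullet>c x"
      using B x Q by (simp flip: assoc_vec)
    also have "\<dots> = of_real (vsq (?Q *\<^sub>v x))"
      using B x by (simp add: inner_adj inner_self)
    finally have "vsq (?Q *\<^sub>v x) \<le> 0" using ge[OF x(1)] by simp
    then have "vsq (?Q *\<^sub>v x) = 0" using vsq_nonneg by (metis order_antisym)
    then have "?Q *\<^sub>v x = 0\<^sub>v n" using B x by (subst (asm) vsq_eq_0[of _ n]) auto
    then show "x \<in> mat_kernel ?Q" using B x by (simp add: mat_kernel_iff)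
  qed
  from projection_eq_of_kernel_subset[OF _ _ P this] A B have "?Q * ?P = ?Q" by simp
  then have "B * (?Q * ?P) = B * ?Q" by simp
  moreover have "B * ?Q = B" using mat_powr_mult[OF B, of 1 0] B by simp
  ultimately show ?thesis using A B by (simp flip: assoc)
qed

lemma pos_def_psd:
  assumes "pos_def n A"
  shows "psd n A"
  unfolding psd_def
proof (intro conjI ballI)
  fix x :: "complex vec" assume x: "x \<in> carrier_vec n"
  have "A \<in> carrier_mat n n" using assms by (simp add: pos_def_def hermitian_mat_def)
  then have "A *\<^sub>v 0\<^sub>v n = 0\<^sub>v n" by (rule mult_zero_vec)
  then show "0 \<le> Re ((A *\<^sub>v x) \<bullet>c x)"
    using assms x by (cases "x = 0\<^sub>v n") (auto simp: pos_def_def less_imp_le)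
qed (use assms in \<open>simp add: pos_def_def\<close>)

lemma pos_def_powr_0:
  assumes "pos_def n A"
  shows "mat_powr A 0 = 1\<^sub>m n"
proof -
  have A: "psd n A" using assms by (rule pos_def_psd)
  let ?P = "mat_powr A 0"
  have "mat_kernel ?P \<subseteq> mat_kernel (1\<^sub>m n)"
  proof
    fix x assume "x \<in> mat_kernel ?P"
    then have x: "x \<in> carrier_vec n" "?P *\<^sub>v x = 0\<^sub>v n" using A by (simp_all add: mat_kernel_iff)
    have "A *\<^sub>v x = (A * ?P) *\<^sub>v x"
      using mat_powr_mult[OF A, of 1 0] A by simp
    also have "\<dots> = A *\<^sub>v (?P *\<^sub>v x)" using A x by (simp add: assoc_vec)
    finally have "A *\<^sub>v x = 0\<^sub>v n" using x(2) mult_zero_vec[of A] A by simp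
    then have "x = 0\<^sub>v n" using assms x(1) by (auto simp: pos_def_def)
    then show "x \<in> mat_kernel (1\<^sub>m n)" by (simp add: mat_kernel_iff)
  qed
  from projection_eq_of_kernel_subset[OF _ _ _ this] A have "1\<^sub>m n * ?P = 1\<^sub>m n"
    by (simp add: mat_powr_mult)
  then show ?thesis using A by (simp add: left_one)
qed

lemma loewner_le_support_pos_def:
  assumes "pos_def n A" "pos_def n B"
  shows "loewner_le n (support_proj B) (support_proj A)"
proof -
  have S: "support_proj A = 1\<^sub>m n" "support_proj B = 1\<^sub>m n"
    using assms by (simp_all add: support_proj_eq pos_def_psd pos_def_powr_0)
  have Z: "1\<^sub>m n - 1\<^sub>m n = (0\<^sub>m n n :: complex mat)" by (intro eq_matI) auto
  have "psd n (0\<^sub>m n n)"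
    by (auto simp: psd_def hermitian_mat_def zero_mat_mult_vec intro!: eq_matI)
  then show ?thesis unfolding loewner_le_def S Z by (simp add: hermitian_mat_def)
qed

text \<open>The necessity proof exploits the majorization at \<open>k = 1\<close>: only largest
  eigenvalues are compared.\<close>

lemma log_majorized_qbound:
  assumes "log_majorized n X Y" "0 < n" "qbound n c Y"
  shows "qbound n c X"
proof -
  have "eigs_desc X ! 0 \<le> eigs_desc Y ! 0"
    using assms(1,2) unfolding log_majorized_def by (force dest: bspec[of _ _ 1])
  then show ?thesis
    using assms by (auto simp: log_majorized_def qbound_iff_largest_eigenvalue)
qed

end


section \<open>The means at Riccati pairs\<close>

lemma inner_cauchy_schwarz:
  assumes "x \<in> carrier_vec n" "y \<in> carrier_vec n"
  shows "(cmod (x \<bullet>c y))\<^sup>2 \<le> vsq x * vsq y"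
proof -
  have "cmod (x \<bullet>c y) \<le> (\<Sum>i<n. cmod (x $ i) * cmod (y $ i))"
    using assms by (auto simp: scalar_prod_def atLeast0LessThan norm_mult intro!: sum_norm_le)
  then have "(cmod (x \<bullet>c y))\<^sup>2 \<le> (\<Sum>i<n. cmod (x $ i) * cmod (y $ i))\<^sup>2"
    by (intro power_mono) auto
  also have "\<dots> \<le> (\<Sum>i<n. (cmod (x $ i))\<^sup>2) * (\<Sum>i<n. (cmod (y $ i))\<^sup>2)"
    by (rule Cauchy_Schwarz_ineq_sum)
  finally show ?thesis using assms by (simp add: vsq_sum)
qed

context fixed_dim
begin

text \<open>\<open>C b^s C\<close> is the sum of the rank one forms given by the vectors
  \<open>C u_k\<close> with weights \<open>l_k^s\<close>; Cauchy-Schwarz bounds each of them. When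
  one eigenvalue dominates, this upper bound nearly matches the lower bound that follows.\<close>

lemma opbound_eigenvector_sum:
  assumes U: "unitary_mat n U" and l: "\<And>i. i < n \<Longrightarrow> l i \<ge> 0" and C: "psd n C"
  shows "opbound n (\<Sum>k<n. l k powr s * vsq (C *\<^sub>v col U k)) (mat_powr (conj_diag n U l) (s / 2) * C)"
proof -
  let ?b = "conj_diag n U l"
  have b: "psd n ?b" using U l by (rule psd_conj_diag)
  have "qbound n (\<Sum>k<n. l k powr s * vsq (C *\<^sub>v col U k)) (C * mat_powr ?b s * C)"
    unfolding qbound_def
  proof
    fix x :: "complex vec" assume x: "x \<in> carrier_vec n"
    define z where "z = C *\<^sub>v x"
    have z: "z \<in> carrier_vec n" using C x by (simp add: z_def)
    have comp: "(mat_adjoint U *\<^sub>v z) $ k = x \<bullet>c (C *\<^sub>v col U k)" if k: "k < n" for k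
    proof -
      note u = conj_diag_eigenvector(2)[OF U k]
      have "(mat_adjoint U *\<^sub>v z) $ k = (\<Sum>i<n. mat_adjoint U $$ (k, i) * z $ i)"
        using U z k by (intro index_mult_mat_vec_sum) (auto simp: unitaryD)
      also have "\<dots> = z \<bullet>c col U k"
        using carrier_matD[OF unitaryD(1)[OF U]] k
        by (auto simp: scalar_prod_def atLeast0LessThan mult.commute intro!: sum.cong)
      also have "\<dots> = x \<bullet>c (C *\<^sub>v col U k)"
        using C x u by (simp add: z_def inner_adj)
      finally show ?thesis .
    qed
    have "((C * mat_powr ?b s * C) *\<^sub>v x) \<bullet>c x = (mat_powr ?b s *\<^sub>v z) \<bullet>c z"
      using C b x by (simp add: assoc_vec inner_adj z_def)
    also have "\<dots> = (conj_diag n U (\<lambda>k. l k powr s) *\<^sub>v z) \<bullet>c z"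
      using U l by (simp only: mat_powr_conj_diag)
    also have "(conj_diag n U (\<lambda>k. l k powr s) *\<^sub>v z) \<bullet>c z =
        of_real (\<Sum>k<n. l k powr s * (cmod ((mat_adjoint U *\<^sub>v z) $ k))\<^sup>2)"
      by (rule quadratic_form_conj_diag[OF U z])
    finally have "Re (((C * mat_powr ?b s * C) *\<^sub>v x) \<bullet>c x) =
        (\<Sum>k<n. l k powr s * (cmod ((mat_adjoint U *\<^sub>v z) $ k))\<^sup>2)"
      by (simp only: Re_complex_of_real)
    also have "\<dots> = (\<Sum>k<n. l k powr s * (cmod (x \<bullet>c (C *\<^sub>v col U k)))\<^sup>2)"
      using comp by (intro sum.cong) simp_all
    also have "\<dots> \<le> (\<Sum>k<n. l k powr s * (vsq x * vsq (C *\<^sub>v col U k)))"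
      using C x conj_diag_eigenvector(2)[OF U] by (intro sum_mono mult_left_mono inner_cauchy_schwarz[of _ n]) auto
    finally show "Re (((C * mat_powr ?b s * C) *\<^sub>v x) \<bullet>c x) \<le> (\<Sum>k<n. l k powr s * vsq (C *\<^sub>v col U k)) * vsq x"
      by (simp add: sum_distrib_left mult_ac)
  qed
  then show ?thesis
    using opbound_half_powr[of "mat_powr ?b s" C] b C by (simp add: mat_powr_powr)
qed

text \<open>Test the adjoint product \<open>C b^(s/2)\<close> on the unit eigenvector
  \<open>u_k\<close>.\<close>

lemma opbound_eigenvector_lower:
  assumes U: "unitary_mat n U" and l: "\<And>i. i < n \<Longrightarrow> l i \<ge> 0" and C: "psd n C" and K: "0 \<le> K"
    and bd: "opbound n K (mat_powr (conj_diag n U l) (s / 2) * C)" and k: "k < n"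
  shows "l k powr s * vsq (C *\<^sub>v col U k) \<le> K"
proof -
  let ?b = "mat_powr (conj_diag n U l) (s / 2)"
  have b: "psd n ?b" using U l by (intro psd_mat_powr psd_conj_diag)
  note u = conj_diag_eigenvector(2,3)[OF U k]
  have "opbound n K (C * ?b)"
    using opbound_adjoint_iff[of "?b * C" K] b C K bd by (simp add: adjoint_mult)
  then have "vsq ((C * ?b) *\<^sub>v col U k) \<le> K" using u by (auto simp: opbound_def)
  also have "(C * ?b) *\<^sub>v col U k = of_real (l k powr (s / 2)) \<cdot>\<^sub>v (C *\<^sub>v col U k)"
    using U l C u(1) conj_diag_eigenvector(1)[OF U k]
    by (simp add: assoc_vec mat_powr_conj_diag conj_diag_closed mult_mat_vec[of _ n n])
  finally show ?thesis
    by (simp add: vsq_smult power2_eq_square flip: powr_add)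
qed

section \<open>Positive definite pairs prescribed by a and X\<close>

lemma pos_defI:
  assumes A: "psd n A" and 0: "mat_powr A 0 = 1\<^sub>m n"
  shows "pos_def n A"
  unfolding pos_def_def
proof (intro conjI ballI impI)
  show "hermitian_mat n A" using A by (simp add: psd_def)
  fix x :: "complex vec" assume x: "x \<in> carrier_vec n" "x \<noteq> 0\<^sub>v n"
  let ?R = "mat_powr A (1/2)"
  have "(A *\<^sub>v x) \<bullet>c x = ((?R * ?R) *\<^sub>v x) \<bullet>c x"
    using A by (simp add: mat_powr_mult)
  also have "\<dots> = of_real (vsq (?R *\<^sub>v x))"
    using A x by (simp add: assoc_vec inner_adj flip: inner_self)
  finally have eq: "Re ((A *\<^sub>v x) \<bullet>c x) = vsq (?R *\<^sub>v x)" by simp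
  have "?R *\<^sub>v x \<noteq> 0\<^sub>v n"
  proof
    assume Rx: "?R *\<^sub>v x = 0\<^sub>v n"
    have "x = (mat_powr A (- (1/2)) * ?R) *\<^sub>v x" using A 0 x by (simp add: mat_powr_mult)
    also have "\<dots> = 0\<^sub>v n" using A x Rx by (simp add: assoc_vec mult_zero_vec)
    finally show False using x by simp
  qed
  then have "vsq (?R *\<^sub>v x) \<noteq> 0" using A x vsq_eq_0[of "?R *\<^sub>v x" n] by simp
  then show "Re ((A *\<^sub>v x) \<bullet>c x) > 0" using eq vsq_nonneg[of "?R *\<^sub>v x"] by linarith
qed

lemma pos_def_mat_powr: "pos_def n A \<Longrightarrow> pos_def n (mat_powr A r)"
  by (intro pos_defI) (simp_all add: pos_def_psd mat_powr_powr pos_def_powr_0)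

lemma pos_def_sandwich:
  assumes A: "pos_def n A" and X: "pos_def n X"
  shows "pos_def n (X * A * X)"
  unfolding pos_def_def
proof (intro conjI ballI impI)
  have A': "psd n A" and X': "psd n X" using assms by (simp_all add: pos_def_psd)
  show "hermitian_mat n (X * A * X)" using psd_sandwich[OF A' X'] by (simp add: psd_def)
  fix x :: "complex vec" assume x: "x \<in> carrier_vec n" "x \<noteq> 0\<^sub>v n"
  have "X *\<^sub>v x \<noteq> 0\<^sub>v n" using X x by (auto simp: pos_def_def)
  moreover have "((X * A * X) *\<^sub>v x) \<bullet>c x = (A *\<^sub>v (X *\<^sub>v x)) \<bullet>c (X *\<^sub>v x)"
    using A' X' x by (simp add: assoc_vec inner_adj)
  ultimately show "Re (((X * A * X) *\<^sub>v x) \<bullet>c x) > 0" using A X' x by (simp add: pos_def_def)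
qed

text \<open>\<open>a^(1/2) (X a X) a^(1/2)\<close> is the square of the positive semidefinite matrix
  \<open>a^(1/2) X a^(1/2)\<close>, so uniqueness of the square root recovers X. Test pairs A, B can
  thus be built from freely chosen a and X.\<close>

lemma geom_mean_riccati_unique:
  assumes a: "pos_def n a" and X: "psd n X"
  shows "geom_mean (mat_powr a (- 1)) (X * a * X) = X"
proof -
  have a': "psd n a" using a by (rule pos_def_psd)
  let ?a = "mat_powr a"
  let ?Z = "?a (1/2) * X * ?a (1/2)"
  have Z: "psd n ?Z" using a' X by (simp add: psd_sandwich)
  have aa: "?a (- (1/2)) * (?a (1/2) * T) = T" "?a (1/2) * (?a (- (1/2)) * T) = T" if "T \<in> carrier_mat n n" for T
    using a a' that mat_powr_mult'[OF a' that] by (simp_all add: pos_def_powr_0 left_one)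
  have Xa: "X * a = X * (?a (1/2) * ?a (1/2))" using a' by (simp add: mat_powr_mult)
  have "?a (1/2) * (X * a * X) * ?a (1/2) = ?Z * ?Z"
    unfolding Xa using a' X by (simp add: assoc)
  then have "mat_powr (?a (1/2) * (X * a * X) * ?a (1/2)) (1/2) = ?Z"
    using mat_powr_sqrt_unique[OF Z] by simp
  then have "geom_mean (?a (- 1)) (X * a * X) = ?a (- (1/2)) * ?Z * ?a (- (1/2))"
    using a' by (simp add: geom_mean_def mat_powr_powr)
  also have "\<dots> = X * (?a (1/2) * ?a (- (1/2)))"
    using a' X by (simp add: assoc aa)
  also have "\<dots> = X" using a a' X by (simp add: mat_powr_mult pos_def_powr_0 right_one)
  finally show ?thesis .
qed

lemma SG_Renyi_parametrized:
  fixes p q \<alpha> c :: real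
  assumes a: "pos_def n a" and X: "pos_def n X" and pq: "0 < p" "0 < q" and c: "0 \<le> c"
  defines "A \<equiv> mat_powr a (1 / p)" and "B \<equiv> mat_powr (X * a * X) (1 / p)"
  shows "pos_def n A" "pos_def n B"
    "qbound n c (SG \<alpha> p A B) \<longleftrightarrow> qbound n (c powr p) (mat_powr X \<alpha> * a * mat_powr X \<alpha>)"
    "qbound n c (Renyi \<alpha> q A B) \<longleftrightarrow>
       opbound n (c powr q) (mat_powr (X * a * X) (\<alpha> * (q / p) / 2) * mat_powr a ((1 - \<alpha>) * (q / p) / 2))"
proof -
  show AB: "pos_def n A" "pos_def n B"
    by (simp_all add: A_def B_def a X pos_def_mat_powr pos_def_sandwich)
  have a': "psd n a" and X': "psd n X" and b': "psd n (X * a * X)"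
    using a X by (simp_all add: pos_def_psd psd_sandwich)
  have A: "mat_powr A p = a" "mat_powr A (- p) = mat_powr a (- 1)" and B: "mat_powr B p = X * a * X"
    using pq a' b' by (simp_all add: A_def B_def mat_powr_powr)
  note AB' = AB[THEN pos_def_psd]
  show "qbound n c (SG \<alpha> p A B) \<longleftrightarrow> qbound n (c powr p) (mat_powr X \<alpha> * a * mat_powr X \<alpha>)"
    using qbound_SG[OF AB' pq(1) c] by (simp only: A B geom_mean_riccati_unique[OF a X'])
  show "qbound n c (Renyi \<alpha> q A B) \<longleftrightarrow>
       opbound n (c powr q) (mat_powr (X * a * X) (\<alpha> * (q / p) / 2) * mat_powr a ((1 - \<alpha>) * (q / p) / 2))"
    using qbound_Renyi[OF AB' pq c] by (simp only: A B)
qed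

text \<open>The exchange of a and b for test pairs: now c plays the part of b, and the spectral side
  is that of the pair c, D with \<alpha> replaced by \<open>1 - \<alpha>\<close>.\<close>

lemma sandwich_inverse:
  assumes c: "pos_def n c" and D: "pos_def n D"
  defines "X \<equiv> mat_powr D (- 1)" and "a \<equiv> D * c * D"
  shows "pos_def n X" "pos_def n a" "X * a * X = c"
    "mat_powr X \<alpha> * a * mat_powr X \<alpha> = mat_powr D (1 - \<alpha>) * c * mat_powr D (1 - \<alpha>)"
proof -
  show "pos_def n X" "pos_def n a"
    using c D by (simp_all add: X_def a_def pos_def_mat_powr pos_def_sandwich)
  have c': "psd n c" and D': "psd n D" using c D by (simp_all add: pos_def_psd)
  have DD: "mat_powr D r * (D * T) = mat_powr D (r + 1) * T" if "T \<in> carrier_mat n n" for r T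
    using mat_powr_mult'[OF D' that, of r 1] D' by simp
  have DD': "D * mat_powr D r = mat_powr D (1 + r)" for r
    using mat_powr_mult[OF D', of 1 r] D' by simp
  have eq: "mat_powr D r * a * mat_powr D r = mat_powr D (r + 1) * c * mat_powr D (1 + r)" for r
    unfolding a_def using c' D' by (simp add: assoc DD DD')
  show "X * a * X = c"
    using eq[of "- 1"] c' D by (simp add: X_def pos_def_powr_0 left_one right_one)
  show "mat_powr X \<alpha> * a * mat_powr X \<alpha> = mat_powr D (1 - \<alpha>) * c * mat_powr D (1 - \<alpha>)"
    using eq[of "- \<alpha>"] D' by (simp add: X_def mat_powr_powr)
qed

text \<open>The parameter \<kappa> treats both roles of c at once. For
  \<open>\<kappa> = \<alpha>\<close> take \<open>a = c\<close> and \<open>X = D\<close>; for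
  \<open>\<kappa> = 1 - \<alpha>\<close> take \<open>a = D c D\<close> and X the inverse of D, so
  that \<open>b = c\<close>. Both choices lead to the same S, and to the same R up to taking the
  adjoint.\<close>

lemma majorization_bounds:
  fixes p q \<alpha> \<kappa> :: real
  assumes n: "0 < n" and pq: "0 < p" "0 < q" and \<kappa>: "\<kappa> = \<alpha> \<or> \<kappa> = 1 - \<alpha>"
    and c: "pos_def n c" and D: "pos_def n D" and K: "0 \<le> K"
  defines "S \<equiv> mat_powr D \<kappa> * c * mat_powr D \<kappa>"
    and "R \<equiv> mat_powr (D * c * D) (\<kappa> * (q / p) / 2) * mat_powr c ((1 - \<kappa>) * (q / p) / 2)"
  shows "(\<And>A B. pos_def n A \<Longrightarrow> pos_def n B \<Longrightarrow> log_majorized n (SG \<alpha> p A B) (Renyi \<alpha> q A B)) \<Longrightarrow>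
      opbound n (K powr q) R \<Longrightarrow> qbound n (K powr p) S"
    and "(\<And>A B. pos_def n A \<Longrightarrow> pos_def n B \<Longrightarrow> log_majorized n (Renyi \<alpha> q A B) (SG \<alpha> p A B)) \<Longrightarrow>
      qbound n (K powr p) S \<Longrightarrow> opbound n (K powr q) R"
proof -
  obtain A B where "pos_def n A" "pos_def n B"
    "qbound n K (SG \<alpha> p A B) \<longleftrightarrow> qbound n (K powr p) S"
    "qbound n K (Renyi \<alpha> q A B) \<longleftrightarrow> opbound n (K powr q) R"
  proof (cases "\<kappa> = \<alpha>")
    case True
    note par = SG_Renyi_parametrized(1,2)[OF c D pq K] SG_Renyi_parametrized(3,4)[OF c D pq K, of \<alpha>]
    show thesis
      by (rule that[OF par(1,2)]) (simp_all only: par(3,4) R_def S_def True)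
  next
    case False
    then have k: "\<kappa> = 1 - \<alpha>" using \<kappa> by simp
    note sand = sandwich_inverse(1-3)[OF c D] sandwich_inverse(4)[OF c D, of \<alpha>]
    have psd: "psd n c" "psd n (D * c * D)" using c D by (simp_all add: pos_def_psd psd_sandwich)
    have R: "opbound n (K powr q) R \<longleftrightarrow> opbound n (K powr q) (mat_powr c (\<alpha> * (q / p) / 2) * mat_powr (D * c * D) ((1 - \<alpha>) * (q / p) / 2))"
      unfolding R_def k using psd by (subst opbound_swap) simp_all
    note par = SG_Renyi_parametrized(1,2)[OF sand(2,1) pq K, unfolded sand(3)]
      SG_Renyi_parametrized(3,4)[OF sand(2,1) pq K, of \<alpha>, unfolded sand(3,4)]
    show thesis
      by (rule that[OF par(1,2)]) (simp_all only: par(3,4) R S_def k)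
  qed
  then show "(\<And>A B. pos_def n A \<Longrightarrow> pos_def n B \<Longrightarrow> log_majorized n (SG \<alpha> p A B) (Renyi \<alpha> q A B)) \<Longrightarrow>
      opbound n (K powr q) R \<Longrightarrow> qbound n (K powr p) S"
    and "(\<And>A B. pos_def n A \<Longrightarrow> pos_def n B \<Longrightarrow> log_majorized n (Renyi \<alpha> q A B) (SG \<alpha> p A B)) \<Longrightarrow>
      qbound n (K powr p) S \<Longrightarrow> opbound n (K powr q) R"
    using log_majorized_qbound[OF _ n] by blast+
qed

end


section \<open>Necessity of the exponent conditions\<close>

lemma sum_lessThan_2: "(\<Sum>i<2. f i) = f 0 + f (1::nat)"
  by (simp add: numeral_2_eq_2)

text \<open>The normalized Hadamard matrix. Being a symmetric reflection, it is its own adjoint and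
  inverse; all its entries have equal modulus, which makes both diagonal entries of
  \<open>tilted x y\<close> the mean of x and y.\<close>

definition rot45 :: "complex mat" where
  "rot45 = mat 2 2 (\<lambda>(i, j). complex_of_real (if i = 1 \<and> j = 1 then - (1 / sqrt 2) else 1 / sqrt 2))"

definition tilted :: "real \<Rightarrow> real \<Rightarrow> complex mat" where
  "tilted x y = conj_diag 2 rot45 (\<lambda>i. if i = 0 then x else y)"

text \<open>As \<open>\<epsilon>\<close> tends to \<open>0\<close>, conjugating by \<open>squeeze \<epsilon>\<close> compresses \<open>tilted x y\<close> to its upper left entry \<open>(x + y) / 2\<close>.\<close>

definition squeeze :: "real \<Rightarrow> complex mat" where
  "squeeze \<epsilon> = mat_diag 2 (\<lambda>i. complex_of_real (if i = 0 then 1 else \<epsilon>))"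

lemma rot45_closed: "rot45 \<in> carrier_mat 2 2"
  by (simp add: rot45_def)

lemma rot45_adjoint: "mat_adjoint rot45 = rot45"
  by (rule eq_matI) (auto simp: rot45_def)

lemma unitary_rot45: "unitary_mat 2 rot45"
proof -
  have s: "complex_of_real (1 / sqrt 2) * complex_of_real (1 / sqrt 2) = 1 / 2"
  proof -
    have "1 / sqrt 2 * (1 / sqrt 2) = 1 / (2::real)" by simp
    then show ?thesis by (metis of_real_mult of_real_divide of_real_1 of_real_numeral)
  qed
  have "rot45 * rot45 = 1\<^sub>m 2"
  proof (rule eq_matI)
    fix i j assume "i < dim_row (1\<^sub>m 2)" "j < dim_col (1\<^sub>m 2)"
    then have ij: "i < 2" "j < 2" by simp_all
    have "(rot45 * rot45) $$ (i, j) = (\<Sum>l<2. rot45 $$ (i, l) * rot45 $$ (l, j))"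
      using rot45_closed ij by (intro index_mult_mat_sum) auto
    then show "(rot45 * rot45) $$ (i, j) = 1\<^sub>m 2 $$ (i, j)"
      using ij s unfolding less_2_cases_iff sum_lessThan_2 rot45_def by auto
  qed (simp_all add: rot45_def)
  then show ?thesis by (simp add: unitary_mat_def rot45_closed rot45_adjoint)
qed

lemma tilted_powr:
  assumes "0 \<le> x" "0 \<le> y"
  shows "mat_powr (tilted x y) t = tilted (x powr t) (y powr t)"
  unfolding tilted_def using assms
  by (subst fixed_dim.mat_powr_conj_diag[OF unitary_rot45]) (auto intro!: conj_diag_cong)

lemma squeeze_conj_diag: "squeeze \<epsilon> = conj_diag 2 (1\<^sub>m 2) (\<lambda>i. if i = 0 then 1 else \<epsilon>)"
  by (simp add: squeeze_def conj_diag_def left_mult_one_mat[of _ 2 2] right_mult_one_mat[of _ 2 2])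

lemma unitary_one: "unitary_mat n (1\<^sub>m n)"
  by (simp add: unitary_mat_def)

lemma squeeze_powr: "0 \<le> \<epsilon> \<Longrightarrow> mat_powr (squeeze \<epsilon>) t = squeeze (\<epsilon> powr t)"
  unfolding squeeze_conj_diag
  by (subst fixed_dim.mat_powr_conj_diag[OF unitary_one]) (auto intro!: conj_diag_cong)

lemma conj_diag_ones: "unitary_mat n U \<Longrightarrow> conj_diag n U (\<lambda>_. 1) = 1\<^sub>m n"
  by (simp add: conj_diag_def unitary_mat_def right_mult_one_mat[of _ n n])

lemma pos_def_conj_diag:
  assumes U: "unitary_mat n U" and d: "\<And>i. i < n \<Longrightarrow> 0 < d i"
  shows "pos_def n (conj_diag n U d)"
proof (rule fixed_dim.pos_defI)
  have d': "\<And>i. i < n \<Longrightarrow> 0 \<le> d i" using d by (simp add: less_imp_le)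
  show "psd n (conj_diag n U d)" using fixed_dim.psd_conj_diag[OF U d'] .
  have "conj_diag n U (\<lambda>i. d i powr 0) = conj_diag n U (\<lambda>_. 1)"
    using d by (intro conj_diag_cong) (simp add: less_imp_neq[symmetric])
  then show "mat_powr (conj_diag n U d) 0 = 1\<^sub>m n"
    by (simp only: fixed_dim.mat_powr_conj_diag[OF U d'] conj_diag_ones[OF U])
qed

lemma pos_def_tilted: "0 < x \<Longrightarrow> 0 < y \<Longrightarrow> pos_def 2 (tilted x y)"
  unfolding tilted_def by (intro pos_def_conj_diag unitary_rot45) auto

lemma pos_def_squeeze: "0 < \<epsilon> \<Longrightarrow> pos_def 2 (squeeze \<epsilon>)"
  unfolding squeeze_conj_diag by (intro pos_def_conj_diag unitary_one) auto

lemma tilted_diagonal: "i < 2 \<Longrightarrow> tilted x y $$ (i, i) = complex_of_real ((x + y) / 2)"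
proof -
  have s: "sqrt 2 * sqrt 2 = 2" "complex_of_real (sqrt 2) * complex_of_real (sqrt 2) = 2"
    by (simp_all flip: of_real_mult)
  assume i: "i < 2"
  have "tilted x y $$ (i, i) = (\<Sum>k<2. rot45 $$ (i, k) * complex_of_real (if k = 0 then x else y) * cnj (rot45 $$ (i, k)))"
    unfolding tilted_def conj_diag_def using i by (intro index_conj_diag rot45_closed)
  also have "\<dots> = complex_of_real (x / (sqrt 2 * sqrt 2) + y / (sqrt 2 * sqrt 2))"
    using i unfolding less_2_cases_iff sum_lessThan_2 rot45_def by (auto simp: s)
  finally show ?thesis unfolding s by (simp add: add_divide_distrib)
qed

text \<open>The equal diagonal entries contribute the mean for every unit vector; what remains is
  the cross term \<open>(x - y) * w\<close>, small when u is close to the first coordinate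
  axis.\<close>

lemma tilted_form:
  assumes u: "u \<in> carrier_vec 2" "vsq u = 1" and xy: "0 \<le> x" "0 \<le> y"
  shows "\<bar>Re ((tilted x y *\<^sub>v u) \<bullet>c u) - (x + y) / 2\<bar> \<le> (x + y) * cmod (u $ 1)"
proof -
  define v where "v = mat_adjoint rot45 *\<^sub>v u"
  have v: "v $ i = (\<Sum>k<2. rot45 $$ (i, k) * u $ k)" if "i < 2" for i
    unfolding v_def rot45_adjoint using u(1) rot45_closed that by (intro index_mult_mat_vec_sum)
  have v0: "v $ 0 = (u $ 0 + u $ 1) / complex_of_real (sqrt 2)"
    and v1: "v $ 1 = (u $ 0 - u $ 1) / complex_of_real (sqrt 2)"
    using v[of 0] v[of 1] unfolding sum_lessThan_2 rot45_def by (simp_all add: add_divide_distrib diff_divide_distrib)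
  have s: "(cmod (z / complex_of_real (sqrt 2)))\<^sup>2 = (cmod z)\<^sup>2 / 2" for z
    by (simp add: norm_divide power_divide)
  have n1: "(cmod (u $ 0))\<^sup>2 + (cmod (u $ 1))\<^sup>2 = 1"
    using u by (simp add: vsq_sum sum_lessThan_2)
  define w where "w = Re (u $ 0 * cnj (u $ 1))"
  have cm: "(cmod (a + b))\<^sup>2 = (cmod a)\<^sup>2 + (cmod b)\<^sup>2 + 2 * Re (a * cnj b)"
    "(cmod (a - b))\<^sup>2 = (cmod a)\<^sup>2 + (cmod b)\<^sup>2 - 2 * Re (a * cnj b)" for a b
    unfolding cmod_power2 by (simp_all add: power2_eq_square algebra_simps)
  have "Re ((tilted x y *\<^sub>v u) \<bullet>c u) = x * (cmod (v $ 0))\<^sup>2 + y * (cmod (v $ 1))\<^sup>2"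
    unfolding tilted_def fixed_dim.quadratic_form_conj_diag[OF unitary_rot45 u(1)] v_def
    by (simp only: Re_complex_of_real sum_lessThan_2) simp
  also have "\<dots> = x * ((1 + 2 * w) / 2) + y * ((1 - 2 * w) / 2)"
    unfolding v0 v1 s cm n1 w_def ..
  also have "\<dots> = (x + y) / 2 + (x - y) * w" by (simp add: field_simps)
  finally have "\<bar>Re ((tilted x y *\<^sub>v u) \<bullet>c u) - (x + y) / 2\<bar> = \<bar>x - y\<bar> * \<bar>w\<bar>"
    by (simp add: abs_mult)
  also have "\<dots> \<le> (x + y) * cmod (u $ 1)"
  proof (intro mult_mono)
    have "(cmod (u $ 0))\<^sup>2 \<le> 1\<^sup>2" unfolding one_power2 using n1 zero_le_power2[of "cmod (u $ 1)"] by linarith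
    then have "cmod (u $ 0) \<le> 1" by (rule power2_le_imp_le) simp
    then have "cmod (u $ 0) * cmod (u $ 1) \<le> 1 * cmod (u $ 1)" by (intro mult_right_mono) auto
    moreover have "\<bar>w\<bar> \<le> cmod (u $ 0 * cnj (u $ 1))" unfolding w_def by (rule abs_Re_le_cmod)
    ultimately show "\<bar>w\<bar> \<le> cmod (u $ 1)" by (simp add: norm_mult)
  qed (use xy in auto)
  finally show ?thesis .
qed

text \<open>The diagonal entries are m and \<open>\<epsilon>\<^sup>2 * m\<close>. The largest
  eigenvalue is at least the first entry, and the trace then confines both eigenvalues. The second
  entry dominates \<open>l 0 * (cmod (U $$ (1, 0)))\<^sup>2\<close>, which forces the leading
  eigenvector towards the first axis.\<close>

lemma squeezed_spectrum:
  assumes xy: "0 < x" "0 < y" and e: "0 < \<epsilon>"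
  defines "m \<equiv> (x + y) / 2"
  obtains U l where "unitary_mat 2 U" "squeeze \<epsilon> * tilted x y * squeeze \<epsilon> = conj_diag 2 U l"
    "m \<le> l 0" "l 0 \<le> m * (1 + \<epsilon>\<^sup>2)" "0 \<le> l 1" "l 1 \<le> \<epsilon>\<^sup>2 * m" "cmod (U $$ (1, 0)) \<le> \<epsilon>"
proof -
  interpret fixed_dim 2 .
  let ?b = "squeeze \<epsilon> * tilted x y * squeeze \<epsilon>"
  have m: "m > 0" using xy by (simp add: m_def)
  have T: "tilted x y \<in> carrier_mat 2 2" using pos_def_tilted[OF xy] by (simp add: pos_def_def hermitian_mat_def)
  have D: "squeeze \<epsilon> \<in> carrier_mat 2 2" by (simp add: squeeze_def)
  have "psd 2 ?b" using pos_def_tilted[OF xy] pos_def_squeeze[OF e] by (intro psd_sandwich pos_def_psd)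
  then obtain U l where U: "unitary_mat 2 U" and b: "?b = conj_diag 2 U l" and l0: "\<And>i. i < 2 \<Longrightarrow> l i \<ge> 0"
    and mono: "\<And>i j. i \<le> j \<Longrightarrow> j < 2 \<Longrightarrow> l j \<le> l i" using psd_sorted by metis
  have l: "0 \<le> l 0" "0 \<le> l 1" "l 1 \<le> l 0" using l0[of 0] l0[of 1] mono[of 0 1] by simp_all
  note Uc = unitaryD[OF U]
  let ?u = "\<lambda>i j. (cmod (U $$ (i, j)))\<^sup>2"
  have bii: "?b $$ (i, i) = of_real (l 0 * ?u i 0 + l 1 * ?u i 1)" if "i < 2" for i
  proof -
    have "?b $$ (i, i) = (\<Sum>k<2. U $$ (i, k) * complex_of_real (l k) * cnj (U $$ (i, k)))"
      unfolding b conj_diag_def using that Uc(1) by (intro index_conj_diag)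
    also have "\<dots> = (\<Sum>k<2. of_real (l k * ?u i k))"
      by (intro sum.cong) (simp_all add: mult_ac flip: complex_norm_square)
    finally show ?thesis by (simp add: sum_lessThan_2)
  qed
  have e2: "?b $$ (i, i) = of_real ((if i = 0 then 1 else \<epsilon>\<^sup>2) * m)" if "i < 2" for i
  proof -
    have "?b $$ (i, i) = (if i = 0 then 1 else of_real \<epsilon>) * tilted x y $$ (i, i) * (if i = 0 then 1 else of_real \<epsilon>)"
      using that T D mat_diag_mult_right[of "squeeze \<epsilon> * tilted x y" 2 2] mat_diag_mult_left[OF T]
      by (simp add: squeeze_def)
    then show ?thesis using tilted_diagonal[OF that, of x y] by (simp add: m_def power2_eq_square)
  qed
  have lt2: "(0::nat) < 2" "(1::nat) < 2" by simp_all
  have 0: "l 0 * ?u 0 0 + l 1 * ?u 0 1 = m"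
    using trans[OF bii[OF lt2(1), symmetric] e2[OF lt2(1)], unfolded of_real_eq_iff] by simp
  have 1: "l 0 * ?u 1 0 + l 1 * ?u 1 1 = \<epsilon>\<^sup>2 * m"
    using trans[OF bii[OF lt2(2), symmetric] e2[OF lt2(2)], unfolded of_real_eq_iff] by simp
  have col: "?u 0 k + ?u 1 k = 1" if "k < 2" for k
    using conj_diag_eigenvector(3)[OF U that] that carrier_matD[OF Uc(1)] by (simp add: vsq_sum sum_lessThan_2)
  have row: "?u i 0 + ?u i 1 = 1" if "i < 2" for i
  proof -
    have "(U * mat_adjoint U) $$ (i, i) = (\<Sum>k<2. U $$ (i, k) * mat_adjoint U $$ (k, i))"
      using Uc that by (intro index_mult_mat_sum)
    also have "\<dots> = (\<Sum>k<2. of_real (?u i k))"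
      using carrier_matD[OF Uc(1)] that by (intro sum.cong) (simp_all flip: complex_norm_square)
    finally have "complex_of_real (?u i 0 + ?u i 1) = complex_of_real 1"
      using Uc(4) that by (simp add: sum_lessThan_2)
    then show ?thesis by (simp only: of_real_eq_iff)
  qed
  have ml: "m \<le> l 0"
  proof -
    have "m \<le> l 0 * ?u 0 0 + l 0 * ?u 0 1" unfolding 0[symmetric] using l by (simp add: mult_right_mono)
    also have "\<dots> = l 0" using row[of 0] by (simp flip: distrib_left)
    finally show ?thesis .
  qed
  have "l 0 * (?u 0 0 + ?u 1 0) + l 1 * (?u 0 1 + ?u 1 1) = m + \<epsilon>\<^sup>2 * m"
    using 0 1 unfolding distrib_left by linarith
  then have tr: "l 0 + l 1 = m + \<epsilon>\<^sup>2 * m" using col[of 0] col[of 1] by simp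
  have "m * ?u 1 0 \<le> l 0 * ?u 1 0" using ml by (intro mult_right_mono) auto
  also have "\<dots> \<le> \<epsilon>\<^sup>2 * m" using 1 l by (smt (verit) mult_nonneg_nonneg zero_le_power2)
  finally have "?u 1 0 \<le> \<epsilon>\<^sup>2" using m by simp
  then have u10: "cmod (U $$ (1, 0)) \<le> \<epsilon>" using e by (rule power2_le_imp_le[OF _ less_imp_le])
  have "m * (1 + \<epsilon>\<^sup>2) = m + \<epsilon>\<^sup>2 * m" by (simp add: algebra_simps)
  then have "l 0 \<le> m * (1 + \<epsilon>\<^sup>2)" "l 1 \<le> \<epsilon>\<^sup>2 * m" using ml l tr by linarith+
  from that[OF U b ml this(1) l(2) this(2) u10] show thesis .
qed

text \<open>As \<epsilon> tends to 0, the squared norm of \<open>b^(s/2) c^(t/2)\<close>, with c the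
  tilted matrix, tends to \<open>m^s M\<close>, and the largest eigenvalue of b tends to m. These
  are the two quantities that Jensen's inequality compares.\<close>

lemma squeezed_bounds:
  fixes x y \<epsilon> s t :: real
  assumes xy: "0 < x" "0 < y" and e: "0 < \<epsilon>" "\<epsilon> \<le> 1" and s: "0 < s"
  defines "m \<equiv> (x + y) / 2" and "M \<equiv> (x powr t + y powr t) / 2"
    and "b \<equiv> squeeze \<epsilon> * tilted x y * squeeze \<epsilon>"
  shows "opbound 2 ((m * (1 + \<epsilon>\<^sup>2)) powr s * (M * (1 + 2 * \<epsilon>)) + (\<epsilon>\<^sup>2 * m) powr s * (3 * M))
      (mat_powr b (s / 2) * mat_powr (tilted x y) (t / 2))" (is "opbound 2 ?K _")
    and "0 \<le> K \<Longrightarrow> opbound 2 K (mat_powr b (s / 2) * mat_powr (tilted x y) (t / 2)) \<Longrightarrow> m powr s * (M * (1 - 2 * \<epsilon>)) \<le> K"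
    and "qbound 2 (m * (1 + \<epsilon>\<^sup>2)) b"
    and "qbound 2 K b \<Longrightarrow> m \<le> K"
proof -
  interpret fixed_dim 2 .
  obtain U l where U: "unitary_mat 2 U" and b: "b = conj_diag 2 U l"
    and l: "m \<le> l 0" "l 0 \<le> m * (1 + \<epsilon>\<^sup>2)" "0 \<le> l 1" "l 1 \<le> \<epsilon>\<^sup>2 * m" and u10: "cmod (U $$ (1, 0)) \<le> \<epsilon>"
    unfolding m_def b_def by (rule squeezed_spectrum[OF xy e(1)])
  have m: "m > 0" and M: "M > 0" using xy by (simp_all add: m_def M_def add_pos_pos)
  have lnn: "l i \<ge> 0" if "i < 2" for i using that l m by (auto simp: less_2_cases_iff)
  let ?C = "mat_powr (tilted x y) (t / 2)"
  have c: "psd 2 (tilted x y)" using pos_def_tilted[OF xy] by (rule pos_def_psd)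
  have C: "psd 2 ?C" using c by simp
  have vC: "\<bar>vsq (?C *\<^sub>v col U k) - M\<bar> \<le> 2 * M * cmod (U $$ (1, k))" if k: "k < 2" for k
  proof -
    note u = conj_diag_eigenvector(2,3)[OF U k]
    have "complex_of_real (vsq (?C *\<^sub>v col U k)) = ((?C * ?C) *\<^sub>v col U k) \<bullet>c col U k"
      using C u(1) by (simp add: assoc_vec inner_adj flip: inner_self)
    also have "?C * ?C = tilted (x powr t) (y powr t)"
      using xy c by (simp add: mat_powr_mult flip: tilted_powr)
    finally have "vsq (?C *\<^sub>v col U k) = Re ((tilted (x powr t) (y powr t) *\<^sub>v col U k) \<bullet>c col U k)"
      by (metis Re_complex_of_real)
    moreover have "col U k $ 1 = U $$ (1, k)" using carrier_matD[OF unitaryD(1)[OF U]] k by simp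
    moreover have "x powr t + y powr t = 2 * M" by (simp add: M_def)
    ultimately show ?thesis
      using tilted_form[OF u, of "x powr t" "y powr t"] by simp
  qed
  have v0: "\<bar>vsq (?C *\<^sub>v col U 0) - M\<bar> \<le> 2 * M * \<epsilon>"
    using vC[of 0] u10 M by (smt (verit) mult_left_mono zero_less_numeral)
  \<comment> \<open>The second eigenvector need not be near either axis in this estimate:
    \<open>cmod (U $$ (1, 1)) \<le> 1\<close> allows a deviation of \<open>2 * M\<close> from M. The
    crude 3 is harmless, as its weight \<open>l 1 powr s\<close> tends to 0.\<close>
  have v1: "vsq (?C *\<^sub>v col U 1) \<le> 3 * M"
  proof -
    have "(cmod (U $$ (1, 1)))\<^sup>2 \<le> 1\<^sup>2"
      using conj_diag_eigenvector(3)[OF U, of 1] carrier_matD[OF unitaryD(1)[OF U]]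
      by (simp add: vsq_sum sum_lessThan_2) (smt (verit) zero_le_power2)
    then have "cmod (U $$ (1, 1)) \<le> 1" by (rule power2_le_imp_le) simp
    then have "2 * M * cmod (U $$ (1, 1)) \<le> 2 * M * 1" using M by (intro mult_left_mono) auto
    then show ?thesis using vC[of 1] by simp
  qed
  have sum: "(\<Sum>k<2. l k powr s * vsq (?C *\<^sub>v col U k)) \<le> ?K"
    unfolding sum_lessThan_2
  proof (intro add_mono mult_mono)
    show "l 0 powr s \<le> (m * (1 + \<epsilon>\<^sup>2)) powr s" using l m s by (intro powr_mono2) auto
    show "l 1 powr s \<le> (\<epsilon>\<^sup>2 * m) powr s" using l m s by (intro powr_mono2) auto
    show "vsq (?C *\<^sub>v col U 0) \<le> M * (1 + 2 * \<epsilon>)" using v0 by (simp add: algebra_simps abs_le_iff)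
  qed (use v1 in auto)
  show "opbound 2 ?K (mat_powr b (s / 2) * ?C)"
    unfolding b by (rule opbound_mono[OF opbound_eigenvector_sum[OF U lnn C] sum])
  show "m powr s * (M * (1 - 2 * \<epsilon>)) \<le> K" if K: "0 \<le> K" "opbound 2 K (mat_powr b (s / 2) * ?C)"
  proof -
    have "m powr s * (M * (1 - 2 * \<epsilon>)) \<le> m powr s * vsq (?C *\<^sub>v col U 0)"
      using v0 by (intro mult_left_mono) (auto simp: algebra_simps abs_le_iff)
    also have "\<dots> \<le> l 0 powr s * vsq (?C *\<^sub>v col U 0)"
      using l m s by (intro mult_right_mono powr_mono2) auto
    also have "\<dots> \<le> K"
      using opbound_eigenvector_lower[OF U lnn C K(1) K(2)[unfolded b], of 0] by simp
    finally show ?thesis .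
  qed
  show "qbound 2 (m * (1 + \<epsilon>\<^sup>2)) b"
  proof -
    have "\<epsilon>\<^sup>2 * m \<le> m * (1 + \<epsilon>\<^sup>2)" using m by (simp add: algebra_simps)
    then show ?thesis using l by (auto simp: b qbound_conj_diag[OF U] less_2_cases_iff)
  qed
  show "m \<le> K" if "qbound 2 K b"
    using that l(1) by (force simp: b qbound_conj_diag[OF U])
qed

section \<open>Failure of Jensen's inequality and the limit argument\<close>

lemma powr_mean_less:
  fixes t :: real
  assumes "0 < t" "t < 1"
  shows "\<exists>x y. 0 < x \<and> 0 < y \<and> (x powr t + y powr t) / 2 < ((x + y) / 2) powr t"
proof -
  have 2: "2 powr t < 2" using powr_less_mono[of t 1 2] assms by simp
  \<comment> \<open>Chosen so that \<open>\<delta> powr t\<close> fills half of the gap between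
    \<open>2 powr t\<close> and 2. The mean of the powers of 2 and \<delta> is then below 1, while
    their own mean exceeds 1.\<close>
  define \<delta> where "\<delta> = ((2 - 2 powr t) / 2) powr (1 / t)"
  have d: "\<delta> > 0" using 2 by (simp add: \<delta>_def)
  have "\<delta> powr t = (2 - 2 powr t) / 2" using 2 assms by (simp add: \<delta>_def powr_powr)
  then have "(2 powr t + \<delta> powr t) / 2 < 1" using 2 by (simp add: field_simps)
  also have "1 \<le> ((2 + \<delta>) / 2) powr t" using d assms by (intro ge_one_powr_ge_zero) auto
  finally show ?thesis using d by (intro exI[of _ 2] exI[of _ \<delta>]) auto
qed

text \<open>The concave case for \<open>1 / t\<close>, raised to the power t.\<close>

lemma powr_mean_greater:
  fixes t :: real
  assumes "1 < t"
  shows "\<exists>x y. 0 < x \<and> 0 < y \<and> ((x + y) / 2) powr t < (x powr t + y powr t) / 2"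
proof -
  obtain x y where xy: "0 < x" "0 < y" "(x powr (1 / t) + y powr (1 / t)) / 2 < ((x + y) / 2) powr (1 / t)"
    using powr_mean_less[of "1 / t"] assms by auto
  have "((x powr (1 / t) + y powr (1 / t)) / 2) powr t < (((x + y) / 2) powr (1 / t)) powr t"
    using xy assms by (intro powr_less_mono2) auto
  also have "\<dots> = ((x powr (1 / t)) powr t + (y powr (1 / t)) powr t) / 2"
    using xy assms by (simp add: powr_powr)
  finally show ?thesis using xy(1,2) by (intro exI[of _ "x powr (1 / t)"] exI[of _ "y powr (1 / t)"]) auto
qed

text \<open>In the limit the majorization says \<open>m^r \<le> m^s M\<close> with
  \<open>r = s + t\<close>, that is \<open>m^t \<le> M\<close>. This fails for suitable x and y when
  \<open>t < 1\<close>, which is the negation of the claim.\<close>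

lemma necessity_SG_Renyi:
  fixes \<alpha> p q :: real
  assumes \<alpha>: "0 < \<alpha>" "\<alpha> < 1" and pq: "0 < p" "0 < q" and \<kappa>: "\<kappa> = \<alpha> \<or> \<kappa> = 1 - \<alpha>"
    and maj: "\<And>A B. pos_def 2 A \<Longrightarrow> pos_def 2 B \<Longrightarrow> log_majorized 2 (SG \<alpha> p A B) (Renyi \<alpha> q A B)"
  shows "p \<le> (1 - \<kappa>) * q"
proof (rule ccontr)
  assume "\<not> p \<le> (1 - \<kappa>) * q"
  define r s t where "r = q / p" and "s = \<kappa> * r" and "t = (1 - \<kappa>) * r"
  have k: "0 < \<kappa>" "\<kappa> < 1" using \<kappa> \<alpha> by auto
  have r: "0 < r" and s: "0 < s" and t: "0 < t" "t < 1" and rst: "r = s + t"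
    using pq k \<open>\<not> p \<le> (1 - \<kappa>) * q\<close> by (auto simp: r_def s_def t_def field_simps)
  obtain x y where xy: "0 < x" "0 < y" and less: "(x powr t + y powr t) / 2 < ((x + y) / 2) powr t"
    using powr_mean_less[OF t] by blast
  define m M where "m = (x + y) / 2" and "M = (x powr t + y powr t) / 2"
  have m: "m > 0" and M: "M > 0" using xy by (simp_all add: m_def M_def add_pos_pos)
  define K where "K \<epsilon> = (m * (1 + \<epsilon>\<^sup>2)) powr s * (M * (1 + 2 * \<epsilon>)) + (\<epsilon>\<^sup>2 * m) powr s * (3 * M)" for \<epsilon>
  have bound: "m powr r \<le> K \<epsilon>" if e: "0 < \<epsilon>" "\<epsilon> \<le> 1" for \<epsilon>
  proof -
    have K0: "0 \<le> K \<epsilon>" using e m M by (simp add: K_def)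
    have "opbound 2 ((K \<epsilon> powr (1 / q)) powr q)
        (mat_powr (squeeze \<epsilon> * tilted x y * squeeze \<epsilon>) (\<kappa> * (q / p) / 2) * mat_powr (tilted x y) ((1 - \<kappa>) * (q / p) / 2))"
      using squeezed_bounds(1)[OF xy e s, of t] K0 pq
      by (simp add: powr_powr K_def m_def M_def s_def t_def r_def)
    \<comment> \<open>The power \<open>D^\<kappa>\<close> of a squeeze is again a squeeze, with
      parameter \<open>\<epsilon> powr \<kappa>\<close>, so the lower bound m for the largest
      eigenvalue still applies.\<close>
    from fixed_dim.majorization_bounds(1)[OF _ pq \<kappa> pos_def_tilted[OF xy] pos_def_squeeze[OF e(1)] _ maj this]
    have "qbound 2 (K \<epsilon> powr (1 / r)) (squeeze (\<epsilon> powr \<kappa>) * tilted x y * squeeze (\<epsilon> powr \<kappa>))"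
      using e pq by (simp add: powr_powr r_def squeeze_powr)
    then have "m \<le> K \<epsilon> powr (1 / r)"
      unfolding m_def using e k by (intro squeezed_bounds(4)[OF xy _ _ s]) (auto simp: powr_le_one_le powr_le1)
    then have "m powr r \<le> (K \<epsilon> powr (1 / r)) powr r" using m r by (intro powr_mono2) auto
    then show ?thesis using K0 r by (simp add: powr_powr)
  qed
  \<comment> \<open>The base of the second power tends to 0; positivity of s makes that term vanish
    in the limit.\<close>
  have "(K \<longlongrightarrow> (m * (1 + 0\<^sup>2)) powr s * (M * (1 + 2 * 0)) + (0\<^sup>2 * m) powr s * (3 * M)) (at_right 0)"
    unfolding K_def using m s by (intro tendsto_intros) auto
  then have "(K \<longlongrightarrow> m powr s * M) (at_right 0)" by simp
  moreover have "eventually (\<lambda>\<epsilon>. m powr r \<le> K \<epsilon>) (at_right 0)"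
    using bound by (auto simp: eventually_at_right[of 0 1] intro!: exI[of _ 1])
  ultimately have "m powr r \<le> m powr s * M"
    by (intro tendsto_lowerbound) auto
  then have "m powr s * m powr t \<le> m powr s * M" by (simp add: rst powr_add)
  then show False using less m by (simp add: m_def M_def)
qed

text \<open>Mirror image of the previous argument: the limit is \<open>m^s M \<le> m^r\<close>,
  contradicting strict convexity of the power \<open>t > 1\<close>.\<close>

lemma necessity_Renyi_SG:
  fixes \<alpha> p q :: real
  assumes \<alpha>: "0 < \<alpha>" "\<alpha> < 1" and pq: "0 < p" "0 < q" and \<kappa>: "\<kappa> = \<alpha> \<or> \<kappa> = 1 - \<alpha>"
    and maj: "\<And>A B. pos_def 2 A \<Longrightarrow> pos_def 2 B \<Longrightarrow> log_majorized 2 (Renyi \<alpha> q A B) (SG \<alpha> p A B)"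
  shows "(1 - \<kappa>) * q \<le> p"
proof (rule ccontr)
  assume "\<not> (1 - \<kappa>) * q \<le> p"
  define r s t where "r = q / p" and "s = \<kappa> * r" and "t = (1 - \<kappa>) * r"
  have k: "0 < \<kappa>" "\<kappa> < 1" using \<kappa> \<alpha> by auto
  have r: "0 < r" and s: "0 < s" and t: "1 < t" and rst: "r = s + t"
    using pq k \<open>\<not> (1 - \<kappa>) * q \<le> p\<close> by (auto simp: r_def s_def t_def field_simps)
  obtain x y where xy: "0 < x" "0 < y" and less: "((x + y) / 2) powr t < (x powr t + y powr t) / 2"
    using powr_mean_greater[OF t] by blast
  define m M where "m = (x + y) / 2" and "M = (x powr t + y powr t) / 2"
  have m: "m > 0" and M: "M > 0" using xy by (simp_all add: m_def M_def add_pos_pos)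
  have bound: "m powr s * (M * (1 - 2 * \<epsilon>)) \<le> (m * (1 + (\<epsilon> powr \<kappa>)\<^sup>2)) powr r" if e: "0 < \<epsilon>" "\<epsilon> \<le> 1" for \<epsilon>
  proof -
    \<comment> \<open>Two squeezing parameters occur: the spectral side contains
      \<open>D^\<kappa>\<close>, with parameter \<open>\<epsilon> powr \<kappa>\<close>, and the
      Renyi side contains D itself, with parameter \<epsilon>.\<close>
    define K where "K = m * (1 + (\<epsilon> powr \<kappa>)\<^sup>2)"
    have K0: "0 \<le> K" using m by (simp add: K_def)
    have ek: "0 < \<epsilon> powr \<kappa>" "\<epsilon> powr \<kappa> \<le> 1" using e k by (auto simp: powr_le1)
    have "qbound 2 ((K powr (1 / p)) powr p) (mat_powr (squeeze \<epsilon>) \<kappa> * tilted x y * mat_powr (squeeze \<epsilon>) \<kappa>)"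
      using squeezed_bounds(3)[OF xy ek s] K0 pq e by (simp add: powr_powr K_def m_def squeeze_powr)
    from fixed_dim.majorization_bounds(2)[OF _ pq \<kappa> pos_def_tilted[OF xy] pos_def_squeeze[OF e(1)] _ maj this]
    have "opbound 2 (K powr r) (mat_powr (squeeze \<epsilon> * tilted x y * squeeze \<epsilon>) (s / 2) * mat_powr (tilted x y) (t / 2))"
      by (simp add: powr_powr s_def t_def r_def)
    from squeezed_bounds(2)[OF xy e s _ this] show ?thesis by (simp add: K_def m_def M_def)
  qed
  have "((\<lambda>\<epsilon>. (m * (1 + (\<epsilon> powr \<kappa>)\<^sup>2)) powr r) \<longlongrightarrow> (m * (1 + (0 powr \<kappa>)\<^sup>2)) powr r) (at_right 0)"
    using m k by (intro tendsto_intros) (auto simp: eventually_at_right[of 0 1] intro!: exI[of _ 1])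
  moreover have "((\<lambda>\<epsilon>. m powr s * (M * (1 - 2 * \<epsilon>))) \<longlongrightarrow> m powr s * (M * (1 - 2 * 0))) (at_right 0)"
    by (intro tendsto_intros)
  moreover have "eventually (\<lambda>\<epsilon>. m powr s * (M * (1 - 2 * \<epsilon>)) \<le> (m * (1 + (\<epsilon> powr \<kappa>)\<^sup>2)) powr r) (at_right 0)"
    using bound by (auto simp: eventually_at_right[of 0 1] intro!: exI[of _ 1])
  ultimately have "m powr s * (M * (1 - 2 * 0)) \<le> (m * (1 + (0 powr \<kappa>)\<^sup>2)) powr r"
    by (intro tendsto_le[of "at_right 0"]) auto
  then have "m powr s * M \<le> m powr s * m powr t" by (simp add: rst powr_add)
  then show False using less m by (simp add: m_def M_def)
qed

theorem theorem3p3: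
  fixes \<alpha> p q :: real
  assumes "0 < \<alpha>" and "\<alpha> < 1" and "p > 0" and "q > 0"
  shows
    "((\<forall>n \<ge> 1. \<forall>A B. psd n A \<longrightarrow> psd n B \<longrightarrow> loewner_le n (support_proj B) (support_proj A) \<longrightarrow>
          log_majorized n (SG \<alpha> p A B) (Renyi \<alpha> q A B))
       \<longleftrightarrow> (\<forall>A B. pos_def 2 A \<longrightarrow> pos_def 2 B \<longrightarrow>
          log_majorized 2 (SG \<alpha> p A B) (Renyi \<alpha> q A B))) \<and>
     ((\<forall>A B. pos_def 2 A \<longrightarrow> pos_def 2 B \<longrightarrow>
          log_majorized 2 (SG \<alpha> p A B) (Renyi \<alpha> q A B))
       \<longleftrightarrow> p / q \<le> min \<alpha> (1 - \<alpha>)) \<and>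
     ((\<forall>n \<ge> 1. \<forall>A B. psd n A \<longrightarrow> psd n B \<longrightarrow> loewner_le n (support_proj B) (support_proj A) \<longrightarrow>
          log_majorized n (Renyi \<alpha> q A B) (SG \<alpha> p A B))
       \<longleftrightarrow> (\<forall>A B. pos_def 2 A \<longrightarrow> pos_def 2 B \<longrightarrow>
          log_majorized 2 (Renyi \<alpha> q A B) (SG \<alpha> p A B))) \<and>
     ((\<forall>A B. pos_def 2 A \<longrightarrow> pos_def 2 B \<longrightarrow>
          log_majorized 2 (Renyi \<alpha> q A B) (SG \<alpha> p A B))
       \<longleftrightarrow> p / q \<ge> max \<alpha> (1 - \<alpha>))"
proof -
  let ?all1 = "\<forall>n \<ge> 1. \<forall>A B. psd n A \<longrightarrow> psd n B \<longrightarrow> loewner_le n (support_proj B) (support_proj A) \<longrightarrow>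
          log_majorized n (SG \<alpha> p A B) (Renyi \<alpha> q A B)"
  let ?two1 = "\<forall>A B. pos_def 2 A \<longrightarrow> pos_def 2 B \<longrightarrow> log_majorized 2 (SG \<alpha> p A B) (Renyi \<alpha> q A B)"
  let ?all2 = "\<forall>n \<ge> 1. \<forall>A B. psd n A \<longrightarrow> psd n B \<longrightarrow> loewner_le n (support_proj B) (support_proj A) \<longrightarrow>
          log_majorized n (Renyi \<alpha> q A B) (SG \<alpha> p A B)"
  let ?two2 = "\<forall>A B. pos_def 2 A \<longrightarrow> pos_def 2 B \<longrightarrow> log_majorized 2 (Renyi \<alpha> q A B) (SG \<alpha> p A B)"
  note pq = \<open>0 < p\<close> \<open>0 < q\<close> and \<alpha> = \<open>0 < \<alpha>\<close> \<open>\<alpha> < 1\<close>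
  have iii1: "p / q \<le> min \<alpha> (1 - \<alpha>) \<longleftrightarrow> p \<le> \<alpha> * q \<and> p \<le> (1 - \<alpha>) * q"
    and iii2: "p / q \<ge> max \<alpha> (1 - \<alpha>) \<longleftrightarrow> \<alpha> * q \<le> p \<and> (1 - \<alpha>) * q \<le> p"
    using pq by (simp_all add: pos_divide_le_eq pos_le_divide_eq)
  have restrict: "psd 2 A" "psd 2 B" "loewner_le 2 (support_proj B) (support_proj A)"
    if "pos_def 2 A" "pos_def 2 B" for A B
    using that by (simp_all add: fixed_dim.pos_def_psd fixed_dim.loewner_le_support_pos_def)
  have a: "?all1 \<Longrightarrow> ?two1" "?all2 \<Longrightarrow> ?two2"
    using restrict by (metis one_le_numeral)+
  \<comment> \<open>The choice \<open>\<kappa> = \<alpha>\<close> yields the condition with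
    \<open>1 - \<alpha>\<close>, and \<open>\<kappa> = 1 - \<alpha>\<close> the one with
    \<alpha>.\<close>
  have b1: "p / q \<le> min \<alpha> (1 - \<alpha>)" if "?two1"
    using necessity_SG_Renyi[OF \<alpha> pq, of \<alpha>] necessity_SG_Renyi[OF \<alpha> pq, of "1 - \<alpha>"] that unfolding iii1 by auto
  have b2: "p / q \<ge> max \<alpha> (1 - \<alpha>)" if "?two2"
    using necessity_Renyi_SG[OF \<alpha> pq, of \<alpha>] necessity_Renyi_SG[OF \<alpha> pq, of "1 - \<alpha>"] that unfolding iii2 by auto
  have c1: "?all1" if "p / q \<le> min \<alpha> (1 - \<alpha>)"
    using that unfolding iii1
    by (intro allI impI fixed_dim.SG_log_majorized_Renyi fixed_dim.support_condition \<alpha> pq) auto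
  have c2: "?all2" if "p / q \<ge> max \<alpha> (1 - \<alpha>)"
    using that unfolding iii2
    by (intro allI impI fixed_dim.Renyi_log_majorized_SG fixed_dim.support_condition \<alpha> pq) auto
  show ?thesis using a b1 b2 c1 c2 by blast
qed

end
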